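(* Let $G$ be a finite simple graph that contains no induced subgraph isomorphic to $P_5$ and no induced subgraph isomorphic to the gem. Then $\chi(G) \le \lceil \frac{5\omega(G)}{4}\rceil$. Moreover, this bound is tight: for every positive integer $q$ there exists a ($P_5$, gem)-free graph $G$ with $\omega(G)=2q$ and $\chi(G)=\lceil \frac{5\omega(G)}{4}\rceil$.
   Context: $P_5$ is the path on five vertices. The gem is the graph consisting of a path $P_4$ on four vertices together with one further vertex adjacent to all four vertices of the $P_4$. $\chi(G)$ denotes the chromatic number and $\omega(G)$ the clique number (size of a largest set of pairwise adjacent vertices) of $G$. *)

theory Defs
  imports Complex_Main "Graph_Theory.Graph_Theory"
begin

text \<open>
  A finite simple graph is a \<^locale>\<open>pair_graph\<close>: finitely many vertices and a symmetric,
  irreflexive set of vertex pairs, each edge being present in both orientations. The graph without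
  vertices is allowed; both of its invariants below are 0.
\<close>

definition path_graph :: "nat \<Rightarrow> nat pair_pre_digraph" where
  "path_graph n = \<lparr> pverts = {..<n},
     parcs = {(i, j). i < n \<and> j < n \<and> (j = Suc i \<or> i = Suc j)} \<rparr>"

text \<open>The vertices 0, 1, 2, 3 form the path, and 4 is the additional vertex.\<close>

definition gem :: "nat pair_pre_digraph" where
  "gem = \<lparr> pverts = insert 4 (pverts (path_graph 4)),
     parcs = parcs (path_graph 4) \<union> pverts (path_graph 4) \<times> {4} \<union> {4} \<times> pverts (path_graph 4) \<rparr>"

definition induced_free :: "'a pair_pre_digraph \<Rightarrow> 'b pair_pre_digraph \<Rightarrow> bool" where
  "induced_free G H \<longleftrightarrow>
     \<not> (\<exists>K. induced_subgraph K (with_proj G) \<and> digraph_iso K (with_proj H))"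

definition P5_gem_free :: "'a pair_pre_digraph \<Rightarrow> bool" where
  "P5_gem_free G \<longleftrightarrow> induced_free G (path_graph 5) \<and> induced_free G gem"

definition is_clique :: "'a pair_pre_digraph \<Rightarrow> 'a set \<Rightarrow> bool" where
  "is_clique G C \<longleftrightarrow> C \<subseteq> pverts G \<and> (\<forall>u\<in>C. \<forall>v\<in>C. u \<noteq> v \<longrightarrow> (u, v) \<in> parcs G)"

definition clique_number :: "'a pair_pre_digraph \<Rightarrow> nat" where
  "clique_number G = Max (card ` {C. is_clique G C})"

definition proper_colouring :: "'a pair_pre_digraph \<Rightarrow> nat \<Rightarrow> ('a \<Rightarrow> nat) \<Rightarrow> bool" where
  "proper_colouring G k c \<longleftrightarrow>
     c ` pverts G \<subseteq> {..<k} \<and> (\<forall>(u, v)\<in>parcs G. c u \<noteq> c v)"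

definition chromatic_number :: "'a pair_pre_digraph \<Rightarrow> nat" where
  "chromatic_number G = (LEAST k. \<exists>c. proper_colouring G k c)"

lemma pair_graphI:
  assumes "finite (pverts G)" "parcs G \<subseteq> pverts G \<times> pverts G" "sym (parcs G)" "irrefl (parcs G)"
  shows "pair_graph G"
proof -
  have "finite (parcs G)"
    using assms(1,2) by (blast intro: finite_subset)
  then show ?thesis
    using assms by unfold_locales (auto simp: symmetric_def irrefl_def)
qed

lemma pair_graph_path_graph: "pair_graph (path_graph n)"
  by (rule pair_graphI) (auto simp: path_graph_def sym_def irrefl_def)

lemma pair_graph_gem: "pair_graph gem"
  by (rule pair_graphI) (auto simp: gem_def path_graph_def sym_def irrefl_def)

text \<open>The maximum and the minimum above are attained for every finite simple graph.\<close>

lemma clique_number_attained: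
  assumes "pair_graph G"
  shows "\<exists>C. is_clique G C \<and> card C = clique_number G"
    and "is_clique G C \<Longrightarrow> card C \<le> clique_number G"
proof -
  interpret pair_graph G by fact
  have "{C. is_clique G C} \<subseteq> Pow (pverts G)"
    by (auto simp: is_clique_def)
  then have fin: "finite (card ` {C. is_clique G C})"
    by (intro finite_imageI finite_subset[OF _ finite_Pow_iff[THEN iffD2, OF pair_finite_verts]])
  have "is_clique G {}"
    by (simp add: is_clique_def)
  then have "clique_number G \<in> card ` {C. is_clique G C}"
    unfolding clique_number_def using fin by (intro Max_in) auto
  then show "\<exists>C. is_clique G C \<and> card C = clique_number G"
    by auto
  show "card C \<le> clique_number G" if "is_clique G C"
    unfolding clique_number_def using fin that by (intro Max_ge) auto
qed

lemma chromatic_number_attained: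
  assumes "pair_graph G"
  shows "\<exists>c. proper_colouring G (chromatic_number G) c"
proof -
  interpret pair_graph G by fact
  obtain c :: "'a \<Rightarrow> nat" and k where c: "c ` pverts G = {i. i < k}" "inj_on c (pverts G)"
    using finite_imp_inj_to_nat_seg[OF pair_finite_verts] by metis
  have "c u \<noteq> c v" if "(u, v) \<in> parcs G" for u v
    using that c(2) pair_no_loops[OF that] in_arcsD1[OF that] in_arcsD2[OF that]
    by (auto dest: inj_onD)
  then have "proper_colouring G k c"
    using c(1) by (auto simp: proper_colouring_def)
  then have "\<exists>c. proper_colouring G k c"
    by blast
  then show ?thesis
    unfolding chromatic_number_def by (rule LeastI[where P = "\<lambda>k. \<exists>c. proper_colouring G k c"])
qed

end

theory Submission
  imports Defs
begin

text \<open>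
  A minimal (\<open>P\<^sub>5\<close>, gem)-free graph without a \<open>C\<^sub>5\<close> and with \<open>\<chi> > \<omega>\<close> is connected and has no
  homogeneous sets, and the non-neighbourhood of each of its vertices is connected.
  This forces first an induced house, then two houses sharing their square or a prism, and finally
  a prism; around a prism the vertices split into two cliques joined by a matching, which is absurd.
  So every (\<open>P\<^sub>5\<close>, gem, \<open>C\<^sub>5\<close>)-free graph satisfies \<open>\<chi> = \<omega>\<close>; this applies to every neighbourhood in a
  gem-free graph.

  In a minimal graph with \<open>\<chi> > \<lceil>5\<omega>/4\<rceil>\<close> there is therefore an induced \<open>C\<^sub>5\<close>. A vertex outside an
  induced copy of one of nine patterns, the \<open>C\<^sub>5\<close> being the smallest of them, is a clone of a vertex
  of the copy, or has no neighbour in the copy, or yields a copy of a larger pattern; only for the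
  second pattern there is one further possibility. So, apart from this case, the graph is a blow-up of
  a maximal pattern that occurs in it.
  By minimality no stable set lowers \<open>\<omega>\<close>, and no five stable sets lower \<open>\<omega>\<close> by 4, because
  \<open>\<lceil>5(m - 4)/4\<rceil> = \<lceil>5m/4\<rceil> - 5\<close>. Applied to suitable unions of parts, this contradicts the linear
  inequalities between the clique numbers of the parts, except for the two smallest patterns, where a
  colouring of the blown-up \<open>C\<^sub>5\<close> is glued to a colouring of the rest.

  The bound is attained by the \<open>C\<^sub>5\<close> with every vertex replaced by a clique of size \<open>q\<close>: its stable
  sets have at most two vertices.
\<close>

section \<open>Cliques and colourings\<close>

text \<open>Two obstacles shape the argument. A further vertex is compared with one fixed copy of a
  pattern, and its type could change when a vertex of the copy is exchanged for a clone. The finite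
  condition \<open>rigid\<close>, evaluated for each pattern, excludes this: a change of type would
  create a P5 or a gem. Hence the types do not depend on the copy, and the classes of equal type are
  joined to each other exactly as in the pattern. The inside of a class must be controlled as well.
  A class lies in the neighbourhood of every vertex of an adjacent class; in a gem-free graph such a
  neighbourhood has no induced C5, so the class can be coloured with as many colours as its clique
  number. From then on only the clique numbers of the classes matter, and a linear problem remains.
  The factor 5/4 comes from the five-cycle of classes: the clique inequalities of the five pairs of
  consecutive classes add up to twice the total weight being at most 5\<omega>, so the total weight
  is at most 2k as soon as 5\<omega> \<le> 4k.\<close>

locale adj_graph =
  fixes E :: "'a \<Rightarrow> 'a \<Rightarrow> bool"
  assumes E_sym: "E u v \<Longrightarrow> E v u"
    and E_irrefl: "\<not> E u u"
begin

lemma E_commute: "E u v \<longleftrightarrow> E v u"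
  using E_sym by blast

definition clique :: "'a set \<Rightarrow> bool" where
  "clique K \<longleftrightarrow> (\<forall>u\<in>K. \<forall>v\<in>K. u \<noteq> v \<longrightarrow> E u v)"

definition stable :: "'a set \<Rightarrow> bool" where
  "stable S \<longleftrightarrow> (\<forall>u\<in>S. \<forall>v\<in>S. \<not> E u v)"

definition om :: "'a set \<Rightarrow> nat" where
  "om V = Max (card ` {K. K \<subseteq> V \<and> clique K})"

definition proper :: "'a set \<Rightarrow> ('a \<Rightarrow> 'b) \<Rightarrow> bool" where
  "proper V c \<longleftrightarrow> (\<forall>u\<in>V. \<forall>v\<in>V. E u v \<longrightarrow> c u \<noteq> c v)"

definition colourable :: "'a set \<Rightarrow> nat \<Rightarrow> bool" where
  "colourable V k \<longleftrightarrow> (\<exists>c :: 'a \<Rightarrow> nat. c ` V \<subseteq> {..<k} \<and> proper V c)"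

text \<open>In this and the next two definitions distinctness comes for free: the prescribed edges
  and non-edges already separate any two of the five vertices.\<close>

definition is_P5 :: "'a \<Rightarrow> 'a \<Rightarrow> 'a \<Rightarrow> 'a \<Rightarrow> 'a \<Rightarrow> bool" where
  "is_P5 a b c d e \<longleftrightarrow> E a b \<and> E b c \<and> E c d \<and> E d e \<and>
     \<not> E a c \<and> \<not> E a d \<and> \<not> E a e \<and> \<not> E b d \<and> \<not> E b e \<and> \<not> E c e"

definition is_gem :: "'a \<Rightarrow> 'a \<Rightarrow> 'a \<Rightarrow> 'a \<Rightarrow> 'a \<Rightarrow> bool" where
  "is_gem a b c d e \<longleftrightarrow> E a b \<and> E b c \<and> E c d \<and> E e a \<and> E e b \<and> E e c \<and> E e d \<and>
     \<not> E a c \<and> \<not> E a d \<and> \<not> E b d"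

definition is_C5 :: "'a \<Rightarrow> 'a \<Rightarrow> 'a \<Rightarrow> 'a \<Rightarrow> 'a \<Rightarrow> bool" where
  "is_C5 a b c d e \<longleftrightarrow> E a b \<and> E b c \<and> E c d \<and> E d e \<and> E e a \<and>
     \<not> E a c \<and> \<not> E a d \<and> \<not> E b d \<and> \<not> E b e \<and> \<not> E c e"

definition pg_free :: "'a set \<Rightarrow> bool" where
  "pg_free V \<longleftrightarrow> (\<forall>a b c d e. {a, b, c, d, e} \<subseteq> V \<longrightarrow> \<not> is_P5 a b c d e \<and> \<not> is_gem a b c d e)"

definition C5_free :: "'a set \<Rightarrow> bool" where
  "C5_free V \<longleftrightarrow> (\<forall>a b c d e. {a, b, c, d, e} \<subseteq> V \<longrightarrow> \<not> is_C5 a b c d e)"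

lemma no_P5:
  assumes "pg_free V" "{a, b, c, d, e} \<subseteq> V" "E a b" "E b c" "E c d" "E d e"
    "\<not> E a c" "\<not> E a d" "\<not> E a e" "\<not> E b d" "\<not> E b e" "\<not> E c e"
  shows False
proof -
  have "is_P5 a b c d e"
    unfolding is_P5_def using assms(3-) by (intro conjI)
  then show ?thesis
    using assms(1,2) unfolding pg_free_def by (elim allE impE) auto
qed

lemma no_gem:
  assumes "pg_free V" "{a, b, c, d, e} \<subseteq> V" "E a b" "E b c" "E c d" "E e a" "E e b" "E e c" "E e d"
    "\<not> E a c" "\<not> E a d" "\<not> E b d"
  shows False
proof -
  have "is_gem a b c d e"
    unfolding is_gem_def using assms(3-) by (intro conjI)
  then show ?thesis
    using assms(1,2) unfolding pg_free_def by (elim allE impE) auto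
qed

lemma no_C5:
  assumes "C5_free V" "{a, b, c, d, e} \<subseteq> V" "E a b" "E b c" "E c d" "E d e" "E e a"
    "\<not> E a c" "\<not> E a d" "\<not> E b d" "\<not> E b e" "\<not> E c e"
  shows False
proof -
  have "is_C5 a b c d e"
    unfolding is_C5_def using assms(3-) by (intro conjI)
  then show ?thesis
    using assms(1,2) unfolding C5_free_def by (elim allE impE) auto
qed

lemma pg_free_subset:
  assumes "pg_free V" "W \<subseteq> V"
  shows "pg_free W"
  unfolding pg_free_def
proof (intro allI impI)
  fix a b c d e assume "{a, b, c, d, e} \<subseteq> W"
  then have "{a, b, c, d, e} \<subseteq> V"
    using assms(2) by (rule subset_trans)
  then show "\<not> is_P5 a b c d e \<and> \<not> is_gem a b c d e"
    using assms(1) unfolding pg_free_def by (elim allE impE)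
qed

lemma C5_free_subset:
  assumes "C5_free V" "W \<subseteq> V"
  shows "C5_free W"
  unfolding C5_free_def
proof (intro allI impI)
  fix a b c d e assume "{a, b, c, d, e} \<subseteq> W"
  then have "{a, b, c, d, e} \<subseteq> V"
    using assms(2) by (rule subset_trans)
  then show "\<not> is_C5 a b c d e"
    using assms(1) unfolding C5_free_def by (elim allE impE)
qed

lemma clique_subset: "clique K \<Longrightarrow> L \<subseteq> K \<Longrightarrow> clique L"
  unfolding clique_def by blast

lemma clique_insert: "clique K \<Longrightarrow> (\<And>u. u \<in> K \<Longrightarrow> u \<noteq> v \<Longrightarrow> E u v) \<Longrightarrow> clique (insert v K)"
  unfolding clique_def using E_sym by blast

lemma om_finite: "finite V \<Longrightarrow> finite (card ` {K. K \<subseteq> V \<and> clique K})"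
  by simp

lemma om_ge: "finite V \<Longrightarrow> K \<subseteq> V \<Longrightarrow> clique K \<Longrightarrow> card K \<le> om V"
  unfolding om_def by (intro Max_ge om_finite) auto

lemma om_attained:
  assumes "finite V"
  obtains K where "K \<subseteq> V" "clique K" "card K = om V"
proof -
  have "{} \<in> {K. K \<subseteq> V \<and> clique K}"
    by (simp add: clique_def)
  then have "om V \<in> card ` {K. K \<subseteq> V \<and> clique K}"
    unfolding om_def using assms by (intro Max_in om_finite) auto
  then show ?thesis
    using that by force
qed

lemma om_le: "finite V \<Longrightarrow> (\<And>K. K \<subseteq> V \<Longrightarrow> clique K \<Longrightarrow> card K \<le> m) \<Longrightarrow> om V \<le> m"
  by (metis om_attained)

lemma om_mono: "finite V \<Longrightarrow> W \<subseteq> V \<Longrightarrow> om W \<le> om V"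
  by (meson finite_subset om_ge om_le order_trans)

lemma om_pos: "finite V \<Longrightarrow> v \<in> V \<Longrightarrow> 1 \<le> om V"
  using om_ge[of V "{v}"] by (auto simp: clique_def)

lemma proper_subset: "proper V c \<Longrightarrow> W \<subseteq> V \<Longrightarrow> proper W c"
  unfolding proper_def by blast

lemma properI: "(\<And>u v. u \<in> V \<Longrightarrow> v \<in> V \<Longrightarrow> E u v \<Longrightarrow> c u \<noteq> c v) \<Longrightarrow> proper V c"
  unfolding proper_def by blast

lemma properD: "proper V c \<Longrightarrow> u \<in> V \<Longrightarrow> v \<in> V \<Longrightarrow> E u v \<Longrightarrow> c u \<noteq> c v"
  unfolding proper_def by blast

lemma proper_inj_clique: "proper V c \<Longrightarrow> K \<subseteq> V \<Longrightarrow> clique K \<Longrightarrow> inj_on c K"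
  unfolding proper_def clique_def inj_on_def by blast

text \<open>Colourings are moved to an arbitrary palette, so that a set can be recoloured with
  colours that are already in use elsewhere.\<close>

lemma colourable_with:
  fixes C :: "'b set"
  assumes "colourable V k" "finite C" "k \<le> card C"
  obtains c where "c ` V \<subseteq> C" "proper V c"
proof -
  obtain c :: "'a \<Rightarrow> nat" where c: "c ` V \<subseteq> {..<k}" "proper V c"
    using assms(1) unfolding colourable_def by blast
  obtain h where h: "h ` {..<k} \<subseteq> C" "inj_on h {..<k}"
    using card_le_inj[of "{..<k}" C] assms(2,3) by auto
  show ?thesis
  proof (rule that[of "h \<circ> c"])
    show "(h \<circ> c) ` V \<subseteq> C"
      using c(1) h(1) by auto
    have "h (c u) \<noteq> h (c v)" if "u \<in> V" "v \<in> V" "E u v" for u v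
      using that c h(2) unfolding proper_def inj_on_def by blast
    then show "proper V (h \<circ> c)"
      unfolding proper_def by auto
  qed
qed

lemma colourable_mono:
  assumes "colourable V k" "k \<le> m" "W \<subseteq> V"
  shows "colourable W m"
proof -
  obtain c where c: "c ` V \<subseteq> {..<k}" "proper V c"
    using assms(1) unfolding colourable_def by blast
  have "c ` W \<subseteq> {..<m}"
    using c(1) assms(2,3) by force
  then show ?thesis
    unfolding colourable_def using proper_subset[OF c(2) assms(3)] by blast
qed

lemma colourable_empty: "colourable {} 0"
  by (auto simp: colourable_def proper_def)

lemma colourable_stable:
  assumes "colourable (V - S) k" "stable S"
  shows "colourable V (Suc k)"
proof -
  obtain c :: "'a \<Rightarrow> nat" where c: "c ` (V - S) \<subseteq> {..<k}" "proper (V - S) c"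
    using assms(1) unfolding colourable_def by blast
  define d where "d v = (if v \<in> S then k else c v)" for v
  have ck: "c w < k" if "w \<in> V" "w \<notin> S" for w
    using c(1) that by blast
  have "d ` V \<subseteq> {..<Suc k}"
    using ck by (auto simp: d_def less_Suc_eq)
  moreover have "proper V d"
  proof (rule properI)
    fix u v assume uv: "u \<in> V" "v \<in> V" "E u v"
    then have "\<not> (u \<in> S \<and> v \<in> S)"
      using assms(2) unfolding stable_def by blast
    moreover have "c u \<noteq> c v" if "u \<notin> S" "v \<notin> S"
      using properD[OF c(2)] uv that by blast
    ultimately show "d u \<noteq> d v"
      using ck[of u] ck[of v] uv(1,2) by (auto simp: d_def)
  qed
  ultimately show ?thesis
    unfolding colourable_def by blast
qed

lemma colourable_Un:
  assumes "colourable X k" "colourable Y k" "\<And>x y. x \<in> X \<Longrightarrow> y \<in> Y \<Longrightarrow> \<not> E x y"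
  shows "colourable (X \<union> Y) k"
proof -
  obtain c d :: "'a \<Rightarrow> nat" where c: "c ` X \<subseteq> {..<k}" "proper X c" and d: "d ` Y \<subseteq> {..<k}" "proper Y d"
    using assms(1,2) unfolding colourable_def by blast
  define e where "e v = (if v \<in> X then c v else d v)" for v
  have "e ` (X \<union> Y) \<subseteq> {..<k}"
    using c(1) d(1) by (auto simp: e_def)
  moreover have "proper (X \<union> Y) e"
  proof (rule properI)
    fix u v assume uv: "u \<in> X \<union> Y" "v \<in> X \<union> Y" "E u v"
    show "e u \<noteq> e v"
      using uv properD[OF c(2), of u v] properD[OF d(2), of u v]
        assms(3)[of u v] assms(3)[of v u] E_sym[of u v]
      by (auto simp: e_def)
  qed
  ultimately show ?thesis
    unfolding colourable_def by blast
qed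

end

section \<open>Small patterns and the traces of further vertices\<close>

text \<open>A pattern is a graph on an initial segment of the natural numbers; entry \<open>i\<close> of the list
  contains the neighbours of \<open>i\<close> that are smaller than \<open>i\<close>.\<close>

definition adj :: "nat list list \<Rightarrow> nat \<Rightarrow> nat \<Rightarrow> bool" where
  "adj g i j = (if j < i then List.member (g ! i) j else List.member (g ! j) i)"

lemma adj_sym: "i \<noteq> j \<Longrightarrow> adj g i j \<longleftrightarrow> adj g j i"
  by (auto simp: adj_def)

text \<open>A member \<open>(ns, ms)\<close> of \<open>quad h g p q r s\<close> says that a further vertex adjacent to
  all of \<open>ns\<close> and to none of \<open>ms\<close> completes \<open>p, q, r, s\<close> to a \<open>P\<^sub>5\<close>, to a gem or, if \<open>h\<close> holds, to a
  \<open>C\<^sub>5\<close>. Four vertices of any of these graphs span an edge, so \<open>p\<close> and \<open>q\<close> may be assumed adjacent.\<close>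

definition quad :: "bool \<Rightarrow> nat list list \<Rightarrow> nat \<Rightarrow> nat \<Rightarrow> nat \<Rightarrow> nat \<Rightarrow> (nat list \<times> nat list) list" where
  "quad h g p q r s =
    (if adj g q r then
       if adj g p r then
         if adj g p s then
           if adj g r s then []
           else if adj g q s then [([p, r], [q, s])] else [([p, q, s], [r])]
         else []
       else if adj g p s then []
       else if adj g q s then []
       else if adj g r s then ([p, q, r, s], []) # ([p], [q, r, s]) # (if h then [([p, s], [q, r])] else [])
       else [([p, s], [q, r])]
     else if adj g p r then []
     else if adj g p s then []
     else if adj g q s then []
     else if adj g r s then [([q, r], [p, s])]
     else [])"

text \<open>Only quadruples that contain \<open>k\<close> are listed, because the others were tested
  when the trace was shorter: \<open>s\<close> is forced to be \<open>k\<close> unless one of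
  \<open>p\<close>, \<open>q\<close>, \<open>r\<close> is \<open>k\<close>. Nested conditionals take
  the place of conjunctions so that hopeless quadruples are cut off early in the evaluation.\<close>

definition clauses :: "bool \<Rightarrow> nat list list \<Rightarrow> nat \<Rightarrow> (nat list \<times> nat list) list" where
  "clauses h g k =
    concat (map (\<lambda>p. concat (map (\<lambda>q. if p = q then [] else if adj g p q then
      concat (map (\<lambda>r. if r = p then [] else if r = q then [] else
        concat (map (\<lambda>s. if s = p then [] else if s = q then [] else if s = r then [] else quad h g p q r s)
          (if p = k \<or> q = k \<or> r = k then [0..<Suc k] else [k]))) [0..<Suc k]) else
            []) [0..<Suc k])) [0..<Suc k])"

definition violates :: "nat list \<Rightarrow> nat list \<times> nat list \<Rightarrow> bool" where
  "violates T c \<longleftrightarrow> (if list_all (List.member T) (fst c) then \<not> list_ex (List.member T) (snd c) else False)"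

text \<open>The sets of neighbours, as increasing lists, that a further vertex can have among the
  first \<open>k\<close> vertices of \<open>g\<close>.\<close>

fun exts :: "bool \<Rightarrow> nat list list \<Rightarrow> nat \<Rightarrow> nat list list" where
  "exts h g 0 = [[]]"
| "exts h g (Suc k) = (let cs = clauses h g k in
     filter (\<lambda>T. \<not> list_ex (violates T) cs) (concat (map (\<lambda>T. [T, T @ [k]]) (exts h g k))))"

definition clone :: "nat list list \<Rightarrow> nat list \<Rightarrow> nat \<Rightarrow> bool" where
  "clone g T i \<longleftrightarrow> list_all (\<lambda>j. if j = i then True else List.member T j = adj g i j) [0..<length g]"

definition copy_at :: "nat list list \<Rightarrow> nat list \<Rightarrow> nat list list \<Rightarrow> bool" where
  "copy_at g e g' \<longleftrightarrow> length e = length g \<and> list_all (\<lambda>i. i < length g') e \<and> distinct e \<and>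
     list_all (\<lambda>i. list_all (\<lambda>j. adj g i j = adj g' (e ! i) (e ! j)) [0..<i]) [0..<length g]"

text \<open>The list \<open>bs\<close> is a certificate: each possible trace that belongs neither to a clone nor to
  \<open>ex\<close> occurs in it, together with a pattern \<open>g'\<close> that it creates and the position \<open>e\<close> of \<open>g'\<close>.\<close>

definition closed :: "bool \<Rightarrow> nat list list \<Rightarrow> nat list list \<Rightarrow> (nat list \<times> nat list \<times> nat list list) list
  \<Rightarrow> bool" where
  "closed h g ex bs \<longleftrightarrow> list_all (\<lambda>T. if list_ex (clone g T) [0..<length g] then True
     else if List.member ex T then True
     else list_ex (\<lambda>(T', e, g'). if T = T' then copy_at g' e (g @ [T]) else
       False) bs) (exts h g (length g))"

text \<open>The three conditions say that no vertex has a twin, that no trace in \<open>ex\<close> contains the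
  neighbourhood of a vertex even after a replacement of another vertex by a clone, and that
  a vertex cannot change its type under such a replacement.\<close>

definition rigid :: "nat list list \<Rightarrow> nat list list \<Rightarrow> bool" where
  "rigid g ex \<longleftrightarrow>
     (\<forall>i\<in>set [0..<length g]. \<forall>j\<in>set [0..<length g]. if i = j then True else
       (\<exists>l\<in>set [0..<length g]. l \<noteq> i \<and> l \<noteq> j \<and> adj g i l \<noteq> adj g j l)) \<and>
     (\<forall>T\<in>set ex. \<forall>i\<in>set [0..<length g]. \<forall>j\<in>set [0..<length g]. \<exists>l\<in>set [0..<length g]. l \<noteq> i \<and> l \<noteq> j \<and>
       adj g j l \<and> l \<notin> set T) \<and>
     (\<forall>i\<in>set [0..<length g]. \<forall>j\<in>set [0..<length g]. if i = j \<or> adj g j i then True else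
       (\<forall>k\<in>set [0..<length g]. if k = i \<or> k = j \<or> \<not> adj g k i then True
         else if \<forall>l\<in>set [0..<length g]. l = i \<or> l = j \<or> l = k \<or> adj g k l = adj g j l
         then if adj g j k then \<exists>l\<in>set [0..<length g]. l \<noteq> i \<and> l \<noteq> j \<and> l \<noteq> k \<and> adj g i l \<and> \<not> adj g j l
           else (\<exists>l\<in>set [0..<length g]. l \<noteq> i \<and> l \<noteq> j \<and> l \<noteq> k \<and> adj g j l \<and> \<not> adj g i l) \<and>
             (\<exists>l\<in>set [0..<length g]. l \<noteq> i \<and> l \<noteq> j \<and> l \<noteq> k \<and> adj g j l \<and> adj g i l)
         else True))"

text \<open>These patterns arise from the \<open>C\<^sub>5\<close> by successively closing under the traces that are not
  clones.\<close>

definition "F0 = [[], [0], [1], [2], [0, 3::nat]]"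
definition "F1 = F0 @ [[0, 1, 3]]"
definition "F2 = F1 @ [[0, 2]]"
definition "F3 = F1 @ [[0, 2, 3]]"
definition "F4 = F3 @ [[1, 4, 6]]"
definition "F5 = F3 @ [[5, 6]]"
definition "F6 = F3 @ [[0, 2]]"
definition "F7 = F4 @ [[2, 4, 5, 7]]"
definition "F8 = F6 @ [[1, 3, 7]]"
text \<open>The prism consists of the triangles 0, 1, 2 and 3, 4, 5 with \<open>i\<close> matched to
  \<open>i + 3\<close>. The double house is the square 0, 1, 2, 3 with the roof 4 over the edge 01
  and the roof 5 over the opposite edge 23.\<close>

definition "Prism = [[], [0], [0, 1], [0], [1, 3], [2, 3, 4::nat]]"
definition "Double_house = [[], [0], [1], [0, 2], [0, 1], [2, 3::nat]]"

text \<open>A vertex that is neither a clone nor without neighbours on the cycle sees the ends of an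
  edge and the vertex opposite to that edge; the five rotations of this trace all lead to
  \<open>F1\<close>.\<close>

lemma closed_F0: "closed False F0 [[]] [([0, 1, 3], [0, 1, 2, 3, 4, 5], F1),
  ([0, 2, 3], [2, 3, 4, 0, 1, 5], F1),
    ([0, 2, 4], [0, 4, 3, 2, 1, 5], F1), ([1, 2, 4], [1, 2, 3, 4, 0, 5], F1),
      ([1, 3, 4], [3, 4, 0, 1, 2, 5], F1)]"
  by code_simp
lemma closed_F1: "closed False F1 [[], [5]] [([0, 2], [0, 1, 2, 3, 4, 5, 6], F2),
  ([0, 2, 3], [0, 1, 2, 3, 4, 5, 6], F3),
    ([1, 4], [1, 0, 4, 3, 2, 5, 6], F2), ([1, 3, 4], [1, 0, 4, 3, 2, 5, 6], F3)]"
  by code_simp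
lemma closed_F2: "closed False F2 [[]] [([0, 2, 3], [0, 1, 2, 3, 4, 5, 7, 6], F6),
    ([1, 3, 4, 6], [1, 0, 4, 3, 2, 5, 7, 6], F4), ([2, 4, 5, 6], [5, 0, 6, 2, 3, 1, 7, 4], F4)]"
  by code_simp
lemma closed_F3: "closed False F3 [[]] [([0, 2], [0, 1, 2, 3, 4, 5, 6, 7], F6),
  ([1, 3], [3, 2, 1, 0, 4, 6, 5, 7], F6),
    ([2, 4, 5], [3, 2, 1, 0, 4, 6, 5, 7], F4), ([1, 4, 6], [0, 1, 2, 3, 4, 5, 6, 7], F4),
    ([5, 6], [0, 1, 2, 3, 4, 5, 6, 7], F5)]"
  by code_simp
lemma closed_F4: "closed False F4 [[]] [([1, 3], [1, 0, 6, 3, 8, 5, 2, 7, 4], F8),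
  ([2, 4, 5, 7], [0, 1, 2, 3, 4, 5, 6, 7, 8], F7)]"
  by code_simp
lemma closed_F5: "closed False F5 [[]] []"
  by code_simp
lemma closed_F6: "closed False F6 [[]] [([2, 4, 5], [0, 5, 3, 2, 7, 1, 6, 4, 8], F8),
  ([1, 3, 7], [0, 1, 2, 3, 4, 5, 6, 7, 8], F8)]"
  by code_simp
lemma closed_F7: "closed False F7 [[]] []"
  by code_simp
lemma closed_F8: "closed False F8 [[]] []"
  by code_simp
lemma rigid_all: "list_all (\<lambda>g. rigid g [[]]) [F0, F2, F3, F4, F5, F6, F7, F8, Double_house]"
  "rigid F1 [[], [5]]"
  by code_simp+

lemma closed_Double_house: "closed True Double_house [[]]
    [([2, 3, 4, 5], [0, 1, 4, 3, 2, 6], Prism), ([0, 1, 4, 5], [2, 3, 5, 1, 0, 6], Prism)]"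
  by code_simp
lemma exts_Prism: "exts True Prism 6 = [[], [3, 4, 5], [2, 3, 4], [2, 3, 4, 5], [1, 3, 5], [1, 3, 4, 5],
  [1, 2, 3], [0, 4, 5], [0, 3, 4, 5], [0, 2, 4], [0, 1, 5], [0, 1, 2], [0, 1, 2, 5], [0, 1, 2, 4],
    [0, 1, 2, 3]]"
  by code_simp

section \<open>Copies of a pattern and the types of further vertices\<close>

context adj_graph
begin

text \<open>Non-adjacent twins of \<open>g\<close> may have the same image.\<close>

definition embeds :: "'a set \<Rightarrow> nat list list \<Rightarrow> (nat \<Rightarrow> 'a) \<Rightarrow> bool" where
  "embeds V g f \<longleftrightarrow> (\<forall>i<length g. f i \<in> V) \<and>
     (\<forall>i<length g. \<forall>j<length g. i \<noteq> j \<longrightarrow> (E (f i) (f j) \<longleftrightarrow> adj g i j))"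

definition trace :: "(nat \<Rightarrow> 'a) \<Rightarrow> nat \<Rightarrow> 'a \<Rightarrow> nat list" where
  "trace f n x = filter (\<lambda>i. E x (f i)) [0..<n]"

text \<open>Nothing is said about the adjacency of \<open>x\<close> and \<open>f i\<close>.\<close>

definition like :: "nat list list \<Rightarrow> (nat \<Rightarrow> 'a) \<Rightarrow> nat \<Rightarrow> 'a \<Rightarrow> bool" where
  "like g f i x \<longleftrightarrow> (\<forall>j<length g. j \<noteq> i \<longrightarrow> (E x (f j) \<longleftrightarrow> adj g i j))"

lemma embedsD:
  assumes "embeds V g f"
  shows "i < length g \<Longrightarrow> f i \<in> V"
    and "i < length g \<Longrightarrow> j < length g \<Longrightarrow> i \<noteq> j \<Longrightarrow> E (f i) (f j) \<longleftrightarrow> adj g i j"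
  using assms unfolding embeds_def by auto

lemma mem_trace [simp]: "i \<in> set (trace f n x) \<longleftrightarrow> i < n \<and> E x (f i)"
  by (auto simp: trace_def)

lemma clone_like: "clone g (trace f (length g) x) i \<longleftrightarrow> like g f i x"
  by (auto simp: clone_def like_def list_all_iff)

text \<open>A P5, a gem or a C5 without one of its vertices is a diamond, a paw, a P4, a P3 with an
  isolated vertex, or two disjoint edges. These are the cases, and \<open>x\<close> plays the part
  of the removed vertex.\<close>

lemma quad_sound:
  assumes pg: "pg_free V" and h: "h \<Longrightarrow> C5_free V" and mem: "{a, b, c, d, x} \<subseteq> V"
    and adj: "adj g p q" "E a b \<longleftrightarrow> adj g p q" "E a c \<longleftrightarrow> adj g p r" "E a d \<longleftrightarrow> adj g p s"
      "E b c \<longleftrightarrow> adj g q r" "E b d \<longleftrightarrow> adj g q s" "E c d \<longleftrightarrow> adj g r s"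
    and ns: "ns \<in> set (quad h g p q r s)"
    and P: "P p \<longleftrightarrow> E x a" "P q \<longleftrightarrow> E x b" "P r \<longleftrightarrow> E x c" "P s \<longleftrightarrow> E x d"
  shows "\<not> ((\<forall>i\<in>set (fst ns). P i) \<and> (\<forall>i\<in>set (snd ns). \<not> P i))"
proof
  assume *: "(\<forall>i\<in>set (fst ns). P i) \<and> (\<forall>i\<in>set (snd ns). \<not> P i)"
  consider
    (diamond) "ns = ([p, r], [q, s])" "adj g q r" "adj g p r" "adj g p s" "\<not> adj g r s" "adj g q s"
  | (paw) "ns = ([p, q, s], [r])" "adj g q r" "adj g p r" "adj g p s" "\<not> adj g r s" "\<not> adj g q s"
  | (path) "ns = ([p, q, r, s], []) \<or> ns = ([p], [q, r, s]) \<or> (h \<and> ns = ([p, s], [q, r]))"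
      "adj g q r" "\<not> adj g p r" "\<not> adj g p s" "\<not> adj g q s" "adj g r s"
  | (isolated) "ns = ([p, s], [q, r])" "adj g q r" "\<not> adj g p r" "\<not> adj g p s" "\<not> adj g q s" "\<not> adj g r s"
  | (edges) "ns = ([q, r], [p, s])" "\<not> adj g q r" "\<not> adj g p r" "\<not> adj g p s" "\<not> adj g q s" "adj g r s"
    using ns by (auto simp: quad_def split: if_splits)
  then show False
  proof cases
    case diamond
    then show False
      using no_gem[OF pg, of x c b d a] mem adj P * by (auto simp: E_commute)
  next
    case paw
    then show False
      using no_gem[OF pg, of c b x d a] mem adj P * by (auto simp: E_commute)
  next
    case path
    then show False
      using no_gem[OF pg, of a b c d x] no_P5[OF pg, of x a b c d] no_C5[OF h, of x a b c d] mem adj P *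
      by (auto simp: E_commute)
  next
    case isolated
    then show False
      using no_P5[OF pg, of d x a b c] mem adj P * by (auto simp: E_commute)
  next
    case edges
    then show False
      using no_P5[OF pg, of a b x c d] mem adj P * by (auto simp: E_commute)
  qed
qed

lemma quad_indices: "ns \<in> set (quad h g p q r s) \<Longrightarrow> set (fst ns) \<union> set (snd ns) \<subseteq> {p, q, r, s}"
  by (auto simp: quad_def split: if_splits)

lemma set_clauses:
  assumes "ns \<in> set (clauses h g k)"
  obtains p q r s where "p \<le> k" "q \<le> k" "r \<le> k" "s \<le> k" "distinct [p, q, r, s]" "adj g p q"
    "ns \<in> set (quad h g p q r s)"
proof -
  have "\<exists>p q r s. p \<le> k \<and> q \<le> k \<and> r \<le> k \<and> s \<le> k \<and> distinct [p, q, r, s] \<and> adj g p q \<and>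
    ns \<in> set (quad h g p q r s)"
    using assms unfolding clauses_def
    by (auto simp: less_Suc_eq_le split: if_splits simp del: upt_Suc) (use order_refl[of k] in blast)+
  then show ?thesis
    using that by blast
qed

lemma trace_in_exts:
  assumes pg: "pg_free V" and h: "h \<Longrightarrow> C5_free V" and f: "embeds V g f" and x: "x \<in> V"
  shows "k \<le> length g \<Longrightarrow> trace f k x \<in> set (exts h g k)"
proof (induction k)
  case 0
  then show ?case
    by (simp add: trace_def)
next
  case (Suc k)
  have "\<not> violates (trace f (Suc k) x) ns" if ns: "ns \<in> set (clauses h g k)" for ns
  proof -
    obtain p q r s where q: "p \<le> k" "q \<le> k" "r \<le> k" "s \<le> k" "distinct [p, q, r, s]" "adj g p q"
        "ns \<in> set (quad h g p q r s)"
      using set_clauses[OF ns] .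
    have "\<not> ((\<forall>i\<in>set (fst ns). E x (f i)) \<and> (\<forall>i\<in>set (snd ns). \<not> E x (f i)))"
      by (rule quad_sound[OF pg h _ q(6) _ _ _ _ _ _ q(7), of "f p" "f q" "f r" "f s" x])
        (use q(1-5) x embedsD[OF f] Suc.prems in auto)
    moreover have "i \<le> k" if "i \<in> set (fst ns) \<union> set (snd ns)" for i
      using that quad_indices[OF q(7)] q(1-4) by auto
    ultimately show ?thesis
      unfolding violates_def by (auto simp: list_all_iff list_ex_iff less_Suc_eq_le)
  qed
  moreover have "trace f (Suc k) x = trace f k x \<or> trace f (Suc k) x = trace f k x @ [k]"
    by (simp add: trace_def)
  ultimately show ?case
    using Suc by (auto simp: Let_def list_ex_iff)
qed

lemma embeds_snoc:
  assumes "embeds V g f" "x \<in> V"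
  shows "embeds V (g @ [trace f (length g) x]) (f(length g := x))"
proof -
  let ?g = "g @ [trace f (length g) x]"
  have "E x (f j) \<longleftrightarrow> adj ?g (length g) j" "E (f j) x \<longleftrightarrow> adj ?g j (length g)" if "j < length g" for j
    using that E_commute[of x "f j"] by (auto simp: adj_def nth_append)
  moreover have "adj ?g i j \<longleftrightarrow> adj g i j" if "i < length g" "j < length g" for i j
    using that by (simp add: adj_def nth_append)
  ultimately show ?thesis
    using assms unfolding embeds_def by (auto simp: less_Suc_eq)
qed

lemma embeds_copy:
  assumes "embeds V g' f" "copy_at g e g'"
  shows "embeds V g (\<lambda>i. f (e ! i))"
proof -
  have e: "length e = length g" "distinct e" "\<And>i. i < length g \<Longrightarrow> e ! i < length g'"
    and adj: "\<And>i j. i < length g \<Longrightarrow> j < i \<Longrightarrow> adj g i j \<longleftrightarrow> adj g' (e ! i) (e ! j)"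
    using assms(2) by (auto simp: copy_at_def list_all_iff all_set_conv_all_nth)
  have "adj g i j \<longleftrightarrow> adj g' (e ! i) (e ! j)" if "i < length g" "j < length g" "i \<noteq> j" for i j
  proof -
    have "e ! i \<noteq> e ! j"
      using that e(1,2) by (simp add: nth_eq_iff_index_eq)
    then show ?thesis
      using that adj[of i j] adj[of j i] adj_sym[of i j g] adj_sym[of "e ! i" "e ! j" g']
      by (metis linorder_neqE_nat)
  qed
  then show ?thesis
    using embedsD[OF assms(1)] e unfolding embeds_def by (simp add: nth_eq_iff_index_eq)
qed

lemma closed_cases:
  assumes cl: "closed h g ex bs" and pg: "pg_free V" and h: "h \<Longrightarrow> C5_free V"
    and f: "embeds V g f" and x: "x \<in> V"
  obtains i where "i < length g" "like g f i x"
  | "trace f (length g) x \<in> set ex"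
  | T e g' f' where "(T, e, g') \<in> set bs" "embeds V g' f'"
proof -
  let ?T = "trace f (length g) x"
  have "?T \<in> set (exts h g (length g))"
    using trace_in_exts[OF pg h f x] by simp
  then consider "list_ex (clone g ?T) [0..<length g]" | "?T \<in> set ex"
    | e g' where "(?T, e, g') \<in> set bs" "copy_at g' e (g @ [?T])"
    using cl unfolding closed_def by (auto simp: list_all_iff list_ex_iff split: if_splits)
  then show ?thesis
  proof cases
    case 1
    then show ?thesis
      using that(1) by (auto simp: list_ex_iff clone_like)
  next
    case 2
    then show ?thesis
      using that(2) by simp
  next
    case (3 e g')
    then show ?thesis
      using that(3) embeds_copy[OF embeds_snoc[OF f x]] by blast
  qed
qed

lemma likeD: "like g f i x \<Longrightarrow> j < length g \<Longrightarrow> j \<noteq> i \<Longrightarrow> E x (f j) \<longleftrightarrow> adj g i j"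
  unfolding like_def by blast

lemma embeds_like:
  assumes f: "embeds V g f" and x: "x \<in> V" "like g f i x"
  shows "embeds V g (f(i := x))"
  unfolding embeds_def
proof (intro conjI allI impI)
  fix a b assume ab: "a < length g" "b < length g" "a \<noteq> b"
  show "E ((f(i := x)) a) ((f(i := x)) b) \<longleftrightarrow> adj g a b"
    using ab embedsD(2)[OF f ab] likeD[OF x(2), of a] likeD[OF x(2), of b]
      E_commute[of x "f a"] adj_sym[of a b g] by auto
qed (use embedsD(1)[OF f] x(1) in auto)

lemma rigidD:
  assumes "rigid g ex" "i < length g" "j < length g"
  shows "i \<noteq> j \<Longrightarrow> \<exists>l<length g. l \<noteq> i \<and> l \<noteq> j \<and> adj g i l \<noteq> adj g j l"
    and "T \<in> set ex \<Longrightarrow> \<exists>l<length g. l \<noteq> i \<and> l \<noteq> j \<and> adj g j l \<and> l \<notin> set T"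
    and "k < length g \<Longrightarrow> distinct [i, j, k] \<Longrightarrow> adj g k i \<Longrightarrow> \<not> adj g j i \<Longrightarrow>
      (\<And>l. l < length g \<Longrightarrow> l \<noteq> i \<Longrightarrow> l \<noteq> j \<Longrightarrow> l \<noteq> k \<Longrightarrow> adj g k l \<longleftrightarrow> adj g j l) \<Longrightarrow>
      (if adj g j k then \<exists>l<length g. l \<noteq> i \<and> l \<noteq> j \<and> l \<noteq> k \<and> adj g i l \<and> \<not> adj g j l
       else (\<exists>l<length g. l \<noteq> i \<and> l \<noteq> j \<and> l \<noteq> k \<and> adj g j l \<and> \<not> adj g i l) \<and>
         (\<exists>l<length g. l \<noteq> i \<and> l \<noteq> j \<and> l \<noteq> k \<and> adj g j l \<and> adj g i l))"
proof -
  have lt: "(\<forall>l\<in>set [0..<n]. P l) \<longleftrightarrow> (\<forall>l<n. P l)" "(\<exists>l\<in>set [0..<n]. P l) \<longleftrightarrow> (\<exists>l<n. P l)" for n P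
    by auto
  note r = assms(1)[unfolded rigid_def lt]
  note r1 = conjunct1[OF r, THEN spec, THEN mp, OF assms(2), THEN spec, THEN mp, OF assms(3)]
  note r2 = conjunct1[OF conjunct2[OF r], THEN bspec, THEN spec, THEN mp, OF _ assms(2),
    THEN spec, THEN mp, OF _ assms(3)]
  note r3 = conjunct2[OF conjunct2[OF r], THEN spec, THEN mp, OF assms(2), THEN spec, THEN mp, OF assms(3)]
  show "i \<noteq> j \<Longrightarrow> \<exists>l<length g. l \<noteq> i \<and> l \<noteq> j \<and> adj g i l \<noteq> adj g j l"
    using r1 by (simp only: if_False)
  show "T \<in> set ex \<Longrightarrow> \<exists>l<length g. l \<noteq> i \<and> l \<noteq> j \<and> adj g j l \<and> l \<notin> set T"
    by (rule r2)
  assume k: "k < length g" "distinct [i, j, k]" "adj g k i" "\<not> adj g j i"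
    and agree: "\<And>l. l < length g \<Longrightarrow> l \<noteq> i \<Longrightarrow> l \<noteq> j \<Longrightarrow> l \<noteq> k \<Longrightarrow> adj g k l \<longleftrightarrow> adj g j l"
  have ijk: "i \<noteq> j" "k \<noteq> i" "k \<noteq> j"
    using k(2) by auto
  have "\<forall>l<length g. l = i \<or> l = j \<or> l = k \<or> adj g k l = adj g j l"
    using agree by blast
  then show "if adj g j k then \<exists>l<length g. l \<noteq> i \<and> l \<noteq> j \<and> l \<noteq> k \<and> adj g i l \<and> \<not> adj g j l
       else (\<exists>l<length g. l \<noteq> i \<and> l \<noteq> j \<and> l \<noteq> k \<and> adj g j l \<and> \<not> adj g i l) \<and>
         (\<exists>l<length g. l \<noteq> i \<and> l \<noteq> j \<and> l \<noteq> k \<and> adj g j l \<and> adj g i l)"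
    using r3[simplified ijk k(4), simplified, THEN spec, THEN mp, OF k(1)] ijk k(3) by simp
qed

text \<open>The vertex \<open>y\<close> sees \<open>x\<close> but not \<open>f i\<close>, and
  \<open>j\<close> and \<open>k\<close> agree outside \<open>i\<close>, \<open>j\<close>,
  \<open>k\<close>. The further vertices promised by the last clause of \<open>rigid\<close>
  complete a P5 or a gem, according to whether \<open>x\<close> and \<open>f i\<close> are
  adjacent.\<close>

lemma not_ambiguous:
  assumes pg: "pg_free V" and rigid: "rigid g ex" and f: "embeds V g f"
    and x: "x \<in> V" "like g f i x" and y: "y \<in> V" "like g f j y" "like g (f(i := x)) k y"
    and ijk: "i < length g" "j < length g" "k < length g" "distinct [i, j, k]"
    and adj: "adj g k i" "\<not> adj g j i"
  shows False
proof -
  have f': "embeds V g (f(i := x))"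
    using embeds_like[OF f x] .
  have yi: "\<not> E y (f i)" and yx: "E y x"
    using likeD[OF y(2), of i] likeD[OF y(3), of i] ijk adj by auto
  have yl: "E y (f l) \<longleftrightarrow> adj g j l" "E y (f l) \<longleftrightarrow> adj g k l" if "l < length g" "l \<noteq> i" "l \<noteq> j" "l \<noteq> k" for l
    using likeD[OF y(2), of l] likeD[OF y(3), of l] that by auto
  have yj: "E y (f j) \<longleftrightarrow> adj g j k" and yk: "E y (f k) \<longleftrightarrow> adj g j k"
    using likeD[OF y(2), of k] likeD[OF y(3), of j] ijk adj_sym[of j k g] by auto
  have agree: "adj g k l \<longleftrightarrow> adj g j l" if "l < length g" "l \<noteq> i" "l \<noteq> j" "l \<noteq> k" for l
    using yl that by blast
  have xl: "E x (f l) \<longleftrightarrow> adj g i l" if "l < length g" "l \<noteq> i" for l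
    using likeD[OF x(2)] that by blast
  have ij: "\<not> adj g i j" and ik: "adj g i k"
    using adj ijk adj_sym[of i j g] adj_sym[of i k g] by auto
  note fE = embedsD(2)[OF f] and fV = embedsD(1)[OF f]
  note * = rigidD(3)[OF rigid ijk(1,2,3,4) adj agree]
  have mem: "f i \<in> V" "f j \<in> V" "f k \<in> V"
    using fV ijk by auto
  have base: "E (f i) (f k)" "\<not> E (f i) (f j)" "E (f j) (f k) \<longleftrightarrow> adj g j k" "E x (f k)" "\<not> E x (f j)"
    using fE[of i k] fE[of i j] fE[of j k] xl[of k] xl[of j] ijk ij ik by auto
  show False
  proof (cases "adj g j k")
    case True
    then obtain l where l: "l < length g" "l \<noteq> i" "l \<noteq> j" "l \<noteq> k" "adj g i l" "\<not> adj g j l"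
      using * by auto
    have c: "f l \<in> V" "E (f i) (f l)" "E x (f l)" "\<not> E y (f l)" "\<not> E (f j) (f l)" "\<not> E (f k) (f l)"
      using l fV fE[of i l] fE[of j l] fE[of k l] xl[of l] yl[of l] agree[of l] ijk by auto
    show False
      using no_P5[OF pg, of "f i" "f l" x y "f j"] no_gem[OF pg, of "f l" "f i" "f k" y x]
        True c base mem x(1) y(1) yi yx yj yk by (auto simp: E_commute)
  next
    case False
    then obtain l m where l: "l < length g" "l \<noteq> i" "l \<noteq> j" "l \<noteq> k" "adj g j l" "\<not> adj g i l"
      and m: "m < length g" "m \<noteq> i" "m \<noteq> j" "m \<noteq> k" "adj g j m" "adj g i m"
      using * by auto
    have c: "f l \<in> V" "\<not> E (f i) (f l)" "\<not> E x (f l)" "E y (f l)" "E (f j) (f l)"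
      using l fV fE[of i l] fE[of j l] xl[of l] yl[of l] ijk by auto
    have d: "f m \<in> V" "E (f i) (f m)" "E x (f m)" "E y (f m)" "E (f k) (f m)"
      using m fV fE[of i m] fE[of k m] xl[of m] yl[of m] agree[of m] ijk by auto
    show False
      using no_P5[OF pg, of "f i" x y "f l" "f j"] no_gem[OF pg, of "f i" "f k" x y "f m"]
        False c d base mem x(1) y(1) yi yx yj yk by (auto simp: E_commute)
  qed
qed

text \<open>If \<open>y\<close> disagreed with the pattern on \<open>x\<close>, then exchanging
  \<open>f i\<close> for \<open>x\<close> would change the type of \<open>y\<close> from
  \<open>j\<close> to some other \<open>k\<close>, which \<open>not_ambiguous\<close>
  forbids.\<close>

lemma like_adj:
  assumes pg: "pg_free V" and rigid: "rigid g ex" and f: "embeds V g f"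
    and types: "\<And>f x. embeds V g f \<Longrightarrow> x \<in> V \<Longrightarrow>
      (\<exists>i<length g. like g f i x) \<or> trace f (length g) x \<in> set ex"
    and x: "x \<in> V" "like g f i x" and y: "y \<in> V" "like g f j y"
    and ij: "i < length g" "j < length g" "i \<noteq> j"
  shows "E x y \<longleftrightarrow> adj g i j"
proof (rule ccontr)
  assume neq: "\<not> ?thesis"
  then have yx: "E y x \<longleftrightarrow> \<not> adj g j i"
    using E_commute[of x y] adj_sym[of i j g] ij by auto
  have yi: "E y (f i) \<longleftrightarrow> adj g j i"
    using likeD[OF y(2), of i] ij by auto
  let ?f = "f(i := x)"
  have f': "embeds V g ?f"
    using embeds_like[OF f x] .
  consider "trace ?f (length g) y \<in> set ex" | k where "k < length g" "like g ?f k y"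
    using types[OF f' y(1)] by blast
  then show False
  proof cases
    case 1
    then obtain l where "l < length g" "l \<noteq> i" "l \<noteq> j" "adj g j l" "l \<notin> set (trace ?f (length g) y)"
      using rigidD(2)[OF rigid ij(1,2)] by blast
    then show False
      using likeD[OF y(2), of l] by simp
  next
    case (2 k)
    have "k \<noteq> j"
      using likeD[OF 2(2), of i] ij yx by auto
    moreover have "k \<noteq> i"
    proof
      assume "k = i"
      then have "adj g i l \<longleftrightarrow> adj g j l" if "l < length g" "l \<noteq> i" "l \<noteq> j" for l
        using likeD[OF 2(2), of l] likeD[OF y(2), of l] that by auto
      then show False
        using rigidD(1)[OF rigid ij] by blast
    qed
    ultimately have ijk: "distinct [i, j, k]"
      using ij(3) by auto
    have ki: "adj g k i \<longleftrightarrow> \<not> adj g j i"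
      using likeD[OF 2(2), of i] ij ijk yx by auto
    show False
    proof (cases "adj g j i")
      case False
      then show False
        using not_ambiguous[OF pg rigid f x y 2(2) ij(1,2) 2(1) ijk] ki by blast
    next
      case True
      \<comment> \<open>\<open>not_ambiguous\<close> covers the case that \<open>y\<close> gains a
        neighbour by the exchange. Here it loses one, so the copies change roles: \<open>x\<close>
        in \<open>?f\<close> is exchanged back for \<open>f i\<close>.\<close>
      have "like g ?f i (f i)"
        using embedsD(2)[OF f] ij(1) unfolding like_def by auto
      moreover have "?f(i := f i) = f"
        by simp
      ultimately show False
        using not_ambiguous[OF pg rigid f' _ _ y(1) 2(2),
          of "f i" i j] embedsD(1)[OF f ij(1)] y(2) ij 2(1) ijk True ki
        by auto
    qed
  qed
qed

text \<open>Put \<open>x\<close> in the place of \<open>f i\<close>. If \<open>z\<close> saw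
  \<open>x\<close>, its new trace would contain \<open>i\<close> and so be the trace of a clone of
  some \<open>a\<close>; but the old trace of \<open>z\<close> misses a neighbour of
  \<open>a\<close> other than \<open>i\<close>, and that adjacency is unchanged.\<close>

lemma outsider_nonadjacent:
  assumes rigid: "rigid g ex" and f: "embeds V g f"
    and types: "\<And>f x. embeds V g f \<Longrightarrow> x \<in> V \<Longrightarrow>
      (\<exists>i<length g. like g f i x) \<or> trace f (length g) x \<in> set ex"
    and x: "x \<in> V" "like g f i x" "i < length g"
    and z: "z \<in> V" "trace f (length g) z \<in> set ex" and i: "\<And>T. T \<in> set ex \<Longrightarrow> i \<notin> set T"
  shows "\<not> E z x"
proof
  assume zx: "E z x"
  let ?f = "f(i := x)"
  have "embeds V g ?f"
    using embeds_like[OF f x(1,2)] .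
  moreover have "i \<in> set (trace ?f (length g) z)"
    using zx x(3) by simp
  ultimately obtain a where a: "a < length g" "like g ?f a z"
    using types z(1) i by blast
  obtain l where "l < length g" "l \<noteq> i" "l \<noteq> a" "adj g a l" "l \<notin> set (trace f (length g) z)"
    using rigidD(2)[OF rigid x(3) a(1) z(2)] by blast
  then show False
    using likeD[OF a(2), of l] by simp
qed

lemma traceD: "trace f n x = T \<Longrightarrow> j < n \<Longrightarrow> E x (f j) \<longleftrightarrow> j \<in> set T"
  by auto

lemma like_self: "embeds V g f \<Longrightarrow> i < length g \<Longrightarrow> like g f i (f i)"
  unfolding like_def using embedsD(2) by blast

lemma like_unique:
  assumes "rigid g ex" "i < length g" "j < length g" "like g f i x" "like g f j x"
  shows "i = j"
proof (rule ccontr)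
  assume "i \<noteq> j"
  then obtain l where "l < length g" "l \<noteq> i" "l \<noteq> j" "adj g i l \<noteq> adj g j l"
    using rigidD(1)[OF assms(1-3)] by blast
  then show False
    using likeD[OF assms(4), of l] likeD[OF assms(5), of l] by auto
qed

text \<open>By \<open>outsider_nonadjacent\<close> no edge leaves the set of clones. The
  classification \<open>types\<close> is required for every copy, since the argument exchanges
  vertices of the given one.\<close>

lemma all_like:
  assumes rigid: "rigid g [[]]" and f: "embeds V g f" and g: "g \<noteq> []"
    and types: "\<And>f x. embeds V g f \<Longrightarrow> x \<in> V \<Longrightarrow>
      (\<exists>i<length g. like g f i x) \<or> trace f (length g) x = []"
    and connected: "\<And>X. X \<subseteq> V \<Longrightarrow> X \<noteq> {} \<Longrightarrow> X \<noteq> V \<Longrightarrow> \<exists>x\<in>X. \<exists>y\<in>V - X. E x y"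
    and x: "x \<in> V"
  shows "\<exists>i<length g. like g f i x"
proof -
  let ?X = "{x \<in> V. \<exists>i<length g. like g f i x}"
  have "f 0 \<in> ?X"
    using like_self[OF f] embedsD(1)[OF f] g by auto
  moreover have "\<not> E y z" if y: "y \<in> ?X" and z: "z \<in> V - ?X" for y z
  proof -
    obtain i where "y \<in> V" "i < length g" "like g f i y"
      using y by blast
    moreover have "z \<in> V" "trace f (length g) z \<in> set [[]]"
      using types[OF f, of z] z by auto
    ultimately show ?thesis
      using outsider_nonadjacent[OF rigid f, of y i z] types E_commute[of y z] by auto
  qed
  ultimately have "?X = V"
    using connected[of ?X] by blast
  then show ?thesis
    using x by blast
qed

end

section \<open>Graphs without an induced five-cycle\<close>

locale minimal_imperfect = adj_graph +
  fixes V :: "'a set"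
  assumes fin: "finite V" and pg: "pg_free V"
    and not_colourable: "\<not> colourable V (om V)"
    and minimal: "\<And>W. W \<subset> V \<Longrightarrow> colourable W (om W)"
begin

definition M :: "'a \<Rightarrow> 'a set" where
  "M v = {u \<in> V. u \<noteq> v \<and> \<not> E v u}"

lemma colourable_sub: "W \<subset> V \<Longrightarrow> colourable W (om V)"
  using minimal[of W] om_mono[OF fin, of W] colourable_mono[of W "om W" "om V" W] by auto

lemma nonempty: "V \<noteq> {}"
  using not_colourable colourable_empty colourable_mono by blast

lemma not_hitting:
  assumes "stable S"
  shows "om V \<le> om (V - S)"
proof (rule ccontr)
  assume *: "\<not> om V \<le> om (V - S)"
  then have "V - S \<subset> V"
    by auto
  then have "colourable V (Suc (om (V - S)))"
    using minimal colourable_stable assms by blast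
  then show False
    using * not_colourable colourable_mono[of V "Suc (om (V - S))" "om V" V] by auto
qed

lemma connected:
  assumes "X \<subseteq> V" "X \<noteq> {}" "X \<noteq> V"
  obtains x y where "x \<in> X" "y \<in> V - X" "E x y"
proof -
  have "\<exists>x\<in>X. \<exists>y\<in>V - X. E x y"
  proof (rule ccontr)
    assume "\<not> ?thesis"
    moreover have "X \<subset> V" "V - X \<subset> V"
      using assms by auto
    ultimately have "colourable (X \<union> (V - X)) (om V)"
      by (intro colourable_Un colourable_sub) auto
    moreover have "X \<union> (V - X) = V"
      using assms(1) by auto
    ultimately show False
      using not_colourable by simp
  qed
  then show ?thesis
    using that by blast
qed

lemma M_nonempty:
  assumes "v \<in> V"
  shows "M v \<noteq> {}"
proof
  assume "M v = {}"
  then have adj: "E v u" if "u \<in> V" "u \<noteq> v" for u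
    using that by (auto simp: M_def)
  obtain K where K: "K \<subseteq> V - {v}" "clique K" "card K = om (V - {v})"
    using om_attained[of "V - {v}"] fin by blast
  have "clique (insert v K)"
    using K(1,2) adj E_sym by (intro clique_insert) auto
  then have "card (insert v K) \<le> om V"
    using K(1) assms fin by (intro om_ge) auto
  moreover have "card (insert v K) = Suc (card K)"
    using K(1) fin by (meson Diff_iff card_insert_disjoint finite_Diff finite_subset insertI1 subsetD)
  moreover have "om V \<le> om (V - {v})"
    by (rule not_hitting) (simp add: stable_def E_irrefl)
  ultimately show False
    using K(3) by simp
qed

text \<open>Otherwise every neighbour of \<open>u\<close> is one of \<open>v\<close>, and
  \<open>u\<close> can take the colour of \<open>v\<close>.\<close>

lemma not_dominated:
  assumes "u \<in> V" "v \<in> V" "u \<noteq> v" "\<not> E u v"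
  obtains x where "x \<in> V" "E u x" "\<not> E v x"
proof -
  have "\<exists>x\<in>V. E u x \<and> \<not> E v x"
  proof (rule ccontr)
    assume *: "\<not> ?thesis"
    have "colourable (V - {u}) (om V)"
      using assms(1) by (intro colourable_sub) auto
    then obtain c :: "'a \<Rightarrow> nat" where c: "c ` (V - {u}) \<subseteq> {..<om V}" "proper (V - {u}) c"
      unfolding colourable_def by blast
    have "proper V (c(u := c v))"
    proof (rule properI)
      fix x y assume xy: "x \<in> V" "y \<in> V" "E x y"
      show "(c(u := c v)) x \<noteq> (c(u := c v)) y"
        using xy * assms properD[OF c(2), of x y] properD[OF c(2), of v y] properD[OF c(2), of v x]
          E_commute E_irrefl by (metis Diff_iff fun_upd_apply singletonD)
    qed
    moreover have "(c(u := c v)) ` V \<subseteq> {..<om V}"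
      using c(1) assms by (auto simp: image_subset_iff)
    ultimately show False
      using not_colourable unfolding colourable_def by blast
  qed
  then show ?thesis
    using that by blast
qed

text \<open>Replication in the sense of Lovasz: a colour class through \<open>x\<close>, with \<open>y\<close> in the place
  of \<open>x\<close>, would meet every maximum clique.\<close>

lemma no_twins:
  assumes "x \<in> V" "y \<in> V" "E x y" "\<And>v. v \<in> V \<Longrightarrow> v \<noteq> x \<Longrightarrow> v \<noteq> y \<Longrightarrow> E v x \<longleftrightarrow> E v y"
  shows False
proof -
  have "x \<noteq> y"
    using assms(3) E_irrefl by blast
  have "colourable (V - {y}) (om V)"
    using assms(2) by (intro colourable_sub) auto
  then obtain c :: "'a \<Rightarrow> nat" where c: "c ` (V - {y}) \<subseteq> {..<om V}" "proper (V - {y}) c"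
    unfolding colourable_def by blast
  define S where "S = insert y ({v \<in> V - {y}. c v = c x} - {x})"
  have "\<not> E u v" if "u \<in> S" "v \<in> S" for u v
  proof
    assume uv: "E u v"
    have *: "\<not> E w x" if "w \<in> V - {y}" "c w = c x" for w
      using properD[OF c(2), of w x] that assms(1) \<open>x \<noteq> y\<close> by auto
    show False
      using that uv * assms(4)[of u] assms(4)[of v] properD[OF c(2) _ _ uv] E_irrefl E_sym[OF uv]
      unfolding S_def by auto
  qed
  then have "om V \<le> om (V - S)"
    by (intro not_hitting) (auto simp: stable_def)
  then obtain K where K: "K \<subseteq> V - S" "clique K" "om V \<le> card K"
    using om_attained[of "V - S"] fin by (metis finite_Diff)
  have finK: "finite K"
    using K(1) fin by (meson Diff_subset finite_subset)
  show False
  proof (cases "x \<in> K")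
    case True
    have "E u y" if "u \<in> K" for u
      using that True K(1,2) assms(3) assms(4)[of u] unfolding clique_def S_def by (cases "u = x") auto
    then have "clique (insert y K)"
      using K(2) by (intro clique_insert) auto
    moreover have "y \<notin> K"
      using K(1) unfolding S_def by auto
    ultimately show False
      using om_ge[OF fin, of "insert y K"] K(1,3) finK assms(2) by (simp add: subset_iff)
  next
    case False
    then have "K \<subseteq> V - {y}" "\<And>u. u \<in> K \<Longrightarrow> c u \<noteq> c x"
      using K(1) unfolding S_def by auto
    then have "c ` K \<subseteq> {..<om V} - {c x}" "inj_on c K"
      using c proper_inj_clique K(2) by auto
    then have "card K \<le> card ({..<om V} - {c x})"
      by (metis card_image card_mono finite_Diff finite_lessThan)
    moreover have "c x < om V"
      using c(1) assms(1) \<open>x \<noteq> y\<close> by auto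
    ultimately show False
      using K(3) by simp
  qed
qed

text \<open>If \<open>X\<close> is a clique, two of its vertices are adjacent twins. Otherwise keep
  only a maximum clique \<open>K\<close> of \<open>X\<close>, colour the smaller graph, and recolour
  all of \<open>X\<close> with the colours of \<open>K\<close>. There are enough of them by
  minimality, and they do not clash outside, because an outside neighbour of one vertex of
  \<open>X\<close> is a neighbour of all of \<open>K\<close>.\<close>

lemma no_module:
  assumes "X \<subseteq> V" "X \<noteq> V" "x \<in> X" "y \<in> X" "x \<noteq> y"
    and hom: "\<And>v a b. v \<in> V - X \<Longrightarrow> a \<in> X \<Longrightarrow> b \<in> X \<Longrightarrow> E v a \<Longrightarrow> E v b"
  shows False
proof (cases "clique X")
  case True
  show False
  proof (rule no_twins[of x y])
    show "E v x \<longleftrightarrow> E v y" if "v \<in> V" "v \<noteq> x" "v \<noteq> y" for v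
      using that True assms(3,4) hom unfolding clique_def by (metis DiffI)
  qed (use True assms in \<open>auto simp: clique_def\<close>)
next
  case False
  obtain K where K: "K \<subseteq> X" "clique K" "card K = om X"
    using om_attained[OF finite_subset[OF assms(1) fin]] .
  have "K \<noteq> X"
    using K(2) False by blast
  then have "V - (X - K) \<subset> V"
    using K(1) assms(1) by blast
  then obtain c :: "'a \<Rightarrow> nat" where c: "c ` (V - (X - K)) \<subseteq> {..<om V}" "proper (V - (X - K)) c"
    using colourable_sub[of "V - (X - K)"] unfolding colourable_def by blast
  have KV: "K \<subseteq> V - (X - K)"
    using K(1) assms(1) by auto
  have "inj_on c K"
    using proper_inj_clique[OF c(2) KV K(2)] .
  then have "om X \<le> card (c ` K)"
    using K(3) by (simp add: card_image)
  moreover have "finite (c ` K)"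
    using finite_subset[OF K(1) finite_subset[OF assms(1) fin]] by simp
  moreover have "colourable X (om X)"
    using assms(1,2) by (intro minimal) auto
  ultimately obtain d where d: "d ` X \<subseteq> c ` K" "proper X d"
    using colourable_with[of X "om X" "c ` K"] by blast
  define e where "e v = (if v \<in> X then d v else c v)" for v
  have cross: "d u \<noteq> c v" if uv: "u \<in> X" "v \<in> V - X" "E u v" for u v
  proof -
    obtain w where w: "w \<in> K" "d u = c w"
      using d(1) uv(1) by blast
    then have "E v w"
      using hom[of v u w] uv K(1) E_sym by blast
    then show ?thesis
      using properD[OF c(2), of v w] w uv(2) KV by auto
  qed
  have "proper V e"
  proof (rule properI)
    fix u v assume uv: "u \<in> V" "v \<in> V" "E u v"
    show "e u \<noteq> e v"
      using uv cross[of u v] cross[of v u] properD[OF d(2), of u v] properD[OF c(2), of u v]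
        E_sym[OF uv(3)] by (auto simp: e_def)
  qed
  moreover have "e ` V \<subseteq> {..<om V}"
  proof -
    have "c ` K \<subseteq> {..<om V}"
      using c(1) KV by blast
    then have "d ` X \<subseteq> {..<om V}"
      using d(1) by (rule subset_trans[rotated])
    then show ?thesis
      using c(1) by (auto simp: e_def)
  qed
  ultimately show False
    using not_colourable unfolding colourable_def by blast
qed

lemma degree:
  assumes "v \<in> V"
  shows "om V \<le> card {u \<in> V. E v u}"
proof (rule ccontr)
  assume "\<not> ?thesis"
  then have less: "card {u \<in> V. E v u} < om V"
    by simp
  obtain c :: "'a \<Rightarrow> nat" where c: "c ` (V - {v}) \<subseteq> {..<om V}" "proper (V - {v}) c"
    using colourable_sub[of "V - {v}"] assms unfolding colourable_def by blast
  have "card (c ` {u \<in> V. E v u}) < card {..<om V}"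
    using less card_image_le[of "{u \<in> V. E v u}" c] fin by simp
  then have "\<not> {..<om V} \<subseteq> c ` {u \<in> V. E v u}"
    using card_mono[of "c ` {u \<in> V. E v u}" "{..<om V}"] fin by auto
  then obtain k where k: "k < om V" "k \<notin> c ` {u \<in> V. E v u}"
    by auto
  have "proper V (c(v := k))"
  proof (rule properI)
    fix x y assume xy: "x \<in> V" "y \<in> V" "E x y"
    show "(c(v := k)) x \<noteq> (c(v := k)) y"
      using xy k(2) properD[OF c(2), of x y] E_sym[OF xy(3)] E_irrefl by auto
  qed
  moreover have "(c(v := k)) ` V \<subseteq> {..<om V}"
    using c(1) k(1) by (auto simp: image_subset_iff)
  ultimately show False
    using not_colourable unfolding colourable_def by blast
qed

text \<open>If every neighbour of \<open>v\<close> were constant along the edges in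
  \<open>X\<close>, a connected component \<open>C\<close> of \<open>X\<close> would be homogeneous.
  It is not a single vertex, since \<open>not_dominated\<close> gives its vertex \<open>x\<close> a
  neighbour that \<open>v\<close> does not have.\<close>

lemma mixed_edge:
  assumes v: "v \<in> V" and X: "X \<subseteq> M v" "X \<noteq> {}"
    and anti: "\<And>x y. x \<in> X \<Longrightarrow> y \<in> M v - X \<Longrightarrow> \<not> E x y"
  obtains s c c' where "s \<in> V" "E v s" "c \<in> X" "c' \<in> X" "E c c'" "E s c" "\<not> E s c'"
proof -
  have "\<exists>s\<in>V. \<exists>c\<in>X. \<exists>c'\<in>X. E v s \<and> E c c' \<and> E s c \<and> \<not> E s c'"
  proof (rule ccontr)
    assume "\<not> ?thesis"
    then have const: "E s a \<longleftrightarrow> E s b" if "s \<in> V" "E v s" "a \<in> X" "b \<in> X" "E a b" for s a b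
      using that E_sym by blast
    obtain x where x: "x \<in> X"
      using X(2) by blast
    define R where "R a b \<longleftrightarrow> a \<in> X \<and> b \<in> X \<and> E a b" for a b
    define C where "C = {y. R\<^sup>*\<^sup>* x y}"
    have CX: "C \<subseteq> X"
    proof
      fix y assume "y \<in> C"
      then have "R\<^sup>*\<^sup>* x y"
        by (simp add: C_def)
      then show "y \<in> X"
        by (induction rule: rtranclp_induct) (auto simp: x R_def)
    qed
    have Cconst: "E s y \<longleftrightarrow> E s x" if "s \<in> V" "E v s" "y \<in> C" for s y
    proof -
      have "R\<^sup>*\<^sup>* x y"
        using that by (simp add: C_def)
      then show ?thesis
        by (induction rule: rtranclp_induct) (use const that in \<open>auto simp: R_def\<close>)
    qed
    have closed: "b \<in> C" if "a \<in> C" "b \<in> V" "E a b" "\<not> E v b" for a b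
    proof -
      have a: "a \<in> X" "a \<in> M v"
        using that CX X(1) by auto
      then have "b \<noteq> v"
        using that(3) E_sym by (auto simp: M_def)
      then have "b \<in> X"
        using that anti[of a b] a(1) by (auto simp: M_def)
      then show ?thesis
        using that a(1) unfolding C_def R_def by (auto intro: rtranclp.rtrancl_into_rtrancl)
    qed
    have xC: "x \<in> C"
      by (simp add: C_def)
    have xM: "x \<in> V" "x \<noteq> v" "\<not> E x v"
      using x X(1) E_sym by (auto simp: M_def)
    obtain y where y: "y \<in> V" "E x y" "\<not> E v y"
      using not_dominated[of x v] xM v by blast
    have "y \<in> C" "x \<noteq> y"
      using closed xC y E_irrefl by auto
    show False
    proof (rule no_module[of C x y])
      show "C \<subseteq> V" "C \<noteq> V"
        using CX X(1) v by (auto simp: M_def)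
      show "E w b" if "w \<in> V - C" "a \<in> C" "b \<in> C" "E w a" for w a b
        using that Cconst[of w a] Cconst[of w b] closed[of a w] E_sym by blast
    qed (use xC \<open>y \<in> C\<close> \<open>x \<noteq> y\<close> in auto)
  qed
  then show ?thesis
    using that by blast
qed

text \<open>Two parts of \<open>M v\<close> without edges between them would contain mixed edges
  \<open>a b\<close> for \<open>s\<close> and \<open>c d\<close> for \<open>t\<close>. Whatever the
  remaining adjacencies, these six vertices and \<open>v\<close> contain a P5 or a gem.\<close>

lemma M_connected:
  assumes v: "v \<in> V" and X: "X \<subseteq> M v" "X \<noteq> {}" "X \<noteq> M v"
  obtains x y where "x \<in> X" "y \<in> M v - X" "E x y"
proof -
  have "\<exists>x\<in>X. \<exists>y\<in>M v - X. E x y"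
  proof (rule ccontr)
    assume "\<not> ?thesis"
    then have anti: "\<not> E x y" "\<not> E y x" if "x \<in> X" "y \<in> M v - X" for x y
      using that E_sym by blast+
    obtain s a b where s: "s \<in> V" "E v s" "a \<in> X" "b \<in> X" "E a b" "E s a" "\<not> E s b"
      using mixed_edge[OF v X(1,2)] anti(1) by blast
    have "M v - X \<noteq> {}" "M v - X \<subseteq> M v"
      using X by auto
    then obtain t c d where t: "t \<in> V" "E v t" "c \<in> M v - X" "d \<in> M v - X" "E c d" "E t c" "\<not> E t d"
      using mixed_edge[OF v, of "M v - X"] anti(2) by (metis Diff_iff)
    have mem: "a \<in> V" "b \<in> V" "c \<in> V" "d \<in> V" "\<not> E v a" "\<not> E v b" "\<not> E v c" "\<not> E v d"
      using s t X(1) by (auto simp: M_def)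
    have far: "\<not> E a c" "\<not> E a d" "\<not> E b c" "\<not> E b d"
      using s t anti by auto
    have 1: "E s c \<Longrightarrow> E s d" "E s d \<Longrightarrow> E s c"
      using no_P5[OF pg, of b a s c d] no_P5[OF pg, of b a s d c] s t v mem far by (auto simp: E_commute)
    have 2: "E t a \<Longrightarrow> E t b" "E t b \<Longrightarrow> E t a"
      using no_P5[OF pg, of d c t a b] no_P5[OF pg, of d c t b a] s t v mem far by (auto simp: E_commute)
    have 3: "E s t \<Longrightarrow> \<not> E s c"
      using no_gem[OF pg, of v t c d s] 1 s t v mem far by (auto simp: E_commute)
    have 4: "E s t \<Longrightarrow> \<not> E t a"
      using no_gem[OF pg, of v s a b t] 2 s t v mem far by (auto simp: E_commute)
    have 5: "\<not> E s t"
      using no_P5[OF pg, of b a s t c] 1 2 3 4 s t v mem far by (auto simp: E_commute)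
    have 6: "E t a"
      using no_P5[OF pg, of t v s a b] 2 5 s t v mem far by (auto simp: E_commute)
    have 7: "E s c"
      using no_P5[OF pg, of s v t c d] 1 5 s t v mem far by (auto simp: E_commute)
    show False
      using no_P5[OF pg, of b t v s d] 1 2 5 6 7 s t v mem far by (auto simp: E_commute)
  qed
  then show ?thesis
    using that by blast
qed

end

locale minimal_imperfect_C5_free = minimal_imperfect +
  assumes c5: "C5_free V"
begin

section \<open>From a house to a prism\<close>

definition house :: "'a \<Rightarrow> 'a \<Rightarrow> 'a \<Rightarrow> 'a \<Rightarrow> 'a \<Rightarrow> bool" where
  "house a b c d r \<longleftrightarrow> {a, b, c, d, r} \<subseteq> V \<and> E a b \<and> E b c \<and> E c d \<and> E d a \<and> E r a \<and> E r b \<and>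
     \<not> E a c \<and> \<not> E b d \<and> \<not> E r c \<and> \<not> E r d"

definition double_house :: "'a \<Rightarrow> 'a \<Rightarrow> 'a \<Rightarrow> 'a \<Rightarrow> 'a \<Rightarrow> 'a \<Rightarrow> bool" where
  "double_house a b c d r t \<longleftrightarrow> house a b c d r \<and> t \<in> V \<and>
     E t c \<and> E t d \<and> \<not> E t a \<and> \<not> E t b \<and> \<not> E t r"

definition prism :: "'a \<Rightarrow> 'a \<Rightarrow> 'a \<Rightarrow> 'a \<Rightarrow> 'a \<Rightarrow> 'a \<Rightarrow> bool" where
  "prism a b c x y z \<longleftrightarrow> {a, b, c, x, y, z} \<subseteq> V \<and> E a b \<and> E a c \<and> E b c \<and> E x y \<and> E x z \<and> E y z \<and>
     E a x \<and> E b y \<and> E c z \<and> \<not> E a y \<and> \<not> E a z \<and> \<not> E b x \<and> \<not> E b z \<and> \<not> E c x \<and> \<not> E c y"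

text \<open>Take an induced path \<open>v b c d\<close>. Without a house, the non-neighbours of
  \<open>c\<close> that see \<open>b\<close> but not \<open>d\<close> are closed under adjacency
  inside \<open>M c\<close>, hence are all of \<open>M c\<close>. Then \<open>b\<close> is complete
  to \<open>M c\<close>, and a mixed edge there with its vertex \<open>s\<close> gives a gem or a
  house.\<close>

lemma ex_house: "\<exists>a b c d r. house a b c d r"
proof (rule ccontr)
  assume "\<not> ?thesis"
  then have no_house: "\<not> house a b c d r" for a b c d r
    by blast
  obtain v where v: "v \<in> V"
    using nonempty by blast
  obtain b c d where P4: "b \<in> V" "E v b" "c \<in> M v" "d \<in> M v" "E c d" "E b c" "\<not> E b d"
    using mixed_edge[OF v, of "M v"] M_nonempty[OF v] by blast
  have mem: "c \<in> V" "d \<in> V" "\<not> E v c" "\<not> E v d" "v \<noteq> c"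
    using P4 by (auto simp: M_def)
  have end_type: "E w b \<and> \<not> E w d"
    if u: "u \<in> V" "E u b" "\<not> E u c" "\<not> E u d" and w: "w \<in> V" "E w u" "\<not> E w c" for u w
  proof -
    note facts = u w P4(1,2,5-7) mem
    have 1: "E w b \<or> E w d"
      using no_P5[OF pg, of w u b c d] facts by (auto simp: E_commute)
    have 2: "E w b"
      using 1 no_C5[OF c5, of w u b c d] facts by (auto simp: E_commute)
    have 3: "\<not> E w d"
      using 2 no_house[of w b c d u] facts by (auto simp: house_def E_commute)
    show ?thesis
      using 2 3 by blast
  qed
  define X where "X = {u \<in> M c. E u b \<and> \<not> E u d}"
  have "v \<in> X"
    using v P4 mem by (auto simp: X_def M_def E_commute)
  have X: "X = M c"
  proof (rule ccontr)
    assume "X \<noteq> M c"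
    then obtain u w where uw: "u \<in> X" "w \<in> M c - X" "E u w"
      using M_connected[of c X] \<open>v \<in> X\<close> mem(1) by (auto simp: X_def)
    then have "E w b \<and> \<not> E w d"
      by (intro end_type[of u w]) (auto simp: X_def M_def E_commute)
    then show False
      using uw by (auto simp: X_def)
  qed
  obtain s e f where s: "s \<in> V" "E c s" "e \<in> M c" "f \<in> M c" "E e f" "E s e" "\<not> E s f"
    using mixed_edge[OF mem(1), of "M c"] M_nonempty[OF mem(1)] by blast
  have ef: "E e b" "E f b" "e \<in> V" "f \<in> V" "\<not> E c e" "\<not> E c f"
    using s(3,4)[folded X] by (auto simp: X_def M_def)
  have "\<not> E s b"
    using no_gem[OF pg, of f e s c b] s ef P4 mem by (auto simp: E_commute)
  then show False
    using no_house[of e b c s f] s ef P4 mem by (auto simp: house_def E_commute)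
qed

text \<open>The same propagation, now in the non-neighbourhood of the square vertex
  \<open>p0\<close> below the roof \<open>p4\<close>: without a prism and a double house, all of
  \<open>M p0\<close> sees \<open>p1\<close> and \<open>p3\<close> and misses \<open>p4\<close>. A
  mixed edge of \<open>M p0\<close> then contradicts the excluded subgraphs.\<close>

lemma ex_double_house:
  assumes no_prism: "\<And>a b c x y z. \<not> prism a b c x y z"
  shows "\<exists>a b c d r t. double_house a b c d r t"
proof (rule ccontr)
  assume "\<not> ?thesis"
  then have no_double: "\<not> double_house a b c d r t" for a b c d r t
    by blast
  obtain p0 p1 p2 p3 p4 where H: "house p0 p1 p2 p3 p4"
    using ex_house by blast
  then have h: "p0 \<in> V" "p1 \<in> V" "p2 \<in> V" "p3 \<in> V" "p4 \<in> V"
    "E p0 p1" "E p1 p2" "E p2 p3" "E p3 p0" "E p4 p0" "E p4 p1"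
    "\<not> E p0 p2" "\<not> E p1 p3" "\<not> E p4 p2" "\<not> E p4 p3"
    by (auto simp: house_def)
  have type2: "E w p1 \<and> E w p3 \<and> \<not> E w p4"
    if u: "u \<in> V" "E u p1" "E u p3" "\<not> E u p4" "\<not> E u p0" and w: "w \<in> V" "E w u" "\<not> E w p0" for u w
  proof -
    note facts = h u w
    have 1: "E w p3"
    proof (rule ccontr)
      assume n: "\<not> E w p3"
      then have "\<not> E w p4"
        using no_C5[OF c5, of w u p3 p0 p4] facts by (auto simp: E_commute)
      then show False
        using n no_P5[OF pg, of w u p3 p0 p4] facts by (auto simp: E_commute)
    qed
    have 2: "E w p1"
      using 1 no_double[of p0 p1 u p3 p4 w] no_prism[of p4 p0 p1 w p3 u] facts
      by (auto simp: double_house_def house_def prism_def E_commute)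
    have 3: "\<not> E w p4"
      using 1 2 no_gem[OF pg, of p4 p1 u p3 w] facts by (auto simp: E_commute)
    show ?thesis
      using 1 2 3 by blast
  qed
  define X where "X = {u \<in> M p0. E u p1 \<and> E u p3 \<and> \<not> E u p4}"
  have "p2 \<noteq> p0"
    using h E_irrefl by metis
  then have "p2 \<in> X"
    using h by (auto simp: X_def M_def E_commute)
  have X: "X = M p0"
  proof (rule ccontr)
    assume "X \<noteq> M p0"
    then obtain u w where uw: "u \<in> X" "w \<in> M p0 - X" "E u w"
      using M_connected[of p0 X] \<open>p2 \<in> X\<close> h(1) by (auto simp: X_def)
    then have "E w p1 \<and> E w p3 \<and> \<not> E w p4"
      by (intro type2[of u w]) (auto simp: X_def M_def E_commute)
    then show False
      using uw by (auto simp: X_def)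
  qed
  obtain s e f where s: "s \<in> V" "E p0 s" "e \<in> M p0" "f \<in> M p0" "E e f" "E s e" "\<not> E s f"
    using mixed_edge[OF h(1), of "M p0"] M_nonempty[OF h(1)] by blast
  have ef: "e \<in> V" "E e p1" "E e p3" "\<not> E e p4" "\<not> E e p0" "f \<in> V" "E f p1" "E f p3" "\<not> E f p4" "\<not> E f p0"
    using s(3,4)[folded X] by (auto simp: X_def M_def E_commute)
  note facts = h(1,2,4-6,9-11,13,15) s(1,2,5-7) ef
  have 1: "E s p4"
    using no_P5[OF pg, of p4 p0 s e f] facts by (auto simp: E_commute)
  have 2: "E s p1"
    using 1 no_P5[OF pg, of s p4 p1 f p3] no_C5[OF c5, of s p4 p1 f p3] facts by (auto simp: E_commute)
  have 3: "\<not> E s p3"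
    using 1 2 no_gem[OF pg, of p4 p1 e p3 s] facts by (auto simp: E_commute)
  show False
    using 1 2 3 no_gem[OF pg, of s p1 f p3 e] facts by (auto simp: E_commute)
qed

lemma ex_leaving_edge: "X \<subseteq> V \<Longrightarrow> X \<noteq> {} \<Longrightarrow> X \<noteq> V \<Longrightarrow> \<exists>x\<in>X. \<exists>y\<in>V - X. E x y"
  using connected by metis

lemma embeds_prism: "prism a b c x y z \<Longrightarrow> embeds V Prism ((!) [a, b, c, x, y, z])"
  unfolding embeds_def Prism_def prism_def
  by (simp add: All_less_Suc eval_nat_numeral adj_def E_commute)

lemma prism_embeds: "embeds V Prism f \<Longrightarrow> prism (f 0) (f 1) (f 2) (f 3) (f 4) (f 5)"
  unfolding embeds_def Prism_def prism_def
  by (simp add: All_less_Suc eval_nat_numeral adj_def)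

lemma embeds_double_house: "double_house a b c d r t \<Longrightarrow> embeds V Double_house ((!) [a, b, c, d, r, t])"
  unfolding embeds_def Double_house_def double_house_def house_def
  by (simp add: All_less_Suc eval_nat_numeral adj_def E_commute)

text \<open>Without a prism every vertex is a clone of a vertex of the double house. A class of
  clones is homogeneous, hence a single vertex, so the roof \<open>f 4\<close> has at most two
  neighbours. This is less than \<omega>, as the roof lies in a triangle, and contradicts
  \<open>degree\<close>.\<close>

lemma ex_prism: "\<exists>f. embeds V Prism f"
proof (rule ccontr)
  assume no: "\<not> ?thesis"
  then have "\<not> prism a b c x y z" for a b c x y z
    using embeds_prism by blast
  then obtain f where f: "embeds V Double_house f"
    using ex_double_house embeds_double_house by blast
  have len: "length Double_house = 6"
    by (simp add: Double_house_def)
  have rigid: "rigid Double_house [[]]"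
    using rigid_all by simp
  have types: "(\<exists>i<length Double_house. like Double_house f i x) \<or> trace f (length Double_house) x = []"
    if "embeds V Double_house f" "x \<in> V" for f x
    using closed_cases[OF closed_Double_house pg c5 that] no by auto
  have types': "(\<exists>i<length Double_house. like Double_house f i x) \<or>
    trace f (length Double_house) x \<in> set [[]]"
    if "embeds V Double_house f" "x \<in> V" for f x
    using types[OF that] by simp
  have all: "\<exists>i<length Double_house. like Double_house f i x" if "x \<in> V" for x
    using all_like[OF rigid f _ types ex_leaving_edge that] by (simp add: Double_house_def)
  have uniq: "x = y" if x: "x \<in> V" "like Double_house f i x" and y: "y \<in> V" "like Double_house f i y"
    and i: "i < length Double_house" for x y i
  proof (rule ccontr)
    assume "x \<noteq> y"
    show False
    proof (rule no_module[of "{z \<in> V. like Double_house f i z}" x y])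
      obtain j where j: "j < length Double_house" "j \<noteq> i"
        using len by (metis one_less_numeral_iff order.strict_trans semiring_norm(76) zero_less_numeral
          zero_neq_one)
      then have "f j \<notin> {z \<in> V. like Double_house f i z}"
        using like_unique[OF rigid i j(1)] like_self[OF f j(1)] by blast
      then show "{z \<in> V. like Double_house f i z} \<noteq> V"
        using embedsD(1)[OF f j(1)] by blast
      fix v a b
      assume v: "v \<in> V - {z \<in> V. like Double_house f i z}" and ab: "a \<in> {z \<in> V. like Double_house f i z}"
        "b \<in> {z \<in> V. like Double_house f i z}" and "E v a"
      obtain k where k: "k < length Double_house" "like Double_house f k v"
        using all v by blast
      then have "k \<noteq> i"
        using v by blast
      then have "E v a \<longleftrightarrow> adj Double_house k i" "E v b \<longleftrightarrow> adj Double_house k i"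
        using like_adj[OF pg rigid f types' _ k(2) _ _ k(1) i] v ab by auto
      then show "E v b"
        using \<open>E v a\<close> by blast
    qed (use x y \<open>x \<noteq> y\<close> in auto)
  qed
  have "{u \<in> V. E (f 4) u} \<subseteq> {f 0, f 1}"
  proof
    fix u assume "u \<in> {u \<in> V. E (f 4) u}"
    then have u: "u \<in> V" "E (f 4) u"
      by auto
    obtain k where k: "k < length Double_house" "like Double_house f k u"
      using all u(1) by blast
    have uk: "u = f k"
      using uniq[OF u(1) k(2) _ like_self[OF f k(1)] k(1)] embedsD(1)[OF f k(1)] by blast
    then have "k \<noteq> 4"
      using u(2) E_irrefl by blast
    then have "adj Double_house 4 k"
      using embedsD(2)[OF f, of 4 k] u(2) uk k(1) len by auto
    then have "k = 0 \<or> k = 1"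
      using \<open>k \<noteq> 4\<close> k(1) by (auto simp: Double_house_def adj_def less_Suc_eq eval_nat_numeral)
    then show "u \<in> {f 0, f 1}"
      using uk by auto
  qed
  then have "card {u \<in> V. E (f 4) u} \<le> card {f 0, f 1}"
    by (intro card_mono) auto
  also have "\<dots> \<le> 2"
    by (simp add: card_insert_if)
  finally have "om V \<le> 2"
    using degree[of "f 4"] embedsD(1)[OF f, of 4] len by simp
  moreover have tri: "E (f 0) (f 1)" "E (f 0) (f 4)" "E (f 1) (f 4)"
    using embedsD(2)[OF f, of 0 1] embedsD(2)[OF f, of 0 4] embedsD(2)[OF f, of 1 4] len
    by (auto simp: Double_house_def adj_def eval_nat_numeral)
  then have "clique {f 0, f 1, f 4}" "card {f 0, f 1, f 4} = 3"
    using E_commute E_irrefl by (auto simp: clique_def card_insert_if)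
  then have "3 \<le> om V"
    using om_ge[OF fin, of "{f 0, f 1, f 4}"] embedsD(1)[OF f] len by auto
  ultimately show False
    by simp
qed

section \<open>The two cliques around a prism\<close>

lemma prism_trace:
  assumes "embeds V Prism f" "x \<in> V"
  shows "trace f 6 x \<in> set [[], [3, 4, 5], [2, 3, 4], [2, 3, 4, 5], [1, 3, 5], [1, 3, 4, 5],
    [1, 2, 3], [0, 4, 5], [0, 3, 4, 5], [0, 2, 4], [0, 1, 5], [0, 1, 2], [0, 1, 2, 5], [0, 1, 2, 4],
      [0, 1, 2, 3]]"
  using trace_in_exts[OF pg c5 assms, where h = True and k = 6]
    unfolding exts_Prism by (simp add: Prism_def)

lemma trace6: "trace f 6 x = filter (\<lambda>i. E x (f i)) [0, 1, 2, 3, 4, 5]"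
proof -
  have "[0..<6] = [0, 1, 2, 3, 4, 5]"
    by (simp add: upt_rec)
  then show ?thesis
    by (simp add: trace_def)
qed

text \<open>One automorphism for each image of the vertex 0, so that facts about this vertex carry
  over to all others. The one starting with 3 exchanges the triangles and defines
  \<open>opp\<close>.\<close>

lemma Prism_automorphisms:
  "copy_at Prism [1, 2, 0, 4, 5, 3] Prism" "copy_at Prism [2, 0, 1, 5, 3, 4] Prism"
  "copy_at Prism [3, 4, 5, 0, 1, 2] Prism" "copy_at Prism [4, 5, 3, 1, 2, 0] Prism"
  "copy_at Prism [5, 3, 4, 2, 0, 1] Prism" "copy_at Prism [0, 1, 2, 3, 4, 5] Prism"
  by code_simp+

lemma Prism_transitive:
  assumes "i < 6"
  obtains e where "copy_at Prism e Prism" "e ! 0 = i" "length e = 6" "distinct e"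
proof -
  have "i \<in> {0, 1, 2, 3, 4, 5}"
    using assms by auto
  then show ?thesis
    using that[of "[0, 1, 2, 3, 4, 5]"] that[of "[1, 2, 0, 4, 5, 3]"] that[of "[2, 0, 1, 5, 3, 4]"]
      that[of "[3, 4, 5, 0, 1, 2]"] that[of "[4, 5, 3, 1, 2, 0]"] that[of "[5, 3, 4, 2, 0, 1]"]
      Prism_automorphisms by auto
qed

text \<open>The clones of \<open>f 0\<close> among its non-neighbours do not include the
  non-neighbour \<open>f 4\<close>, so connectedness of \<open>M (f 0)\<close> yields an edge
  \<open>u v\<close> from such a clone \<open>u\<close> to a non-clone \<open>v\<close>. The traces
  of \<open>v\<close> before and after putting \<open>u\<close> for \<open>f 0\<close> differ
  exactly in 0.\<close>

lemma Prism_clone0: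
  assumes f: "embeds V Prism f" and fw: "embeds V Prism (f(0 := w))" and "w \<noteq> f 0"
  shows "E w (f 0)"
proof (rule ccontr)
  assume nw: "\<not> E w (f 0)"
  define X where "X = {u \<in> M (f 0). embeds V Prism (f(0 := u))}"
  have p: "prism (f 0) (f 1) (f 2) (f 3) (f 4) (f 5)"
    using prism_embeds[OF f] .
  have "w \<in> V"
    using embedsD(1)[OF fw, of 0] by (simp add: Prism_def)
  then have "w \<in> X"
    using fw nw assms(3) by (auto simp: X_def M_def E_commute)
  moreover have "f 4 \<in> M (f 0)"
  proof -
    have "f 4 \<noteq> f 0"
      using p unfolding prism_def by metis
    then show ?thesis
      using p by (auto simp: prism_def M_def)
  qed
  moreover have "f 4 \<notin> X"
    using prism_embeds[of "f(0 := f 4)"] p by (auto simp: X_def prism_def E_commute)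
  ultimately obtain u v where uv: "u \<in> X" "v \<in> M (f 0) - X" "E u v"
    using M_connected[of "f 0" X] p by (auto simp: X_def prism_def)
  have u: "embeds V Prism (f(0 := u))" "u \<in> V" "\<not> E u (f 0)"
    using uv(1) by (auto simp: X_def M_def E_commute)
  have v: "v \<in> V" "\<not> E v (f 0)" "\<not> embeds V Prism (f(0 := v))"
    using uv(2) by (auto simp: X_def M_def E_commute)
  have "trace (f(0 := u)) 6 v = 0 # trace f 6 v"
    using uv(3) v(2) by (simp add: trace6 E_commute)
  \<comment> \<open>These are the only traces in the table without 0 that stay in the table when 0
    is added.\<close>
  then have "trace f 6 v = [1, 2, 3] \<or> trace f 6 v = [3, 4, 5]"
    using prism_trace[OF f v(1)] prism_trace[OF u(1) v(1)] by auto
  then show False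
  proof
    assume t: "trace f 6 v = [1, 2, 3]"
    have "like Prism f 0 v"
      unfolding like_def using traceD[OF t] by (auto simp: Prism_def adj_def less_Suc_eq eval_nat_numeral)
    then show False
      using embeds_like[OF f v(1)] v(3) by blast
  next
    assume t: "trace f 6 v = [3, 4, 5]"
    have "E v (f 4)" "\<not> E v (f 2)"
      using traceD[OF t, of 4] traceD[OF t, of 2] by auto
    moreover have "E u (f 2)" "\<not> E u (f 4)"
      using prism_embeds[OF u(1)] by (auto simp: prism_def)
    ultimately show False
      using no_P5[OF pg, of "f 0" "f 2" u v "f 4"] p u v uv(3) by (auto simp: prism_def E_commute)
  qed
qed

lemma Prism_clone:
  assumes f: "embeds V Prism f" and fw: "embeds V Prism (f(i := w))" and "w \<noteq> f i" "i < 6"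
  shows "E w (f i)"
proof -
  obtain e where e: "copy_at Prism e Prism" "e ! 0 = i" "length e = 6" "distinct e"
    using Prism_transitive[OF assms(4)] .
  have "embeds V Prism (\<lambda>j. f (e ! j))"
    using embeds_copy[OF f e(1)] .
  moreover have "embeds V Prism ((\<lambda>j. f (e ! j))(0 := w))"
  proof -
    have *: "embeds V Prism (\<lambda>j. (f(i := w)) (e ! j))"
      using embeds_copy[OF fw e(1)] .
    have "(f(i := w)) (e ! j) = ((\<lambda>j. f (e ! j))(0 := w)) j" if "j < length Prism" for j
      using e that nth_eq_iff_index_eq[OF e(4), of j 0] by (auto simp: Prism_def)
    then show ?thesis
      using * unfolding embeds_def by simp
  qed
  ultimately show ?thesis
    using Prism_clone0[of "\<lambda>j. f (e ! j)" w] e(2) assms(3) by simp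
qed

text \<open>The triangle together with its common neighbours; equality is allowed because the three
  vertices themselves belong to the clique that this set turns out to be.\<close>

definition side :: "(nat \<Rightarrow> 'a) \<Rightarrow> 'a set" where
  "side f = {w \<in> V. \<forall>j<3. w = f j \<or> E w (f j)}"

definition opp :: "(nat \<Rightarrow> 'a) \<Rightarrow> nat \<Rightarrow> 'a" where
  "opp f j = f ([3, 4, 5, 0, 1, 2] ! j)"

lemma mem_side: "w \<in> side f \<longleftrightarrow> w \<in> V \<and> (w = f 0 \<or> E w (f 0)) \<and> (w = f 1 \<or> E w (f 1)) \<and> (w = f 2 \<or> E w (f 2))"
  by (auto simp: side_def less_Suc_eq eval_nat_numeral)

lemma opp_simps: "opp f 0 = f 3" "opp f 1 = f 4" "opp f (Suc 0) = f 4" "opp f 2 = f 5" "opp f 3 = f 0"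
  "opp f 4 = f 1" "opp f 5 = f 2"
  by (auto simp: opp_def eval_nat_numeral)

lemma embeds_opp: "embeds V Prism f \<Longrightarrow> embeds V Prism (opp f)"
  using embeds_copy[OF _ Prism_automorphisms(3)] unfolding opp_def .

lemma opp_opp: "j < 6 \<Longrightarrow> opp (opp f) j = f j"
  by (auto simp: opp_def less_Suc_eq eval_nat_numeral)

lemma opp_image: "side (opp (opp f)) = side f"
  by (auto simp: mem_side opp_opp)

lemma like_clone:
  assumes f: "embeds V Prism f" and x: "x \<in> V" "like Prism f i x" "i < 6"
  shows "x = f i \<or> E x (f i)"
  using Prism_clone[OF f embeds_like[OF f x(1,2)]] x(3) by blast

lemma like_Prism:
  "like Prism f 0 x \<longleftrightarrow> E x (f 1) \<and> E x (f 2) \<and> E x (f 3) \<and> \<not> E x (f 4) \<and> \<not> E x (f 5)"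
  "like Prism f 1 x \<longleftrightarrow> E x (f 0) \<and> E x (f 2) \<and> E x (f 4) \<and> \<not> E x (f 3) \<and> \<not> E x (f 5)"
  "like Prism f (Suc 0) x \<longleftrightarrow> E x (f 0) \<and> E x (f 2) \<and> E x (f 4) \<and> \<not> E x (f 3) \<and> \<not> E x (f 5)"
  "like Prism f 2 x \<longleftrightarrow> E x (f 0) \<and> E x (f 1) \<and> E x (f 5) \<and> \<not> E x (f 3) \<and> \<not> E x (f 4)"
  "like Prism f 3 x \<longleftrightarrow> E x (f 0) \<and> E x (f 4) \<and> E x (f 5) \<and> \<not> E x (f 1) \<and> \<not> E x (f 2)"
  "like Prism f 4 x \<longleftrightarrow> E x (f 1) \<and> E x (f 3) \<and> E x (f 5) \<and> \<not> E x (f 0) \<and> \<not> E x (f 2)"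
  "like Prism f 5 x \<longleftrightarrow> E x (f 2) \<and> E x (f 3) \<and> E x (f 4) \<and> \<not> E x (f 0) \<and> \<not> E x (f 1)"
  unfolding like_def Prism_def by (auto simp: All_less_Suc eval_nat_numeral adj_def)

lemma Prism_trace_cases:
  assumes f: "embeds V Prism f" and x: "x \<in> V"
  shows "trace f 6 x = [] \<or> trace f 6 x = [0, 1, 2] \<or> trace f 6 x = [3, 4, 5] \<or> (\<exists>i<6. like Prism f i x)"
proof -
  have T: "E x (f j) \<longleftrightarrow> j \<in> set (trace f 6 x)" if "j < 6" for j
    using that by simp
  have all: "like Prism f 0 x \<or> like Prism f 1 x \<or> like Prism f 2 x \<or> like Prism f 3 x \<or> like Prism f 4 x \<or>
      like Prism f 5 x \<longrightarrow> (\<exists>i<6. like Prism f i x)"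
    by (auto intro: exI[of _ 0] exI[of _ 1] exI[of _ 2] exI[of _ 3] exI[of _ 4] exI[of _ 5])
  consider "trace f 6 x \<in> set [[], [3, 4, 5], [0, 1, 2]]"
    | "trace f 6 x \<in> set [[2, 3, 4], [2, 3, 4, 5], [1, 3, 5], [1, 3, 4, 5], [1, 2, 3], [0, 4, 5],
      [0, 3, 4, 5], [0, 2, 4], [0, 1, 5], [0, 1, 2, 5], [0, 1, 2, 4], [0, 1, 2, 3]]"
    using prism_trace[OF f x] by fastforce
  then show ?thesis
  proof cases
    case 1
    then show ?thesis
      by auto
  next
    case 2
    have e: "E x (f 0) \<longleftrightarrow> 0 \<in> set (trace f 6 x)" "E x (f 1) \<longleftrightarrow> 1 \<in> set (trace f 6 x)"
      "E x (f 2) \<longleftrightarrow> 2 \<in> set (trace f 6 x)" "E x (f 3) \<longleftrightarrow> 3 \<in> set (trace f 6 x)"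
      "E x (f 4) \<longleftrightarrow> 4 \<in> set (trace f 6 x)" "E x (f 5) \<longleftrightarrow> 5 \<in> set (trace f 6 x)"
      by auto
    have "like Prism f 0 x \<or> like Prism f 1 x \<or> like Prism f 2 x \<or> like Prism f 3 x \<or> like Prism f 4 x \<or>
      like Prism f 5 x"
      unfolding like_Prism e using 2
      by (simp only: list.set insert_iff empty_iff simp_thms) (elim disjE; simp del: mem_trace)
    then show ?thesis
      using all by blast
  qed
qed

text \<open>Otherwise connectedness gives an edge from a vertex \<open>w\<close> with a non-empty
  trace to a vertex \<open>y\<close> with an empty one. If \<open>w\<close> sees exactly a triangle,
  there is a P5; if \<open>w\<close> is a clone, putting it into the prism gives \<open>y\<close> a
  trace with one element, which the table excludes.\<close>

lemma no_outsider:
  assumes f: "embeds V Prism f" and z: "z \<in> V"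
  shows "trace f 6 z \<noteq> []"
proof
  assume tz: "trace f 6 z = []"
  have nz: "\<not> E z (f j)" if "j < 6" for j
    using traceD[OF tz that] by simp
  define X where "X = {w \<in> V. trace f 6 w \<noteq> []}"
  have p: "prism (f 0) (f 1) (f 2) (f 3) (f 4) (f 5)"
    using prism_embeds[OF f] .
  have "f 0 \<in> X"
    using p by (auto simp: X_def prism_def trace6)
  moreover have "z \<notin> X"
    using tz by (simp add: X_def)
  ultimately obtain w y where wy: "w \<in> X" "y \<in> V - X" "E w y"
    using ex_leaving_edge[of X] z by (auto simp: X_def)
  have ty: "trace f 6 y = []" and y: "y \<in> V" and w: "w \<in> V"
    using wy by (auto simp: X_def)
  have ny: "\<not> E y (f j)" if "j < 6" for j
    using traceD[OF ty that] by simp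
  consider "trace f 6 w = [0, 1, 2]" | "trace f 6 w = [3, 4, 5]" | i where "i < 6" "like Prism f i w"
    using Prism_trace_cases[OF f w] wy(1) by (auto simp: X_def)
  then show False
  proof cases
    case 1
    show False
      using no_P5[OF pg, of y w "f 0" "f 3" "f 4"] traceD[OF 1, of 0] traceD[OF 1, of 3] traceD[OF 1, of 4]
        ny[of 0] ny[of 3] ny[of 4] wy(3) y w p by (auto simp: prism_def E_commute)
  next
    case 2
    show False
      using no_P5[OF pg, of y w "f 3" "f 0" "f 1"] traceD[OF 2, of 0] traceD[OF 2, of 3] traceD[OF 2, of 1]
        ny[of 0] ny[of 3] ny[of 1] wy(3) y w p by (auto simp: prism_def E_commute)
  next
    case (3 i)
    have "embeds V Prism (f(i := w))"
      using embeds_like[OF f w 3(2)] .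
    from prism_trace[OF this y] have "trace (f(i := w)) 6 y \<noteq> [i]"
      by auto
    moreover have "i = 0 \<or> i = 1 \<or> i = 2 \<or> i = 3 \<or> i = 4 \<or> i = 5"
      using 3(1) by auto
    then have "trace (f(i := w)) 6 y = [i]"
      using ny[of 0] ny[of 1] ny[of 2] ny[of 3] ny[of 4] ny[of 5] wy(3) E_commute[of w y]
      by (elim disjE) (simp_all add: trace6)
    ultimately show False
      by blast
  qed
qed

lemma side_cover:
  assumes f: "embeds V Prism f" and x: "x \<in> V"
  shows "x \<in> side f \<or> x \<in> side (opp f)"
proof -
  have p: "prism (f 0) (f 1) (f 2) (f 3) (f 4) (f 5)"
    using prism_embeds[OF f] .
  consider "trace f 6 x = [0, 1, 2]" | "trace f 6 x = [3, 4, 5]" | i where "i < 6" "like Prism f i x"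
    using Prism_trace_cases[OF f x] no_outsider[OF f x] by auto
  then show ?thesis
  proof cases
    case 1
    then show ?thesis
      using x traceD[OF 1, of 0] traceD[OF 1, of 1] traceD[OF 1, of 2] by (auto simp: mem_side)
  next
    case 2
    then show ?thesis
      using x traceD[OF 2, of 3] traceD[OF 2, of 4] traceD[OF 2, of 5] by (auto simp: mem_side opp_simps)
  next
    case (3 i)
    have "i = 0 \<or> i = 1 \<or> i = 2 \<or> i = 3 \<or> i = 4 \<or> i = 5"
      using 3(1) by auto
    then show ?thesis
      using 3(2) like_clone[OF f x 3(2,1)] x
      by (elim disjE) (auto simp: mem_side opp_simps like_Prism)
  qed
qed

lemma side_disjoint:
  assumes f: "embeds V Prism f" and x: "x \<in> side f" "x \<in> side (opp f)"
  shows False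
proof -
  have p: "prism (f 0) (f 1) (f 2) (f 3) (f 4) (f 5)"
    using prism_embeds[OF f] .
  have xV: "x \<in> V"
    using x(1) by (simp add: mem_side)
  have *: "x = f j \<or> E x (f j)" if "j \<in> {0, 1, 2, 3, 4, 5}" for j
    using x that by (auto simp: mem_side opp_simps)
  have "x \<noteq> f 0" "x \<noteq> f 1" "x \<noteq> f 2" "x \<noteq> f 3" "x \<noteq> f 4" "x \<noteq> f 5"
    using *[of 4] *[of 5] *[of 0] *[of 1] *[of 2] *[of 3] p unfolding prism_def
    by (metis E_commute insertCI)+
  then have "E x (f 0)" "E x (f 1)" "E x (f 2)" "E x (f 3)" "E x (f 4)" "E x (f 5)"
    using * by blast+
  then show False
    using prism_trace[OF f xV] by (simp add: trace6)
qed

lemma side_traces: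
  assumes f: "embeds V Prism f" and x: "x \<in> side f" "x \<notin> {f 0, f 1, f 2}"
  shows "trace f 6 x \<in> set [[0, 1, 2], [0, 1, 2, 3], [0, 1, 2, 4], [0, 1, 2, 5]]"
proof -
  have "E x (f 0)" "E x (f 1)" "E x (f 2)" "x \<in> V"
    using x by (auto simp: mem_side)
  then show ?thesis
    using prism_trace[OF f, of x] by (auto simp: trace6 split: if_splits)
qed

text \<open>If \<open>x\<close> also saw a vertex of the other triangle, it would be a clone of some
  \<open>f j\<close>. With \<open>x\<close> in its place the table makes \<open>y\<close> a clone of
  \<open>x\<close>, and clones are adjacent by \<open>Prism_clone\<close>.\<close>

lemma side_nonadjacent:
  assumes f: "embeds V Prism f" and xy: "x \<in> side f" "y \<in> side f" "x \<noteq> y" "\<not> E x y"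
  shows "x \<notin> {f 0, f 1, f 2}" "trace f 6 x = [0, 1, 2]"
proof -
  show x: "x \<notin> {f 0, f 1, f 2}"
    using xy by (auto simp: mem_side E_commute)
  have y: "y \<notin> {f 0, f 1, f 2}"
    using xy by (auto simp: mem_side E_commute)
  have V: "x \<in> V" "y \<in> V"
    using xy by (auto simp: mem_side)
  have *: False if j: "j \<in> {0, 1, 2}" and t: "trace f 6 x = [0, 1, 2, 3 + j]" for j
  proof -
    have lx: "like Prism f j x"
      using j traceD[OF t, of 0] traceD[OF t, of 1] traceD[OF t, of 2] traceD[OF t, of 3] traceD[OF t,
        of 4] traceD[OF t, of 5]
      by (auto simp: like_Prism)
    let ?f = "f(j := x)"
    have f': "embeds V Prism ?f"
      using embeds_like[OF f V(1) lx] .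
    have ty: "trace f 6 y \<in> set [[0, 1, 2], [0, 1, 2, 3], [0, 1, 2, 4], [0, 1, 2, 5]]"
      using side_traces[OF f xy(2) y] .
    have yx: "\<not> E y x"
      using xy(4) E_commute by blast
    have "trace ?f 6 y = filter (\<lambda>i. i \<noteq> j) (trace f 6 y)"
      using yx j by (auto simp: trace6)
    then have t: "trace ?f 6 y \<in> set [[1, 2, 3], [0, 2, 4], [0, 1, 5]]"
      using prism_trace[OF f' V(2)] ty j by auto
    moreover have "j \<notin> set (trace ?f 6 y)"
      using yx by simp
    ultimately consider "j = 0" "trace ?f 6 y = [1, 2, 3]" | "j = 1" "trace ?f 6 y = [0, 2, 4]"
      | "j = 2" "trace ?f 6 y = [0, 1, 5]"
      using j by (auto simp del: mem_trace)
    then have l: "like Prism ?f j y"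
    proof cases
      case 1
      then show ?thesis
        using traceD[OF 1(2), of 0] traceD[OF 1(2), of 1] traceD[OF 1(2), of 2] traceD[OF 1(2), of 3]
          traceD[OF 1(2), of 4] traceD[OF 1(2), of 5] by (simp add: like_Prism)
    next
      case 2
      then show ?thesis
        using traceD[OF 2(2), of 0] traceD[OF 2(2), of 1] traceD[OF 2(2), of 2] traceD[OF 2(2), of 3]
          traceD[OF 2(2), of 4] traceD[OF 2(2), of 5] by (simp add: like_Prism)
    next
      case 3
      then show ?thesis
        using traceD[OF 3(2), of 0] traceD[OF 3(2), of 1] traceD[OF 3(2), of 2] traceD[OF 3(2), of 3]
          traceD[OF 3(2), of 4] traceD[OF 3(2), of 5] by (simp add: like_Prism)
    qed
    have "j < 6"
      using j by auto
    then have "y = ?f j \<or> E y (?f j)"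
      using like_clone[OF f' V(2) l] by blast
    then show False
      using yx xy(3) by auto
  qed
  show "trace f 6 x = [0, 1, 2]"
    using side_traces[OF f xy(1) x] *[of 0] *[of 1] *[of 2] by auto
qed

text \<open>For a non-neighbour \<open>y\<close> in the same side, connectedness of
  \<open>M y\<close> gives an edge \<open>w v\<close> across the two sides with neither end adjacent
  to \<open>y\<close>. Two triangle vertices missed by \<open>v\<close>, their partners, and
  \<open>w v\<close> form a new prism, in which \<open>y\<close> sees only two adjacent vertices; no
  such trace exists.\<close>

lemma side_clique:
  assumes f: "embeds V Prism f"
  shows "clique (side f)"
proof (rule ccontr)
  assume "\<not> clique (side f)"
  then obtain x y where xy: "x \<in> side f" "y \<in> side f" "x \<noteq> y" "\<not> E x y"
    unfolding clique_def by blast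
  have p: "prism (f 0) (f 1) (f 2) (f 3) (f 4) (f 5)"
    using prism_embeds[OF f] .
  have V: "x \<in> V" "y \<in> V"
    using xy by (auto simp: mem_side)
  have ty: "trace f 6 y = [0, 1, 2]"
    using side_nonadjacent(2)[OF f xy(2,1)] xy(3,4) E_commute by blast
  define X where "X = {w \<in> M y. w \<in> side f}"
  have "x \<in> X"
    using xy V by (auto simp: X_def M_def E_commute)
  moreover have "f 3 \<in> M y"
  proof -
    have "y \<noteq> f 3"
      using traceD[OF ty, of 1] p by (auto simp: prism_def E_commute)
    then show ?thesis
      using traceD[OF ty, of 3] p by (auto simp: M_def prism_def)
  qed
  moreover have "f 3 \<notin> X"
    using p E_irrefl by (auto simp: X_def mem_side prism_def E_commute)
  ultimately obtain w v where wv: "w \<in> X" "v \<in> M y - X" "E w v"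
    using M_connected[OF V(2), of X] by (auto simp: X_def)
  have w: "w \<in> side f" "w \<noteq> y" "\<not> E w y" "w \<in> V"
    using wv(1) by (auto simp: X_def M_def E_commute)
  have v: "v \<in> side (opp f)" "\<not> E v y" "v \<in> V"
    using wv(2) side_cover[OF f, of v] by (auto simp: X_def M_def E_commute)
  have tw: "trace f 6 w = [0, 1, 2]"
    using side_nonadjacent(2)[OF f w(1) xy(2) w(2,3)] .
  have nw: "\<not> E w (f 3)" "\<not> E w (f 4)" "\<not> E w (f 5)" and ew: "E w (f 0)" "E w (f 1)" "E w (f 2)"
    using traceD[OF tw, of 0] traceD[OF tw, of 1] traceD[OF tw, of 2] traceD[OF tw, of 3] traceD[OF tw,
      of 4]
      traceD[OF tw, of 5] by auto
  have vn: "v \<notin> {opp f 0, opp f 1, opp f 2}"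
    using wv(3) nw by (auto simp: opp_simps)
  have tv: "trace (opp f) 6 v \<in> set [[0, 1, 2], [0, 1, 2, 3], [0, 1, 2, 4], [0, 1, 2, 5]]"
    using side_traces[OF embeds_opp[OF f] v(1) vn] .
  have ev: "E v (f 3)" "E v (f 4)" "E v (f 5)"
    using v(1) vn by (auto simp: mem_side opp_simps)
  have ey: "E y (f 0)" "E y (f 1)" "E y (f 2)" "\<not> E y (f 3)" "\<not> E y (f 4)" "\<not> E y (f 5)"
    using traceD[OF ty, of 0] traceD[OF ty, of 1] traceD[OF ty, of 2] traceD[OF ty, of 3] traceD[OF ty,
      of 4]
      traceD[OF ty, of 5] by auto
  have *: False if "prism a b w c d v" "E y a" "E y b" "\<not> E y c" "\<not> E y d" for a b c d
  proof -
    have "trace ((!) [a, b, w, c, d, v]) 6 y = [0, 1]"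
      using that w(3) v(2) by (simp add: trace6 E_commute)
    then show False
      using prism_trace[OF embeds_prism[OF that(1)] V(2)] by simp
  qed
  note facts = p w v ev ew nw wv(3)
  consider "\<not> E v (f 0)" "\<not> E v (f 1)" | "\<not> E v (f 0)" "\<not> E v (f 2)" | "\<not> E v (f 1)" "\<not> E v (f 2)"
    using tv by (auto simp: trace6 opp_simps split: if_splits)
  then show False
  proof cases
    case 1
    then show False
      using *[of "f 0" "f 1" "f 3" "f 4"] ey facts by (auto simp: prism_def E_commute)
  next
    case 2
    then show False
      using *[of "f 0" "f 2" "f 3" "f 5"] ey facts by (auto simp: prism_def E_commute)
  next
    case 3
    then show False
      using *[of "f 1" "f 2" "f 4" "f 5"] ey facts by (auto simp: prism_def E_commute)
  qed
qed

text \<open>Two neighbours \<open>b\<close>, \<open>b'\<close> of \<open>a\<close> in the other side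
  would be adjacent twins. A vertex \<open>x\<close> that separates them lies in the side of
  \<open>a\<close>. Each of \<open>b\<close>, \<open>b'\<close> misses at least two of
  \<open>f 0\<close>, \<open>f 1\<close>, \<open>f 2\<close>, so both miss a common one,
  \<open>k\<close>; then \<open>k\<close>, \<open>x\<close> and the two neighbours form the path of
  a gem with centre \<open>a\<close>.\<close>

lemma side_matched:
  assumes f: "embeds V Prism f" and a: "a \<in> side f" and b: "b \<in> side (opp f)" "b' \<in> side (opp f)"
    and ab: "E a b" "E a b'"
  shows "b = b'"
proof (rule ccontr)
  assume "b \<noteq> b'"
  have p: "prism (f 0) (f 1) (f 2) (f 3) (f 4) (f 5)"
    using prism_embeds[OF f] .
  have fside: "f 0 \<in> side f" "f 1 \<in> side f" "f 2 \<in> side f"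
    using p by (auto simp: mem_side prism_def E_commute)
  have clA: "u \<noteq> v \<Longrightarrow> u \<in> side f \<Longrightarrow> v \<in> side f \<Longrightarrow> E u v" for u v
    using side_clique[OF f] unfolding clique_def by blast
  have clB: "u \<noteq> v \<Longrightarrow> u \<in> side (opp f) \<Longrightarrow> v \<in> side (opp f) \<Longrightarrow> E u v" for u v
    using side_clique[OF embeds_opp[OF f]] unfolding clique_def by blast
  have few: "(\<not> E c (f 0) \<and> \<not> E c (f 1)) \<or> (\<not> E c (f 0) \<and> \<not> E c (f 2)) \<or> (\<not> E c (f 1) \<and> \<not> E c (f 2))"
    if c: "c \<in> side (opp f)" for c
  proof (cases "c \<in> {opp f 0, opp f 1, opp f 2}")
    case True
    then show ?thesis
      using p by (auto simp: opp_simps prism_def E_commute)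
  next
    case False
    then show ?thesis
      using side_traces[OF embeds_opp[OF f] c] by (auto simp: trace6 opp_simps split: if_splits)
  qed
  have gem: False if c: "c \<in> side (opp f)" "c' \<in> side (opp f)" "E a c" "E a c'" "c \<noteq> c'"
    and x: "x \<in> V" "x \<noteq> c" "x \<noteq> c'" "E x c" "\<not> E x c'" for c c' x
  proof -
    have xA: "x \<in> side f"
      using side_cover[OF f x(1)] clB[OF x(3) _ c(2)] x(5) by blast
    have ax: "E x a"
      using clA[OF _ xA a] c(4) x(5) by blast
    obtain k where k: "k \<in> {f 0, f 1, f 2}" "\<not> E c k" "\<not> E c' k"
      using few[OF c(1)] few[OF c(2)] by blast
    have kA: "k \<in> side f"
      using k(1) fside by blast
    have "k \<noteq> a" "k \<noteq> x"
      using k(2) c(3) x(4) E_commute by blast+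
    then have "E k a" "E k x"
      using clA kA a xA by blast+
    moreover have "c \<in> V" "c' \<in> V" "k \<in> V" "a \<in> V"
      using c(1,2) kA a by (auto simp: mem_side)
    ultimately show False
      using no_gem[OF pg, of k x c c' a] k c x ax clB[OF c(5,1,2)] by (auto simp: E_commute)
  qed
  show False
  proof (rule no_twins[of b b'])
    show "E b b'"
      using clB[OF \<open>b \<noteq> b'\<close> b] .
    show "E v b \<longleftrightarrow> E v b'" if "v \<in> V" "v \<noteq> b" "v \<noteq> b'" for v
      using gem[OF b ab \<open>b \<noteq> b'\<close> that] gem[OF b(2,1) ab(2,1) _ that(1,3,2)] \<open>b \<noteq> b'\<close> by blast
  qed (use b in \<open>auto simp: mem_side\<close>)
qed

text \<open>The stable set \<open>{f 0, f 4}\<close> is missed by some maximum clique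
  \<open>K\<close>. Neither side contains \<open>K\<close>, since \<open>f 0\<close> or
  \<open>f 4\<close> could be added, so \<open>K\<close> meets both sides. As the edges between them
  form a matching, \<open>K\<close> has at most two vertices, but the prism contains a
  triangle.\<close>

lemma contradiction: False
proof -
  obtain f where f: "embeds V Prism f"
    using ex_prism by blast
  have p: "prism (f 0) (f 1) (f 2) (f 3) (f 4) (f 5)"
    using prism_embeds[OF f] .
  have fo: "embeds V Prism (opp f)"
    using embeds_opp[OF f] .
  have f0: "f 0 \<in> side f" and f4: "f 4 \<in> side (opp f)"
    using p by (auto simp: mem_side prism_def opp_simps E_commute)
  have "stable {f 0, f 4}"
    using p E_irrefl by (auto simp: stable_def prism_def E_commute)
  then have "om V \<le> om (V - {f 0, f 4})"
    by (rule not_hitting)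
  then obtain K where K: "K \<subseteq> V - {f 0, f 4}" "clique K" "om V \<le> card K"
    using om_attained[of "V - {f 0, f 4}"] fin by (metis finite_Diff)
  have finK: "finite K"
    using K(1) fin by (meson Diff_subset finite_subset)
  have big: "\<not> K \<subseteq> side g" if g: "embeds V Prism g" "v \<in> side g" "v \<notin> K" for g v
  proof
    assume "K \<subseteq> side g"
    then have "clique (insert v K)"
      using side_clique[OF g(1)] g(2) clique_subset by (metis insert_subset)
    then show False
      using om_ge[OF fin, of "insert v K"] K(1,3) g(2,3) finK by (auto simp: mem_side)
  qed
  have tri: "3 \<le> om V"
  proof -
    have "clique {f 0, f 1, f 2}" "{f 0, f 1, f 2} \<subseteq> V"
      using p by (auto simp: clique_def prism_def E_commute)
    moreover have "f 0 \<noteq> f 1" "f 0 \<noteq> f 2" "f 1 \<noteq> f 2"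
      using p E_irrefl unfolding prism_def by metis+
    then have "card {f 0, f 1, f 2} = 3"
      by simp
    ultimately show ?thesis
      using om_ge[OF fin] by metis
  qed
  obtain a where a: "a \<in> K" "a \<in> side f"
    using big[OF fo f4] K(1) side_cover[OF f] by blast
  obtain b where b: "b \<in> K" "b \<in> side (opp f)"
    using big[OF f f0] K(1) side_cover[OF f] by blast
  have "K \<subseteq> {a, b}"
  proof
    fix c assume c: "c \<in> K"
    have ne: "a \<noteq> b"
      using side_disjoint[OF f a(2)] b(2) by blast
    have adj: "u \<noteq> v \<Longrightarrow> u \<in> K \<Longrightarrow> v \<in> K \<Longrightarrow> E u v" for u v
      using K(2) unfolding clique_def by blast
    show "c \<in> {a, b}"
    proof (rule ccontr)
      assume "c \<notin> {a, b}"
      then have e: "E a c" "E b c" "E a b" "E b a"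
        using adj a(1) b(1) c ne by auto
      show False
        using side_cover[OF f, of c] c K(1) side_matched[OF f a(2) b(2) _ e(3,1)]
          side_matched[OF fo b(2) _ _ e(4,2)] a(2) \<open>c \<notin> {a, b}\<close> by (auto simp: opp_image)
    qed
  qed
  then have "card K \<le> card {a, b}"
    by (intro card_mono) auto
  also have "\<dots> \<le> 2"
    by (simp add: card_insert_if)
  finally show False
    using tri K(3) by simp
qed

end

context adj_graph
begin

lemma colourable_om_if_C5_free:
  assumes "finite V" "pg_free V" "C5_free V"
  shows "colourable V (om V)"
  using assms
proof (induction V rule: finite_psubset_induct)
  case (psubset V)
  show ?case
  proof (rule ccontr)
    assume "\<not> colourable V (om V)"
    then interpret minimal_imperfect_C5_free E V
      using psubset by unfold_locales (auto intro: pg_free_subset C5_free_subset)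
    show False
      using contradiction .
  qed
qed

end

section \<open>Blow-ups of patterns\<close>

text \<open>This is \<open>\<lceil>5m/4\<rceil>\<close>.\<close>

definition bd :: "nat \<Rightarrow> nat" where
  "bd m = (5 * m + 3) div 4"

lemma bd_mono: "m \<le> n \<Longrightarrow> bd m \<le> bd n"
  unfolding bd_def by (intro div_le_mono) simp

lemma le_bd: "m \<le> bd m" "5 * m \<le> 4 * bd m"
  unfolding bd_def by auto

fun cliqs :: "nat list list \<Rightarrow> nat \<Rightarrow> nat list list" where
  "cliqs g 0 = [[]]"
| "cliqs g (Suc k) = concat (map (\<lambda>C. if list_all (adj g k) C then [C, C @ [k]] else [C]) (cliqs g k))"

text \<open>All maximal cliques of the pattern occur in \<open>Ds\<close>, so its finitely many
  weights control every clique of a blow-up.\<close>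

definition covers :: "nat list list \<Rightarrow> nat list list \<Rightarrow> bool" where
  "covers g Ds \<longleftrightarrow> list_all (\<lambda>D. List.member (cliqs g (length g)) D) Ds \<and>
     list_all (\<lambda>C. list_ex (\<lambda>D. list_all (List.member D) C) Ds) (cliqs g (length g))"

definition stable_list :: "nat list list \<Rightarrow> nat list \<Rightarrow> bool" where
  "stable_list g T \<longleftrightarrow> list_all (\<lambda>i. list_all (\<lambda>j. if i = j then True else \<not> adj g i j) T) T"

lemma cliqs_sound:
  "C \<in> set (cliqs g k) \<Longrightarrow> set C \<subseteq> {..<k} \<and> (\<forall>i\<in>set C. \<forall>j\<in>set C. i \<noteq> j \<longrightarrow> adj g i j)"
proof (induction k arbitrary: C)
  case (Suc k)
  then obtain B where B: "B \<in> set (cliqs g k)" "C = B \<or> C = B @ [k] \<and> list_all (adj g k) B"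
    by (auto split: if_splits)
  have "adj g i k" if "i \<in> set B" "list_all (adj g k) B" for i
    using that Suc.IH[OF B(1)] adj_sym[of k i g] by (auto simp: list_all_iff)
  then show ?case
    using Suc.IH[OF B(1)] B(2) by (auto simp: list_all_iff less_Suc_eq)
qed simp

lemma cliqs_complete:
  assumes "\<forall>i\<in>D. \<forall>j\<in>D. i \<noteq> j \<longrightarrow> adj g i j"
  shows "filter (\<lambda>i. i \<in> D) [0..<k] \<in> set (cliqs g k)"
proof (induction k)
  case (Suc k)
  show ?case
    using Suc assms by (auto simp: list_all_iff intro!: bexI[OF _ Suc])
qed simp

context adj_graph
begin

lemma om_Un_le:
  assumes "finite V" "X \<subseteq> V" "Y \<subseteq> V" "X \<inter> Y = {}" "\<And>x y. x \<in> X \<Longrightarrow> y \<in> Y \<Longrightarrow> E x y"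
  shows "om X + om Y \<le> om V"
proof -
  have fin: "finite X" "finite Y"
    using assms(1-3) finite_subset by auto
  obtain K L where K: "K \<subseteq> X" "clique K" "card K = om X" and L: "L \<subseteq> Y" "clique L" "card L = om Y"
    using om_attained[OF fin(1)] om_attained[OF fin(2)] by metis
  have "E u v" if "u \<in> K \<union> L" "v \<in> K \<union> L" "u \<noteq> v" for u v
    using that K(1,2) L(1,2) assms(5)[of u v] assms(5)[of v u] E_commute[of u v]
    unfolding clique_def by blast
  then have "clique (K \<union> L)"
    by (simp add: clique_def)
  moreover have "card (K \<union> L) = card K + card L"
    using K(1) L(1) fin assms(4) by (intro card_Un_disjoint) (auto intro: finite_subset)
  moreover have "K \<union> L \<subseteq> V"
    using K(1) L(1) assms(2,3) by auto
  ultimately show ?thesis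
    using om_ge[OF assms(1), of "K \<union> L"] K(3) L(3) by simp
qed

text \<open>Four consecutive vertices of the cycle form a P4, and \<open>v\<close> completes it to a
  gem.\<close>

lemma C5_free_neighbourhood:
  assumes "pg_free V" "v \<in> V" "X \<subseteq> V" "\<And>x. x \<in> X \<Longrightarrow> E v x"
  shows "C5_free X"
  unfolding C5_free_def
proof (intro allI impI notI)
  fix a b c d e assume X: "{a, b, c, d, e} \<subseteq> X" and "is_C5 a b c d e"
  then show False
    using no_gem[OF assms(1), of a b c d v] assms(2-4) by (auto simp: is_C5_def)
qed

end

locale minimal_excess = adj_graph +
  fixes V :: "'a set"
  assumes fin: "finite V" and pg: "pg_free V"
    and excess: "\<not> colourable V (bd (om V))"
    and minimal: "\<And>W. W \<subset> V \<Longrightarrow> colourable W (bd (om W))"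
begin

lemma colourable_sub: "W \<subset> V \<Longrightarrow> colourable W (bd (om V))"
  using minimal[of W] bd_mono[OF om_mono[OF fin, of W]] colourable_mono[of W "bd (om W)" "bd (om V)"
    W] by auto

lemma connected:
  assumes "X \<subseteq> V" "X \<noteq> {}" "X \<noteq> V"
  shows "\<exists>x\<in>X. \<exists>y\<in>V - X. E x y"
proof (rule ccontr)
  assume "\<not> ?thesis"
  moreover have "X \<subset> V" "V - X \<subset> V"
    using assms by auto
  ultimately have "colourable (X \<union> (V - X)) (bd (om V))"
    by (intro colourable_Un colourable_sub) auto
  moreover have "X \<union> (V - X) = V"
    using assms(1) by auto
  ultimately show False
    using excess by simp
qed

lemma part_colourable:
  assumes "v \<in> V" "X \<subseteq> V" "\<And>x. x \<in> X \<Longrightarrow> E v x"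
  shows "colourable X (om X)"
  using colourable_om_if_C5_free[OF finite_subset[OF assms(2) fin] pg_free_subset[OF pg assms(2)]
      C5_free_neighbourhood[OF pg assms]] .

end

section \<open>Blow-ups as weighted patterns and the removal of stable sets\<close>

locale blow_up = minimal_excess +
  fixes g :: "nat list list" and cl :: "'a \<Rightarrow> nat"
  assumes cl_less: "x \<in> V \<Longrightarrow> cl x < length g"
    and cross: "x \<in> V \<Longrightarrow> y \<in> V \<Longrightarrow> cl x \<noteq> cl y \<Longrightarrow> E x y \<longleftrightarrow> adj g (cl x) (cl y)"
    and occupied: "i < length g \<Longrightarrow> \<exists>x\<in>V. cl x = i"
    and neighbour: "i < length g \<Longrightarrow> \<exists>j<length g. j \<noteq> i \<and> adj g i j"
begin

definition part :: "nat \<Rightarrow> 'a set" where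
  "part i = {x \<in> V. cl x = i}"

definition w :: "nat \<Rightarrow> nat" where
  "w i = om (part i)"

lemma finite_part: "finite (part i)"
  unfolding part_def using fin by simp

lemma w_pos:
  assumes "i < length g"
  shows "1 \<le> w i"
proof -
  obtain x where "x \<in> V" "cl x = i"
    using occupied[OF assms] by blast
  then have "x \<in> part i"
    by (simp add: part_def)
  then show ?thesis
    unfolding w_def by (rule om_pos[OF finite_part])
qed

lemma part_perfect:
  assumes "i < length g"
  shows "colourable (part i) (w i)"
proof -
  obtain j where j: "j < length g" "j \<noteq> i" "adj g i j"
    using neighbour[OF assms] by blast
  obtain v where v: "v \<in> V" "cl v = j"
    using occupied[OF j(1)] by blast
  have "E v x" if "x \<in> part i" for x
    using that cross[of v x] v j adj_sym[of i j g] by (auto simp: part_def)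
  then show ?thesis
    unfolding w_def by (intro part_colourable[OF v(1)]) (auto simp: part_def)
qed

lemma clique_weight:
  assumes "D \<subseteq> {..<length g}" "\<forall>i\<in>D. \<forall>j\<in>D. i \<noteq> j \<longrightarrow> adj g i j"
  shows "sum w D \<le> om V"
proof -
  have finD: "finite D"
    using assms(1) finite_subset by blast
  have "\<exists>K. K \<subseteq> part i \<and> clique K \<and> card K = w i" for i
    using om_attained[OF finite_part] unfolding w_def by metis
  then obtain K where K: "K i \<subseteq> part i" "clique (K i)" "card (K i) = w i" for i
    by metis
  have "E u v" if neq: "u \<in> (\<Union>i\<in>D. K i)" "v \<in> (\<Union>i\<in>D. K i)" "u \<noteq> v" for u v
  proof -
    obtain i j where ij: "i \<in> D" "j \<in> D" "u \<in> K i" "v \<in> K j"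
      using neq(1,2) by blast
    then have uv: "u \<in> V" "v \<in> V" "cl u = i" "cl v = j"
      using K(1) by (auto simp: part_def)
    show ?thesis
    proof (cases "i = j")
      case True
      then show ?thesis
        using K(2)[of i] ij(3,4) neq(3) True unfolding clique_def by blast
    next
      case False
      then show ?thesis
        using cross[OF uv(1,2)] uv(3,4) assms(2) ij(1,2) by blast
    qed
  qed
  then have "clique (\<Union>i\<in>D. K i)"
    by (simp add: clique_def)
  moreover have "(\<Union>i\<in>D. K i) \<subseteq> V"
    using K(1) by (auto simp: part_def)
  moreover have "card (\<Union>i\<in>D. K i) = (\<Sum>i\<in>D. card (K i))"
  proof (rule card_UN_disjoint[OF finD])
    show "\<forall>i\<in>D. finite (K i)"
      using K(1) finite_part finite_subset by blast
    show "\<forall>i\<in>D. \<forall>j\<in>D. i \<noteq> j \<longrightarrow> K i \<inter> K j = {}"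
      using K(1) unfolding part_def by blast
  qed
  ultimately show ?thesis
    using om_ge[OF fin, of "\<Union>i\<in>D. K i"] K(3) by simp
qed

text \<open>A separate colouring of each part, with \<open>u i\<close> colours for part
  \<open>i\<close>; colours of different parts are not compared. It splits a part into stable
  layers, and removing the top one lowers the bound \<open>u i\<close> by one.\<close>

definition layered :: "('a \<Rightarrow> nat) \<Rightarrow> 'a set \<Rightarrow> (nat \<Rightarrow> nat) \<Rightarrow> bool" where
  "layered c W u \<longleftrightarrow> W \<subseteq> V \<and> (\<forall>x\<in>W. c x < u (cl x)) \<and> (\<forall>x\<in>W. \<forall>y\<in>W. cl x = cl y \<longrightarrow> E x y \<longrightarrow> c x \<noteq> c y)"

lemma ex_layered: "\<exists>c. layered c V w"
proof -
  have "\<exists>d::'a \<Rightarrow> nat. i < length g \<longrightarrow> d ` part i \<subseteq> {..<w i} \<and> proper (part i) d" for i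
    using part_perfect[of i] unfolding colourable_def by blast
  then obtain d :: "nat \<Rightarrow> 'a \<Rightarrow> nat" where
    d: "i < length g \<Longrightarrow> d i ` part i \<subseteq> {..<w i} \<and> proper (part i) (d i)" for i
    by metis
  have "layered (\<lambda>x. d (cl x) x) V w"
    unfolding layered_def
  proof (intro conjI ballI impI)
    fix x assume "x \<in> V"
    then show "d (cl x) x < w (cl x)"
      using d[OF cl_less] by (auto simp: part_def)
  next
    fix x y assume xy: "x \<in> V" "y \<in> V" "cl x = cl y" "E x y"
    then have "x \<in> part (cl x)" "y \<in> part (cl x)"
      by (auto simp: part_def)
    then show "d (cl x) x \<noteq> d (cl y) y"
      using d[OF cl_less[OF xy(1)]] xy(3,4) properD by metis
  qed simp
  then show ?thesis
    by blast
qed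

text \<open>Each member of \<open>Ts\<close> stands for the stable set that consists of the top colour class of each
  of its parts.\<close>

lemma peel:
  assumes "layered c W u" "\<forall>T\<in>set Ts. stable_list g T"
  shows "\<exists>W'. layered c W' (\<lambda>i. u i - length (filter (\<lambda>T. i \<in> set T) Ts)) \<and> W' \<subseteq> W \<and>
    (\<forall>k. colourable W' k \<longrightarrow> colourable W (k + length Ts))"
  using assms
proof (induction Ts arbitrary: W u)
  case Nil
  then show ?case
    by auto
next
  case (Cons T Ts)
  define S where "S = {x \<in> W. cl x \<in> set T \<and> c x = u (cl x) - 1}"
  have W: "W \<subseteq> V" "\<And>x. x \<in> W \<Longrightarrow> c x < u (cl x)"
    "\<And>x y. x \<in> W \<Longrightarrow> y \<in> W \<Longrightarrow> cl x = cl y \<Longrightarrow> E x y \<Longrightarrow> c x \<noteq> c y"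
    using Cons.prems(1) unfolding layered_def by blast+
  have "\<not> E x y" if xy: "x \<in> S" "y \<in> S" for x y
  proof (cases "cl x = cl y")
    case True
    then show ?thesis
      using xy W(3)[of x y] by (auto simp: S_def)
  next
    case False
    then show ?thesis
      using xy W(1) cross[of x y] Cons.prems(2) by (auto simp: S_def stable_list_def list_all_iff)
  qed
  then have "stable S"
    by (simp add: stable_def)
  let ?u = "\<lambda>i. u i - (if i \<in> set T then 1 else 0)"
  have "c x < ?u (cl x)" if "x \<in> W - S" for x
    using that W(2)[of x] by (auto simp: S_def)
  then have "layered c (W - S) ?u"
    using W unfolding layered_def by blast
  then obtain W' where W': "layered c W' (\<lambda>i. ?u i - length (filter (\<lambda>T. i \<in> set T) Ts))" "W' \<subseteq> W - S"
      "\<forall>k. colourable W' k \<longrightarrow> colourable (W - S) (k + length Ts)"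
    using Cons.IH[of "W - S" ?u] Cons.prems(2) by auto
  have "(\<lambda>i. ?u i - length (filter (\<lambda>T. i \<in> set T) Ts)) = (\<lambda>i. u i - length (filter (\<lambda>T.
    i \<in> set T) (T # Ts)))"
    by auto
  then show ?case
    using W' colourable_stable[OF _ \<open>stable S\<close>] by (intro exI[of _ W']) auto
qed

lemma layered_clique:
  assumes "layered c W u" "K \<subseteq> W" "clique K"
  shows "card K \<le> sum u (cl ` K)"
proof -
  have W: "W \<subseteq> V" "\<And>x. x \<in> W \<Longrightarrow> c x < u (cl x)"
    "\<And>x y. x \<in> W \<Longrightarrow> y \<in> W \<Longrightarrow> cl x = cl y \<Longrightarrow> E x y \<Longrightarrow> c x \<noteq> c y"
    using assms(1) unfolding layered_def by blast+
  have finK: "finite K"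
    using assms(2) W(1) fin by (meson finite_subset subset_trans)
  have "inj_on (\<lambda>x. (cl x, c x)) K"
    using W(3) assms(2,3) unfolding inj_on_def clique_def by (metis Pair_inject subsetD)
  moreover have "(\<lambda>x. (cl x, c x)) ` K \<subseteq> (SIGMA i:cl ` K. {..<u i})"
    using W(2) assms(2) by auto
  ultimately have "card K \<le> card (SIGMA i:cl ` K. {..<u i})"
    using finK by (metis card_image card_mono finite_SigmaI finite_imageI finite_lessThan)
  then show ?thesis
    using finK by simp
qed

text \<open>If the stable sets reduce the weight of every clique in \<open>Ds\<close> to at most
  \<open>om V - t\<close>, minimality colours what remains with \<open>bd (om V - t)\<close>
  colours, and one new colour for each stable set stays within the bound.\<close>

lemma peeling_impossible:
  assumes cov: "covers g Ds" and Ts: "\<forall>T\<in>set Ts. stable_list g T"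
    and t: "1 \<le> t" "bd (om V - t) + length Ts \<le> bd (om V)" "t \<le> om V"
    and small: "\<forall>D\<in>set Ds. (\<Sum>i\<in>set D. w i - length (filter (\<lambda>T. i \<in> set T) Ts)) + t \<le> om V"
  shows False
proof -
  let ?u = "\<lambda>i. w i - length (filter (\<lambda>T. i \<in> set T) Ts)"
  obtain c where c: "layered c V w"
    using ex_layered by blast
  obtain W where W: "layered c W ?u" "W \<subseteq> V" "\<And>k. colourable W k \<Longrightarrow> colourable V (k + length Ts)"
    using peel[OF c Ts] by blast
  have "card K \<le> om V - t" if K: "K \<subseteq> W" "clique K" for K
  proof -
    have adjK: "\<forall>i\<in>cl ` K. \<forall>j\<in>cl ` K. i \<noteq> j \<longrightarrow> adj g i j"
      using K W(2) cross unfolding clique_def by (smt (verit) imageE subsetD)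
    have sub: "cl ` K \<subseteq> {..<length g}"
      using K(1) W(2) cl_less by auto
    obtain D where D: "D \<in> set Ds" "cl ` K \<subseteq> set D"
    proof -
      have "filter (\<lambda>i. i \<in> cl ` K) [0..<length g] \<in> set (cliqs g (length g))"
        using cliqs_complete[OF adjK] .
      then obtain D where "D \<in> set Ds" "set (filter (\<lambda>i. i \<in> cl ` K) [0..<length g]) \<subseteq> set D"
        using cov unfolding covers_def list_all_iff list_ex_iff by fastforce
      moreover have "set (filter (\<lambda>i. i \<in> cl ` K) [0..<length g]) = cl ` K"
        using sub by auto
      ultimately show ?thesis
        using that by simp
    qed
    have "card K \<le> sum ?u (cl ` K)"
      using layered_clique[OF W(1) K] .
    also have "\<dots> \<le> sum ?u (set D)"
      using D(2) by (intro sum_mono2) auto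
    also have "\<dots> \<le> om V - t"
      using small D(1) by fastforce
    finally show ?thesis .
  qed
  then have omW: "om W \<le> om V - t"
    using om_le[of W "om V - t"] finite_subset[OF W(2) fin] by blast
  then have "W \<noteq> V"
    using t by auto
  then have "colourable W (bd (om W))"
    using minimal W(2) by blast
  then have "colourable V (bd (om W) + length Ts)"
    using W(3) by blast
  then show False
    using excess colourable_mono[of V _ "bd (om V)" V] bd_mono[OF omW]
      t(2) by (meson add_le_mono1 order_trans subset_refl)
qed

lemma clique_weights:
  assumes "covers g Ds"
  shows "\<forall>D\<in>set Ds. sum w (set D) \<le> om V"
proof
  fix D assume "D \<in> set Ds"
  then have "D \<in> set (cliqs g (length g))"
    using assms unfolding covers_def list_all_iff by simp
  from cliqs_sound[OF this] show "sum w (set D) \<le> om V"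
    by (intro clique_weight) auto
qed

lemma om_V_pos:
  assumes "g \<noteq> []"
  shows "1 \<le> om V"
proof -
  have "0 < length g"
    using assms by simp
  then obtain x where "x \<in> V"
    using occupied[of 0] by blast
  then show ?thesis
    by (rule om_pos[OF fin])
qed

text \<open>One stable set, with \<open>t = 1\<close>: a clique that meets \<open>T\<close> becomes
  lighter because all parts are occupied, so only a clique disjoint from \<open>T\<close> can keep
  the full weight.\<close>

lemma tight_clique:
  assumes cov: "covers g Ds" and T: "stable_list g T" "T \<noteq> []" "set T \<subseteq> {..<length g}"
  shows "\<exists>D\<in>set Ds. set D \<inter> set T = {} \<and> sum w (set D) = om V"
proof (rule ccontr)
  assume no: "\<not> ?thesis"
  have pos: "1 \<le> om V"
    using om_V_pos T(2,3) by fastforce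
  have "(\<Sum>i\<in>set D. w i - length (filter (\<lambda>T. i \<in> set T) [T])) + 1 \<le> om V" if D: "D \<in> set Ds" for D
  proof (cases "set D \<inter> set T = {}")
    case True
    then have "(\<Sum>i\<in>set D. w i - length (filter (\<lambda>T. i \<in> set T) [T])) = sum w (set D)"
      by (intro sum.cong) auto
    moreover have "sum w (set D) \<noteq> om V"
      using no D True by blast
    ultimately show ?thesis
      using clique_weights[OF cov, THEN bspec, OF D] by simp
  next
    case False
    then obtain i where i: "i \<in> set D" "i \<in> set T"
      by blast
    have "(\<Sum>j\<in>set D. w j - length (filter (\<lambda>T. j \<in> set T) [T])) < sum w (set D)"
    proof (rule sum_strict_mono_ex1)
      show "\<exists>j\<in>set D. w j - length (filter (\<lambda>T. j \<in> set T) [T]) < w j"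
        using i w_pos[of i] T(3) by (intro bexI[of _ i]) auto
    qed auto
    then show ?thesis
      using clique_weights[OF cov, THEN bspec, OF D] by simp
  qed
  then have small: "\<forall>D\<in>set Ds. (\<Sum>i\<in>set D. w i - length (filter (\<lambda>T. i \<in> set T) [T])) + 1 \<le> om V"
    by blast
  have "5 * om V + 3 = 5 * (om V - 1) + 3 + 4 + 1"
    using pos by simp
  then have "bd (om V - 1) + length [T] \<le> bd (om V)"
    unfolding bd_def by simp
  moreover have "\<forall>T\<in>set [T]. stable_list g T"
    using T(1) by simp
  ultimately show False
    using peeling_impossible[OF cov _ order_refl _ pos small] by blast
qed

text \<open>The case \<open>t = 4\<close>. The subtraction is truncated, as a part cannot lose more
  layers than it has; parts of small weight therefore have to be considered in the
  applications.\<close>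

lemma five_stable_sets:
  assumes "covers g Ds" "\<forall>T\<in>set Ts. stable_list g T" "length Ts = 5" "4 \<le> om V"
  shows "\<exists>D\<in>set Ds. om V < (\<Sum>i\<in>set D. w i - length (filter (\<lambda>T. i \<in> set T) Ts)) + 4"
proof (rule ccontr)
  assume "\<not> ?thesis"
  then have small: "\<forall>D\<in>set Ds. (\<Sum>i\<in>set D. w i - length (filter (\<lambda>T. i \<in> set T) Ts)) + 4 \<le> om V"
    by (meson not_less)
  have "5 * om V + 3 = 5 * (om V - 4) + 3 + 5 * 4"
    using assms(4) by simp
  then have "bd (om V - 4) + length Ts \<le> bd (om V)"
    unfolding bd_def assms(3) by simp
  then show False
    using peeling_impossible[OF assms(1,2) _ _ assms(4) small] by simp
qed

end

section \<open>The elimination of the patterns\<close>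

lemma covers_F:
  "covers F2 [[1, 2], [2, 3], [0, 4], [3, 4], [0, 1, 5], [3, 5], [0, 6], [2, 6]]"
  "covers F3 [[1, 2], [0, 4], [3, 4], [0, 1, 5], [3, 5], [0, 6], [2, 3, 6]]"
  "covers F4 [[1, 2], [0, 4], [3, 4], [0, 1, 5], [3, 5], [0, 6], [2, 3, 6], [1, 7], [4, 7], [6, 7]]"
  "covers F5 [[1, 2], [0, 4], [3, 4], [0, 1, 5], [3, 5], [0, 6], [2, 3, 6], [5, 7], [6, 7]]"
  "covers F6 [[1, 2], [0, 4], [3, 4], [0, 1, 5], [3, 5], [0, 6], [2, 3, 6], [0, 7], [2, 7]]"
  "covers F7 [[1, 2], [0, 4], [3, 4], [0, 1, 5], [3, 5], [0, 6], [2, 3, 6], [1, 7], [6, 7], [2, 8],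
    [5, 8], [4, 7, 8]]"
  "covers F8 [[1, 2], [0, 4], [3, 4], [0, 1, 5], [3, 5], [0, 6], [2, 3, 6], [0, 7], [2, 7], [1, 8],
    [3, 8], [7, 8]]"
  by code_simp+

lemma stable_F:
  "list_all (stable_list F2) [[2, 4, 5], [1, 3, 6], [4, 5, 6], [0, 2], [0, 3], [1, 4, 6]]"
  "list_all (stable_list F3) [[1, 4, 6], [4, 5, 6]]"
  "list_all (stable_list F4) [[1, 4, 6], [0, 3, 7]]"
  "list_all (stable_list F5) [[0, 3, 7], [2, 4, 5], [1, 4, 6], [0, 2, 7], [1, 4, 7]]"
  "list_all (stable_list F6) [[1, 4, 6, 7], [4, 5, 6, 7]]"
  "list_all (stable_list F7) [[1, 4, 6], [0, 2, 7], [2, 5, 7], [1, 3, 8], [1, 6, 8]]"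
  "list_all (stable_list F8) [[0, 3], [1, 3, 7], [1, 4, 6, 7], [0, 2, 8], [2, 4, 5, 8], [4, 5, 6, 7]]"
  by code_simp+

lemma length_F: "length F0 = 5" "length F1 = 6" "length F2 = 7" "length F3 = 7" "length F4 = 8"
  "length F5 = 8"
  "length F6 = 8" "length F7 = 9" "length F8 = 9"
  by (simp_all add: F0_def F1_def F2_def F3_def F4_def F5_def F6_def F7_def F8_def)

lemma adj_F0: "\<forall>i\<in>set [0..<5]. \<forall>j\<in>set [0..<5]. adj F0 i j =
    List.member [(0, 1), (1, 0), (1, 2), (2, 1), (2, 3), (3, 2), (3, 4), (4, 3), (4, 0), (0, 4)] (i, j)"
  by code_simp

text \<open>A permutation of the colours that moves the first \<open>p\<close> of them to prescribed
  ones; it makes two colourings agree on a palette.\<close>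

lemma ex_inj_extension:
  assumes "p \<le> k" "X \<subseteq> {..<k}" "card X = p"
  obtains h :: "nat \<Rightarrow> nat" where "inj_on h {..<k}" "h ` {..<k} \<subseteq> {..<k}" "h ` {..<p} \<subseteq> X"
proof -
  have finX: "finite X"
    using assms(2) finite_subset by blast
  obtain h1 where h1: "bij_betw h1 {..<p} X"
    using finite_same_card_bij[of "{..<p}" X] assms(3) finX by auto
  have "card ({..<k} - {..<p}) = card ({..<k} - X)"
    using assms finX by (simp add: card_Diff_subset)
  then obtain h2 where h2: "bij_betw h2 ({..<k} - {..<p}) ({..<k} - X)"
    using finite_same_card_bij[of "{..<k} - {..<p}" "{..<k} - X"] by auto
  define h where "h x = (if x \<in> {..<p} then h1 x else h2 x)" for x
  have "bij_betw h {..<p} X"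
    using h1 by (rule bij_betw_cong[THEN iffD1, rotated]) (simp add: h_def)
  moreover have "bij_betw h ({..<k} - {..<p}) ({..<k} - X)"
    using h2 by (rule bij_betw_cong[THEN iffD1, rotated]) (simp add: h_def)
  moreover have "X \<inter> ({..<k} - X) = {}"
    by auto
  ultimately have "bij_betw h ({..<p} \<union> ({..<k} - {..<p})) (X \<union> ({..<k} - X))"
    by (rule bij_betw_combine)
  moreover have "{..<p} \<union> ({..<k} - {..<p}) = {..<k}" "X \<union> ({..<k} - X) = {..<k}"
    using assms(1,2) by auto
  moreover have "h ` {..<p} \<subseteq> X"
    using \<open>bij_betw h {..<p} X\<close> by (simp add: bij_betw_def)
  ultimately show ?thesis
    using that[of h] by (simp add: bij_betw_def)
qed

context minimal_excess
begin

lemma blow_up_exists: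
  assumes f: "embeds V g f" and cl: "closed False g [[]] bs" and rigid: "rigid g [[]]" and g: "g \<noteq> []"
    and none: "\<And>T e g' f'. (T, e, g') \<in> set bs \<Longrightarrow> \<not> embeds V g' f'"
  obtains cl where "blow_up E V g cl"
proof -
  have types: "(\<exists>i<length g. like g f i x) \<or> trace f (length g) x = []" if "embeds V g f" "x \<in> V" for f x
    using closed_cases[OF cl pg _ that] none by (metis empty_iff insert_iff list.set(1) list.set(2))
  have all: "\<exists>i<length g. like g f i x" if "x \<in> V" for x
    using all_like[OF rigid f g types connected that] .
  then obtain cl where cl: "cl x < length g" "like g f (cl x) x" if "x \<in> V" for x
    by metis
  have "blow_up E V g cl"
  proof unfold_locales
    fix x y assume xy: "x \<in> V" "y \<in> V" "cl x \<noteq> cl y"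
    show "E x y \<longleftrightarrow> adj g (cl x) (cl y)"
      by (rule like_adj[OF pg rigid f _ xy(1) cl(2)[OF xy(1)] xy(2) cl(2)[OF xy(2)] cl(1)[OF xy(1)]
        cl(1)[OF xy(2)] xy(3)])
        (use types in auto)
  next
    fix i assume i: "i < length g"
    then show "\<exists>x\<in>V. cl x = i"
      using like_unique[OF rigid _ i cl(2) like_self[OF f i]] cl(1) embedsD(1)[OF f i] by blast
    \<comment> \<open>The second clause of \<open>rigid\<close>, taken for the empty trace and with
      both indices equal to \<open>i\<close>, says that \<open>i\<close> has a neighbour.\<close>
    show "\<exists>j<length g. j \<noteq> i \<and> adj g i j"
      using rigidD(2)[OF rigid i i, of "[]"] by auto
  qed (rule cl(1))
  then show ?thesis
    using that by blast
qed

text \<open>The five sets use the parts 5 and 6 once and every other part twice. So a clique loses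
  at least 4, unless it is \<open>{3, 5}\<close> or \<open>{0, 6}\<close>; \<open>t1\<close>,
  \<open>t3\<close> and \<open>t4\<close> keep these two below \<omega>. The remaining inequalities
  are for parts of weight 1.\<close>

lemma no_F8: "\<not> embeds V F8 f"
proof
  assume "embeds V F8 f"
  then obtain cl where "blow_up E V F8 cl"
    by (rule blow_up_exists[OF _ closed_F8]) (use rigid_all(1) length_F in auto)
  then interpret blow_up E V F8 cl .
  have pos: "1 \<le> w 0" "1 \<le> w 1" "1 \<le> w 2" "1 \<le> w 3" "1 \<le> w 4" "1 \<le> w 5" "1 \<le> w 6" "1 \<le> w 7" "1 \<le> w 8"
    using w_pos by (simp_all add: length_F)
  have bounds: "w 1 + w 2 \<le> om V" "w 0 + w 4 \<le> om V" "w 3 + w 4 \<le> om V" "w 0 + w 1 + w 5 \<le> om V"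
    "w 3 + w 5 \<le> om V" "w 0 + w 6 \<le> om V" "w 2 + w 3 + w 6 \<le> om V" "w 0 + w 7 \<le> om V" "w 2 + w 7 \<le> om V"
      "w 1 + w 8 \<le> om V" "w 3 + w 8 \<le> om V" "w 7 + w 8 \<le> om V"
    using clique_weights[OF covers_F(7)] by simp_all
  note tight = tight_clique[OF covers_F(7)]
  have t1: "w 0 + w 4 = om V \<or> w 0 + w 6 = om V"
    using tight[of "[1, 3, 7]"] stable_F(7) by (auto simp: length_F)
  have t2: "w 1 + w 2 = om V \<or> w 1 + w 8 = om V \<or> w 3 + w 8 = om V"
    using tight[of "[4, 5, 6, 7]"] stable_F(7) by (auto simp: length_F)
  have t3: "w 3 + w 4 = om V \<or> w 3 + w 5 = om V"
    using tight[of "[0, 2, 8]"] stable_F(7) by (auto simp: length_F)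
  have t4: "w 0 + w 6 = om V \<or> w 0 + w 7 = om V"
    using tight[of "[2, 4, 5, 8]"] stable_F(7) by (auto simp: length_F)
  have "4 \<le> om V"
    using pos bounds t1 t2 t3 t4 by linarith
  then have "om V < (w 1 - 2) + (w 2 - 2) + 4 \<or>
      om V < (w 0 - 2) + (w 4 - 2) + 4 \<or>
      om V < (w 3 - 2) + (w 4 - 2) + 4 \<or>
      om V < (w 0 - 2) + (w 1 - 2) + (w 5 - 1) + 4 \<or>
      om V < (w 3 - 2) + (w 5 - 1) + 4 \<or>
      om V < (w 0 - 2) + (w 6 - 1) + 4 \<or>
      om V < (w 2 - 2) + (w 3 - 2) + (w 6 - 1) + 4 \<or>
      om V < (w 0 - 2) + (w 7 - 2) + 4 \<or>
      om V < (w 2 - 2) + (w 7 - 2) + 4 \<or>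
      om V < (w 1 - 2) + (w 8 - 2) + 4 \<or>
      om V < (w 3 - 2) + (w 8 - 2) + 4 \<or>
      om V < (w 7 - 2) + (w 8 - 2) + 4"
    using five_stable_sets[OF covers_F(7), of "[[0, 3], [1, 3, 7], [1, 4, 6, 7], [0, 2, 8],
      [2, 4, 5, 8]]"] stable_F(7) by (simp add: add.assoc numeral_2_eq_2 numeral_3_eq_3)
  then show False
    using pos bounds t1 t2 t3 t4 by (elim disjE) linarith+
qed

text \<open>Three triangles, any two of them joined by a perfect matching. Single stable sets
  suffice: the alternatives \<open>t1\<close> to \<open>t5\<close> are incompatible with the clique
  inequalities.\<close>

lemma no_F7: "\<not> embeds V F7 f"
proof
  assume "embeds V F7 f"
  then obtain cl where "blow_up E V F7 cl"
    by (rule blow_up_exists[OF _ closed_F7]) (use rigid_all(1) length_F in auto)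
  then interpret blow_up E V F7 cl .
  have pos: "1 \<le> w 0" "1 \<le> w 1" "1 \<le> w 2" "1 \<le> w 3" "1 \<le> w 4" "1 \<le> w 5" "1 \<le> w 6" "1 \<le> w 7" "1 \<le> w 8"
    using w_pos by (simp_all add: length_F)
  have bounds: "w 1 + w 2 \<le> om V" "w 0 + w 4 \<le> om V" "w 3 + w 4 \<le> om V" "w 0 + w 1 + w 5 \<le> om V"
    "w 3 + w 5 \<le> om V" "w 0 + w 6 \<le> om V" "w 2 + w 3 + w 6 \<le> om V" "w 1 + w 7 \<le> om V" "w 6 + w 7 \<le> om V"
      "w 2 + w 8 \<le> om V" "w 5 + w 8 \<le> om V" "w 4 + w 7 + w 8 \<le> om V"
    using clique_weights[OF covers_F(6)] by simp_all
  note tight = tight_clique[OF covers_F(6)]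
  have t1: "w 3 + w 5 = om V \<or> w 2 + w 8 = om V \<or> w 5 + w 8 = om V"
    using tight[of "[1, 4, 6]"] stable_F(6) by (auto simp: length_F)
  have t2: "w 3 + w 4 = om V \<or> w 3 + w 5 = om V \<or> w 5 + w 8 = om V"
    using tight[of "[0, 2, 7]"] stable_F(6) by (auto simp: length_F)
  have t3: "w 0 + w 4 = om V \<or> w 3 + w 4 = om V \<or> w 0 + w 6 = om V"
    using tight[of "[2, 5, 7]"] stable_F(6) by (auto simp: length_F)
  have t4: "w 0 + w 4 = om V \<or> w 0 + w 6 = om V \<or> w 6 + w 7 = om V"
    using tight[of "[1, 3, 8]"] stable_F(6) by (auto simp: length_F)
  have t5: "w 0 + w 4 = om V \<or> w 3 + w 4 = om V \<or> w 3 + w 5 = om V"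
    using tight[of "[1, 6, 8]"] stable_F(6) by (auto simp: length_F)
  show False
    using pos bounds t1 t2 t3 t4 t5 by (elim disjE) linarith+
qed

text \<open>By \<open>t1\<close> and the triangles \<open>{0, 1, 5}\<close> and
  \<open>{2, 3, 6}\<close>, the parts 0, 3, 5, 6 together weigh at most \<omega>. So
  \<open>{3, 5}\<close> and \<open>{0, 6}\<close> stay at least 2 below \<omega>; they are the only
  cliques that lose fewer than 4.\<close>

lemma no_F5: "\<not> embeds V F5 f"
proof
  assume "embeds V F5 f"
  then obtain cl where "blow_up E V F5 cl"
    by (rule blow_up_exists[OF _ closed_F5]) (use rigid_all(1) length_F in auto)
  then interpret blow_up E V F5 cl .
  have pos: "1 \<le> w 0" "1 \<le> w 1" "1 \<le> w 2" "1 \<le> w 3" "1 \<le> w 4" "1 \<le> w 5" "1 \<le> w 6" "1 \<le> w 7"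
    using w_pos by (simp_all add: length_F)
  have bounds: "w 1 + w 2 \<le> om V" "w 0 + w 4 \<le> om V" "w 3 + w 4 \<le> om V" "w 0 + w 1 + w 5 \<le> om V"
    "w 3 + w 5 \<le> om V" "w 0 + w 6 \<le> om V" "w 2 + w 3 + w 6 \<le> om V" "w 5 + w 7 \<le> om V" "w 6 + w 7 \<le> om V"
    using clique_weights[OF covers_F(4)] by simp_all
  note tight = tight_clique[OF covers_F(4)]
  have t1: "w 1 + w 2 = om V"
    using tight[of "[0, 3, 7]"] stable_F(4) by (auto simp: length_F)
  have "4 \<le> om V"
    using pos bounds t1 by linarith
  then have "om V < (w 1 - 2) + (w 2 - 2) + 4 \<or>
      om V < (w 0 - 2) + (w 4 - 3) + 4 \<or>
      om V < (w 3 - 1) + (w 4 - 3) + 4 \<or>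
      om V < (w 0 - 2) + (w 1 - 2) + (w 5 - 1) + 4 \<or>
      om V < (w 3 - 1) + (w 5 - 1) + 4 \<or>
      om V < (w 0 - 2) + (w 6 - 1) + 4 \<or>
      om V < (w 2 - 2) + (w 3 - 1) + (w 6 - 1) + 4 \<or>
      om V < (w 5 - 1) + (w 7 - 3) + 4 \<or>
      om V < (w 6 - 1) + (w 7 - 3) + 4"
    using five_stable_sets[OF covers_F(4), of "[[2, 4, 5], [1, 4, 6], [0, 2, 7], [0, 3, 7], [1, 4, 7]]"]
      stable_F(4) by (simp add: add.assoc numeral_2_eq_2 numeral_3_eq_3)
  then show False
    using pos bounds t1 by (elim disjE) linarith+
qed

text \<open>The tight cliques \<open>{3, 5}\<close> and \<open>{1, 2}\<close> weigh 2\<omega>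
  together, as much as the triangles \<open>{0, 1, 5}\<close> and \<open>{2, 3, 6}\<close> may
  weigh, so nothing is left for the parts 0 and 6. The same count settles \<open>F4\<close> and
  \<open>F3\<close>.\<close>

lemma no_F6: "\<not> embeds V F6 f"
proof
  assume "embeds V F6 f"
  then obtain cl where "blow_up E V F6 cl"
    by (rule blow_up_exists[OF _ closed_F6]) (use rigid_all(1) length_F no_F8 in auto)
  then interpret blow_up E V F6 cl .
  have pos: "1 \<le> w 0" "1 \<le> w 1" "1 \<le> w 2" "1 \<le> w 3" "1 \<le> w 4" "1 \<le> w 5" "1 \<le> w 6" "1 \<le> w 7"
    using w_pos by (simp_all add: length_F)
  have bounds: "w 1 + w 2 \<le> om V" "w 0 + w 4 \<le> om V" "w 3 + w 4 \<le> om V" "w 0 + w 1 + w 5 \<le> om V"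
    "w 3 + w 5 \<le> om V" "w 0 + w 6 \<le> om V" "w 2 + w 3 + w 6 \<le> om V" "w 0 + w 7 \<le> om V" "w 2 + w 7 \<le> om V"
    using clique_weights[OF covers_F(5)] by simp_all
  note tight = tight_clique[OF covers_F(5)]
  have t1: "w 3 + w 5 = om V"
    using tight[of "[1, 4, 6, 7]"] stable_F(5) by (auto simp: length_F)
  have t2: "w 1 + w 2 = om V"
    using tight[of "[4, 5, 6, 7]"] stable_F(5) by (auto simp: length_F)
  show False
    using pos bounds t1 t2 by linarith
qed

lemma no_F4: "\<not> embeds V F4 f"
proof
  assume "embeds V F4 f"
  then obtain cl where "blow_up E V F4 cl"
    by (rule blow_up_exists[OF _ closed_F4]) (use rigid_all(1) length_F no_F7 no_F8 in auto)
  then interpret blow_up E V F4 cl .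
  have pos: "1 \<le> w 0" "1 \<le> w 1" "1 \<le> w 2" "1 \<le> w 3" "1 \<le> w 4" "1 \<le> w 5" "1 \<le> w 6" "1 \<le> w 7"
    using w_pos by (simp_all add: length_F)
  have bounds: "w 1 + w 2 \<le> om V" "w 0 + w 4 \<le> om V" "w 3 + w 4 \<le> om V" "w 0 + w 1 + w 5 \<le> om V"
    "w 3 + w 5 \<le> om V" "w 0 + w 6 \<le> om V" "w 2 + w 3 + w 6 \<le> om V" "w 1 + w 7 \<le> om V" "w 4 + w 7 \<le> om V"
      "w 6 + w 7 \<le> om V"
    using clique_weights[OF covers_F(3)] by simp_all
  note tight = tight_clique[OF covers_F(3)]
  have t1: "w 3 + w 5 = om V"
    using tight[of "[1, 4, 6]"] stable_F(3) by (auto simp: length_F)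
  have t2: "w 1 + w 2 = om V"
    using tight[of "[0, 3, 7]"] stable_F(3) by (auto simp: length_F)
  show False
    using pos bounds t1 t2 by linarith
qed

lemma no_F3: "\<not> embeds V F3 f"
proof
  assume "embeds V F3 f"
  then obtain cl where "blow_up E V F3 cl"
    by (rule blow_up_exists[OF _ closed_F3]) (use rigid_all(1) length_F no_F4 no_F5 no_F6 in auto)
  then interpret blow_up E V F3 cl .
  have pos: "1 \<le> w 0" "1 \<le> w 1" "1 \<le> w 2" "1 \<le> w 3" "1 \<le> w 4" "1 \<le> w 5" "1 \<le> w 6"
    using w_pos by (simp_all add: length_F)
  have bounds: "w 1 + w 2 \<le> om V" "w 0 + w 4 \<le> om V" "w 3 + w 4 \<le> om V" "w 0 + w 1 + w 5 \<le> om V"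
    "w 3 + w 5 \<le> om V" "w 0 + w 6 \<le> om V" "w 2 + w 3 + w 6 \<le> om V"
    using clique_weights[OF covers_F(2)] by simp_all
  note tight = tight_clique[OF covers_F(2)]
  have t1: "w 3 + w 5 = om V"
    using tight[of "[1, 4, 6]"] stable_F(2) by (auto simp: length_F)
  have t2: "w 1 + w 2 = om V"
    using tight[of "[4, 5, 6]"] stable_F(2) by (auto simp: length_F)
  show False
    using pos bounds t1 t2 by linarith
qed

text \<open>Of all cliques only \<open>{3, 5}\<close> loses fewer than 4. It is not tight:
  \<open>t2\<close> gives \<open>w 3 \<le> w 0\<close>, and the triangle \<open>{0, 1, 5}\<close>
  leaves room for the part 1.\<close>

lemma no_F2: "\<not> embeds V F2 f"
proof
  assume "embeds V F2 f"
  then obtain cl where "blow_up E V F2 cl"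
    by (rule blow_up_exists[OF _ closed_F2]) (use rigid_all(1) length_F no_F4 no_F6 in auto)
  then interpret blow_up E V F2 cl .
  have pos: "1 \<le> w 0" "1 \<le> w 1" "1 \<le> w 2" "1 \<le> w 3" "1 \<le> w 4" "1 \<le> w 5" "1 \<le> w 6"
    using w_pos by (simp_all add: length_F)
  have bounds: "w 1 + w 2 \<le> om V" "w 2 + w 3 \<le> om V" "w 0 + w 4 \<le> om V" "w 3 + w 4 \<le> om V"
    "w 0 + w 1 + w 5 \<le> om V" "w 3 + w 5 \<le> om V" "w 0 + w 6 \<le> om V" "w 2 + w 6 \<le> om V"
    using clique_weights[OF covers_F(1)] by simp_all
  note tight = tight_clique[OF covers_F(1)]
  have t1: "w 0 + w 6 = om V"
    using tight[of "[2, 4, 5]"] stable_F(1) by (auto simp: length_F)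
  have t2: "w 0 + w 4 = om V"
    using tight[of "[1, 3, 6]"] stable_F(1) by (auto simp: length_F)
  have t3: "w 1 + w 2 = om V \<or> w 2 + w 3 = om V"
    using tight[of "[4, 5, 6]"] stable_F(1) by (auto simp: length_F)
  have "4 \<le> om V"
    using pos bounds t1 t2 t3 by linarith
  then have "om V < (w 1 - 2) + (w 2 - 2) + 4 \<or>
      om V < (w 2 - 2) + (w 3 - 2) + 4 \<or>
      om V < (w 0 - 2) + (w 4 - 2) + 4 \<or>
      om V < (w 3 - 2) + (w 4 - 2) + 4 \<or>
      om V < (w 0 - 2) + (w 1 - 2) + (w 5 - 1) + 4 \<or>
      om V < (w 3 - 2) + (w 5 - 1) + 4 \<or>
      om V < (w 0 - 2) + (w 6 - 2) + 4 \<or>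
      om V < (w 2 - 2) + (w 6 - 2) + 4"
    using five_stable_sets[OF covers_F(1), of "[[0, 2], [0, 3], [2, 4, 5], [1, 3, 6], [1, 4, 6]]"]
      stable_F(1) by (simp add: add.assoc numeral_2_eq_2 numeral_3_eq_3)
  then show False
    using pos bounds t1 t2 t3 by (elim disjE) linarith+
qed

section \<open>A five-cycle of classes attached through three of them\<close>

lemma colour_parts:
  fixes A :: "nat \<Rightarrow> 'a set" and C :: "nat \<Rightarrow> nat set"
  assumes col: "\<And>i. i < n \<Longrightarrow> colourable (A i) (u i)"
    and C: "\<And>i. i < n \<Longrightarrow> finite (C i) \<and> u i \<le> card (C i)"
    and disj: "\<And>i j x. i < n \<Longrightarrow> j < n \<Longrightarrow> x \<in> A i \<Longrightarrow> x \<in> A j \<Longrightarrow> i = j"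
    and cross: "\<And>i j x y. i < n \<Longrightarrow> j < n \<Longrightarrow> i \<noteq> j \<Longrightarrow> x \<in> A i \<Longrightarrow> y \<in> A j \<Longrightarrow> E x y \<Longrightarrow> C i \<inter> C j = {}"
  shows "\<exists>d. (\<forall>i<n. \<forall>x\<in>A i. d x \<in> C i) \<and> proper (\<Union>i<n. A i) d"
proof -
  have "\<exists>d. i < n \<longrightarrow> d ` A i \<subseteq> C i \<and> proper (A i) d" for i
  proof (cases "i < n")
    case True
    obtain d where "d ` A i \<subseteq> C i" "proper (A i) d"
      using colourable_with[OF col[OF True], of "C i"] C[OF True] by blast
    then show ?thesis
      by blast
  qed simp
  then obtain d where d: "i < n \<Longrightarrow> d i ` A i \<subseteq> C i \<and> proper (A i) (d i)" for i
    by metis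
  define cl where "cl x = (THE i. i < n \<and> x \<in> A i)" for x
  have cl: "cl x = i" if "i < n" "x \<in> A i" for x i
    unfolding cl_def using that disj by blast
  define e where "e x = d (cl x) x" for x
  have e: "e x \<in> C i" if "i < n" "x \<in> A i" for x i
    using d[OF that(1)] that cl[OF that] unfolding e_def by auto
  have "proper (\<Union>i<n. A i) e"
  proof (rule properI)
    fix x y assume xy: "x \<in> (\<Union>i<n. A i)" "y \<in> (\<Union>i<n. A i)" "E x y"
    then obtain i j where ij: "i < n" "x \<in> A i" "j < n" "y \<in> A j"
      by blast
    show "e x \<noteq> e y"
    proof (cases "i = j")
      case True
      then show ?thesis
        using properD[of "A i" "d i" x y] d[OF ij(1)] ij xy(3) cl[OF ij(1,2)] cl[OF ij(3,4)]
          unfolding e_def by simp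
    next
      case False
      then show ?thesis
        using cross[OF ij(1,3) False ij(2,4) xy(3)] e[OF ij(1,2)] e[OF ij(3,4)] by auto
    qed
  qed
  then show ?thesis
    using e by blast
qed

text \<open>The sets \<open>A i\<close> are coloured so that \<open>A 0 \<union> A 1 \<union> A 3\<close>, the only sets with neighbours outside,
  receive no more colours than a clique \<open>P\<close> in them has vertices. The rest is coloured together with
  \<open>P\<close>, and the two colourings are made to agree on the colours of \<open>P\<close>.\<close>

lemma no_pendant_C5:
  fixes A :: "nat \<Rightarrow> 'a set"
  assumes A: "\<And>i. i < 5 \<Longrightarrow> A i \<subseteq> V" "\<And>i. i < 5 \<Longrightarrow> A i \<noteq> {}"
    and disj: "\<And>i j x. i < 5 \<Longrightarrow> j < 5 \<Longrightarrow> x \<in> A i \<Longrightarrow> x \<in> A j \<Longrightarrow> i = j"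
    and cross: "\<And>i j x y. i < 5 \<Longrightarrow> j < 5 \<Longrightarrow> i \<noteq> j \<Longrightarrow> x \<in> A i \<Longrightarrow> y \<in> A j \<Longrightarrow> E x y \<longleftrightarrow> adj F0 i j"
    and out: "\<And>y. y \<in> V \<Longrightarrow> (\<And>i. i < 5 \<Longrightarrow> y \<notin> A i) \<Longrightarrow>
      ((\<forall>x\<in>A 0 \<union> A 1 \<union> A 3. E y x) \<and> (\<forall>x\<in>A 2 \<union> A 4. \<not> E y x)) \<or> (\<forall>x\<in>A 0 \<union> A 1 \<union> A 2 \<union> A 3 \<union> A 4. \<not> E y x)"
  shows False
proof -
  define k where "k = bd (om V)"
  define u where "u i = om (A i)" for i
  have C5: "adj F0 i j \<longleftrightarrow> (i, j) \<in> {(0, 1), (1, 0), (1, 2), (2, 1), (2, 3), (3, 2), (3, 4), (4, 3),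
    (4, 0), (0, 4)}"
    if "i < 5" "j < 5" for i j
  proof -
    have "i \<in> set [0..<5]" "j \<in> set [0..<5]"
      using that by auto
    from adj_F0[THEN bspec, OF this(1), THEN bspec, OF this(2)] show ?thesis
      by (simp only: List.member_iff list.set)
  qed
  have complete: "E x y" if "(i, j) \<in> {(0, 1), (1, 2), (2, 3), (3, 4), (4, 0)}" "x \<in> A i" "y \<in> A j"
    for i j x y
    using that cross[of i j x y] C5[of i j] by auto
  have sum: "u i + u j \<le> om V" if ij: "(i, j) \<in> {(0, 1), (1, 2), (2, 3), (3, 4), (4, 0)}" for i j
    unfolding u_def
  proof (rule om_Un_le[OF fin])
    show "A i \<inter> A j = {}"
      using ij disj[of i j] by auto
  qed (use ij A(1)[of i] A(1)[of j] complete[OF ij] in auto)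
  have le: "u 0 + u 1 \<le> om V" "u 1 + u 2 \<le> om V" "u 2 + u 3 \<le> om V" "u 3 + u 4 \<le> om V" "u 4 + u 0 \<le> om V"
    using sum by auto
  have k: "om V \<le> k" "5 * om V \<le> 4 * k"
    using le_bd unfolding k_def by auto
  \<comment> \<open>Beside the \<open>u 0 + u 1\<close> colours of \<open>A 0\<close> and
    \<open>A 1\<close> only \<open>k - (u 0 + u 1)\<close> remain for \<open>A 2\<close>;
    \<open>s\<close> is the number it lacks and has to share with \<open>A 0\<close>.\<close>
  define s where "s = u 0 + u 1 + u 2 - k"
  define p where "p = max (u 0 + u 1) (u 3)"
  \<comment> \<open>The third inequality is where 5/4 enters: the sum of all \<open>le\<close>
    bounds twice the total weight by \<open>5 * om V \<le> 4 * k\<close>, so the total weight is at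
    most \<open>2 * k\<close>.\<close>
  have s: "s \<le> u 0" "s + u 3 \<le> p" "s + u 3 + u 4 \<le> k" "s \<le> u 0 + u 1"
    using le k unfolding s_def p_def by linarith+
  have pk: "p \<le> k"
    using le k unfolding p_def by linarith
  \<comment> \<open>Low colours go to the classes with outside neighbours: the palettes 0, 1 and 3
    stay below \<open>p\<close>. \<open>A 3\<close> starts at \<open>s\<close> to avoid the shared
    colours of \<open>A 2\<close>, which gets its other colours, like \<open>A 4\<close>, from the
    upper end.\<close>
  define C :: "nat \<Rightarrow> nat set" where "C i = (if i = 0 then {..<u 0} else if i = 1 then {u 0..<u 0 + u 1}
    else if i = 2 then {..<s} \<union> {max (s + u 3) (u 0 + u 1)..<k}
    else if i = 3 then {s..<s + u 3} else {max (u 0) (s + u 3)..<k})" for i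
  have Ci: "C 0 = {..<u 0}" "C 1 = {u 0..<u 0 + u 1}" "C (Suc 0) = {u 0..<u 0 + u 1}"
    "C 2 = {..<s} \<union> {max (s + u 3) (u 0 + u 1)..<k}"
    "C 3 = {s..<s + u 3}" "C 4 = {max (u 0) (s + u 3)..<k}"
    by (simp_all add: C_def)
  have card2: "card (C 2) = s + (k - max (s + u 3) (u 0 + u 1))"
    unfolding Ci using s by (subst card_Un_disjoint) auto
  have five: "i = 0 \<or> i = 1 \<or> i = 2 \<or> i = 3 \<or> i = 4" if "i < 5" for i :: nat
    using that by auto
  have cards: "finite (C i) \<and> u i \<le> card (C i)" if "i < 5" for i
  proof -
    have "u 2 \<le> card (C 2)"
      unfolding card2 using le k s unfolding s_def by linarith
    moreover have "u 4 \<le> k - max (u 0) (s + u 3)"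
      using le k s by linarith
    moreover have "finite (C i)"
      using five[OF that] Ci by (elim disjE) simp_all
    ultimately show ?thesis
      using five[OF that] by (elim disjE) (simp_all add: Ci)
  qed
  have Cd: "C i \<inter> C j = {}" if "(i, j) \<in> {(0, 1), (1, 2), (2, 3), (3, 4), (4, 0)}" for i j
    using that s(1) by (auto simp: Ci)
  have Cdisj: "C i \<inter> C j = {}" if "i < 5" "j < 5" "adj F0 i j" for i j
  proof -
    have "(i, j) \<in> {(0, 1), (1, 2), (2, 3), (3, 4), (4, 0)} \<or> (j, i) \<in> {(0, 1), (1, 2), (2, 3), (3, 4),
      (4, 0)}"
      using that C5[OF that(1,2)] by auto
    then show ?thesis
      using Cd[of i j] Cd[of j i] by blast
  qed
  have colA: "colourable (A i) (u i)" if i: "i < 5" for i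
  proof -
    define j where "j = (if i = 4 then 0 else i + 1)"
    have j: "j < 5" "j \<noteq> i" "adj F0 j i"
      using five[OF i] C5[of j i] by (auto simp: j_def)
    obtain v where "v \<in> A j"
      using A(2)[OF j(1)] by blast
    then show ?thesis
      unfolding u_def using cross[OF j(1) i j(2) \<open>v \<in> A j\<close>]
        j(3) A(1) i j(1) by (intro part_colourable[of v]) auto
  qed
  have Ccross: "C i \<inter> C j = {}" if "i < 5" "j < 5" "i \<noteq> j" "x \<in> A i" "y \<in> A j" "E x y" for i j x y
    using Cdisj[of i j] cross[of i j x y] that by blast
  have "\<exists>d. (\<forall>i<5. \<forall>x\<in>A i. d x \<in> C i) \<and> proper (\<Union>i<5. A i) d"
    by (rule colour_parts[of 5 A u C]) (fact colA cards disj Ccross)+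
  then obtain d where d: "\<And>i x. i < 5 \<Longrightarrow> x \<in> A i \<Longrightarrow> d x \<in> C i" "proper (\<Union>i<5. A i) d"
    by blast
  define R where "R = (\<Union>i<5. A i)"
  have inR: "x \<in> R" if "i < 5" "x \<in> A i" for x i
    using that by (auto simp: R_def)
  have RV: "R \<subseteq> V"
    using A(1) by (auto simp: R_def)
  have dk: "d x < k" if xR: "x \<in> R" for x
  proof -
    obtain i where i: "i < 5" "x \<in> A i"
      using xR by (auto simp: R_def)
    have "C i \<subseteq> {..<k}"
      using five[OF i(1)] le k s pk by (elim disjE) (auto simp: Ci)
    then show ?thesis
      using d(1)[OF i] by auto
  qed
  have dp: "d x < p" if "x \<in> A 0 \<union> A 1 \<union> A 3" for x
    using that d(1)[of 0 x] d(1)[of 1 x] d(1)[of 3 x] s(2) by (auto simp: Ci p_def)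
  have fA: "finite (A i)" if "i < 5" for i
    using A(1)[OF that] fin finite_subset by blast
  obtain P where P: "P \<subseteq> A 0 \<union> A 1 \<union> A 3" "clique P" "card P = p"
  proof (cases "u 3 \<le> u 0 + u 1")
    case True
    obtain K L where K: "K \<subseteq> A 0" "clique K" "card K = u 0" and L: "L \<subseteq> A 1" "clique L" "card L = u 1"
      using om_attained[OF fA[of 0]] om_attained[OF fA[of 1]]
        unfolding u_def by (metis one_less_numeral_iff semiring_norm(77) zero_less_numeral)
    have "E x y" if "x \<in> K" "y \<in> L" for x y
      using that K(1) L(1) complete[of 0 1 x y] by auto
    then have "clique (K \<union> L)"
      using K(2) L(2) E_sym unfolding clique_def by blast
    moreover have "K \<inter> L = {}"
      using K(1) L(1) disj[of 0 1] by auto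
    then have "card (K \<union> L) = p"
      using K(1,3) L(1,3) fA[of 0] fA[of 1] True finite_subset by (subst card_Un_disjoint) (auto simp:
        p_def)
    ultimately show ?thesis
      using that[of "K \<union> L"] K(1) L(1) by blast
  next
    case False
    obtain K where "K \<subseteq> A 3" "clique K" "card K = u 3"
      using om_attained[OF fA[of 3]] unfolding u_def by auto
    then show ?thesis
      using that[of K] False by (auto simp: p_def)
  qed
  have PR: "P \<subseteq> R"
    using P(1) inR[of 0] inR[of 1] inR[of 3] by auto
  \<comment> \<open>\<open>A 4\<close> is disjoint from \<open>P\<close>, so removing
    \<open>R - P\<close> really makes the graph smaller and minimality applies.\<close>
  obtain z where z: "z \<in> A 4"
    using A(2)[of 4] by auto
  have "z \<notin> P"
    using z P(1) disj[of 4 0 z] disj[of 4 1 z] disj[of 4 3 z] by auto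
  then have "V - (R - P) \<subset> V"
    using inR[of 4 z] z RV by auto
  then obtain c where c: "c ` (V - (R - P)) \<subseteq> {..<k}" "proper (V - (R - P)) c"
    using colourable_sub[of "V - (R - P)"] unfolding colourable_def k_def by blast
  have PV: "P \<subseteq> V - (R - P)"
    using PR RV by auto
  have "inj_on c P"
    using proper_inj_clique[OF c(2) PV P(2)] .
  then have "card (c ` P) = p"
    using P(3) by (simp add: card_image)
  moreover have "c ` P \<subseteq> {..<k}"
    using c(1) PV by blast
  ultimately obtain h where h: "inj_on h {..<k}" "h ` {..<k} \<subseteq> {..<k}" "h ` {..<p} \<subseteq> c ` P"
    using ex_inj_extension[OF pk] by blast
  define e where "e x = (if x \<in> R then h (d x) else c x)" for x
  \<comment> \<open>An outside neighbour \<open>y\<close> of \<open>x\<close> is complete to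
    \<open>P\<close>, so \<open>c y\<close> differs from all colours of \<open>P\<close>, while
    \<open>h (d x)\<close> is one of them.\<close>
  have mixed: "h (d x) \<noteq> c y" if xy: "x \<in> R" "y \<in> V - R" "E x y" for x y
  proof -
    have "\<And>i. i < 5 \<Longrightarrow> y \<notin> A i"
      using xy(2) inR by blast
    then have y: "((\<forall>x\<in>A 0 \<union> A 1 \<union> A 3. E y x) \<and> (\<forall>x\<in>A 2 \<union> A 4. \<not> E y x)) \<or>
        (\<forall>x\<in>A 0 \<union> A 1 \<union> A 2 \<union> A 3 \<union> A 4. \<not> E y x)"
      using out[of y] xy(2) by blast
    obtain i where i: "i < 5" "x \<in> A i"
      using xy(1) by (auto simp: R_def)
    have "x \<in> A 0 \<union> A 1 \<union> A 2 \<union> A 3 \<union> A 4"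
      using five[OF i(1)] i(2) by auto
    then have y': "\<forall>x\<in>A 0 \<union> A 1 \<union> A 3. E y x" "x \<in> A 0 \<union> A 1 \<union> A 3"
      using y E_sym[OF xy(3)] by blast+
    obtain q where q: "q \<in> P" "h (d x) = c q"
      using h(3) dp[OF y'(2)] by (metis image_eqI imageE lessThan_iff subsetD)
    then have "E y q"
      using y'(1) P(1) by blast
    then show ?thesis
      using properD[OF c(2), of y q] q PV xy(2) by auto
  qed
  have "e x < k" if "x \<in> V" for x
    using that dk[of x] h(2) c(1) by (auto simp: e_def)
  then have "e ` V \<subseteq> {..<k}"
    by auto
  moreover have "proper V e"
  proof (rule properI)
    fix x y assume xy: "x \<in> V" "y \<in> V" "E x y"
    consider "x \<in> R" "y \<in> R" | "x \<in> R" "y \<notin> R" | "x \<notin> R" "y \<in> R" | "x \<notin> R" "y \<notin> R"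
      by blast
    then show "e x \<noteq> e y"
    proof cases
      case 1
      then have "d x \<noteq> d y"
        using properD[OF d(2)[folded R_def]] xy(3) by blast
      then show ?thesis
        using 1 h(1) dk[of x] dk[of y] unfolding e_def inj_on_def by auto
    next
      case 2
      then show ?thesis
        using mixed[of x y] xy by (simp add: e_def)
    next
      case 3
      then show ?thesis
        using mixed[of y x] xy E_sym[OF xy(3)] by (simp add: e_def)
    next
      case 4
      then show ?thesis
        using properD[OF c(2), of x y] xy by (simp add: e_def)
    qed
  qed
  ultimately show False
    using excess unfolding colourable_def k_def by blast
qed

text \<open>A vertex that sees only vertex 5 of the copy is possible, so the graph need not be a
  blow-up of \<open>F1\<close>. The classes 0 to 4 still form a blown-up C5: class 5 is complete to
  the classes 0, 1, 3 and has no edges to 2 and 4, and all other outside vertices have no neighbours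
  in the five classes.\<close>

lemma no_F1: "\<not> embeds V F1 f"
proof
  assume f: "embeds V F1 f"
  have rigid: "rigid F1 [[], [5]]"
    using rigid_all(2) .
  have types: "(\<exists>i<length F1. like F1 f i x) \<or> trace f (length F1) x \<in> set [[], [5]]"
    if "embeds V F1 f" "x \<in> V" for f x
    using closed_cases[OF closed_F1 pg _ that] no_F2 no_F3 by fastforce
  define A where "A i = {x \<in> V. like F1 f i x}" for i
  have adj: "E x y \<longleftrightarrow> adj F1 i j" if "i < 6" "j < 6" "i \<noteq> j" "x \<in> A i" "y \<in> A j" for i j x y
    using like_adj[OF pg rigid f types, of x i y j] that by (auto simp: A_def length_F)
  have F1_F0: "adj F1 i j \<longleftrightarrow> adj F0 i j" if "i < 5" "j < 5" for i j
    using that by (simp add: F1_def adj_def nth_append length_F)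
  show False
  proof (rule no_pendant_C5[of A])
    show "A i \<subseteq> V" for i
      by (auto simp: A_def)
    show "A i \<noteq> {}" if "i < 5" for i
      using that like_self[OF f, of i] embedsD(1)[OF f, of i] by (auto simp: A_def length_F)
    show "i = j" if "i < 5" "j < 5" "x \<in> A i" "x \<in> A j" for i j x
      using that like_unique[OF rigid, of i j f x] by (auto simp: A_def length_F)
    show "E x y \<longleftrightarrow> adj F0 i j" if "i < 5" "j < 5" "i \<noteq> j" "x \<in> A i" "y \<in> A j" for i j x y
      using adj[of i j x y] F1_F0[of i j] that by simp
    fix y assume y: "y \<in> V" "\<And>i. i < 5 \<Longrightarrow> y \<notin> A i"
    have "like F1 f 5 y \<or> trace f (length F1) y \<in> set [[], [5]]"
    proof (rule ccontr)
      assume no: "\<not> ?thesis"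
      then obtain i where i: "i < 6" "like F1 f i y"
        using types[OF f y(1)] by (auto simp: length_F)
      then have "i \<noteq> 5"
        using no by blast
      then show False
        using y(2)[of i] i y(1) by (simp add: A_def)
    qed
    then show "((\<forall>x\<in>A 0 \<union> A 1 \<union> A 3. E y x) \<and> (\<forall>x\<in>A 2 \<union> A 4. \<not> E y x)) \<or>
        (\<forall>x\<in>A 0 \<union> A 1 \<union> A 2 \<union> A 3 \<union> A 4. \<not> E y x)"
    proof
      assume "like F1 f 5 y"
      then have "y \<in> A 5"
        using y(1) by (simp add: A_def)
      then have *: "E y x \<longleftrightarrow> adj F1 5 i" if "i < 5" "x \<in> A i" for i x
        using adj[of 5 i y x] that by simp
      moreover have "adj F1 5 0" "adj F1 5 1" "\<not> adj F1 5 2" "adj F1 5 3" "\<not> adj F1 5 4"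
        by code_simp+
      ultimately have "((\<forall>x\<in>A 0 \<union> A 1 \<union> A 3. E y x) \<and> (\<forall>x\<in>A 2 \<union> A 4. \<not> E y x))"
        using *[of 0] *[of 1] *[of 2] *[of 3] *[of 4] by auto
      then show ?thesis ..
    next
      assume tr: "trace f (length F1) y \<in> set [[], [5]]"
      have *: "\<not> E y x" if "i < 5" "x \<in> A i" for i x
        by (rule outsider_nonadjacent[OF rigid f types _ _ _ y(1) tr,
          of x i]) (use that in \<open>auto simp: A_def length_F\<close>)
      have "\<forall>x\<in>A 0 \<union> A 1 \<union> A 2 \<union> A 3 \<union> A 4. \<not> E y x"
        using *[of 0] *[of 1] *[of 2] *[of 3] *[of 4] by auto
      then show ?thesis ..
    qed
  qed
qed

text \<open>All vertices lie in the five parts, so the condition on outside vertices in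
  \<open>no_pendant_C5\<close> is vacuous.\<close>

lemma no_F0: "\<not> embeds V F0 f"
proof
  assume f: "embeds V F0 f"
  then obtain cl where "blow_up E V F0 cl"
    by (rule blow_up_exists[OF _ closed_F0]) (use rigid_all(1) no_F1 length_F in auto)
  then interpret blow_up E V F0 cl .
  show False
  proof (rule no_pendant_C5[of part])
    show "part i \<noteq> {}" if "i < 5" for i
      using occupied[of i] that by (auto simp: part_def length_F)
    show "E x y \<longleftrightarrow> adj F0 i j" if "i < 5" "j < 5" "i \<noteq> j" "x \<in> part i" "y \<in> part j" for i j x y
      using cross[of x y] that by (auto simp: part_def)
    show "((\<forall>x\<in>part 0 \<union> part 1 \<union> part 3. E y x) \<and> (\<forall>x\<in>part 2 \<union> part 4. \<not> E y x)) \<or>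
        (\<forall>x\<in>part 0 \<union> part 1 \<union> part 2 \<union> part 3 \<union> part 4. \<not> E y x)"
      if "y \<in> V" "\<And>i. i < 5 \<Longrightarrow> y \<notin> part i" for y
      using that(2)[of "cl y"] cl_less[OF that(1)] that(1) by (simp add: part_def length_F)
  qed (auto simp: part_def)
qed

lemma contradiction: False
proof -
  have "C5_free V"
    unfolding C5_free_def
  proof (intro allI impI notI)
    fix a b c d e assume V: "{a, b, c, d, e} \<subseteq> V" and C5: "is_C5 a b c d e"
    have "embeds V F0 ((!) [a, b, c, d, e])"
      using V C5 unfolding embeds_def F0_def is_C5_def
      by (simp add: All_less_Suc eval_nat_numeral adj_def E_commute)
    then show False
      using no_F0 by blast
  qed
  then have "colourable V (om V)"
    by (rule colourable_om_if_C5_free[OF fin pg])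
  then show False
    using excess colourable_mono[of V "om V" "bd (om V)" V] le_bd(1) by blast
qed

end

context adj_graph
begin

lemma colourable_five_fourths:
  assumes "finite V" "pg_free V"
  shows "colourable V (bd (om V))"
  using assms
proof (induction V rule: finite_psubset_induct)
  case (psubset V)
  show ?case
  proof (rule ccontr)
    assume "\<not> colourable V (bd (om V))"
    then interpret minimal_excess E V
      using psubset by unfold_locales (auto intro: pg_free_subset)
    show False
      using contradiction .
  qed
qed

end

section \<open>The bound and its tightness\<close>

text \<open>An isomorphism consists of a vertex map and an arc map. Since arcs are pairs of their
  ends on both sides, the vertex map determines the arc map, and its inverse is the embedding of
  \<open>H\<close>.\<close>

lemma induced_free_iff:
  fixes G :: "'a pair_pre_digraph" and H :: "'b pair_pre_digraph"
  assumes "pair_wf_digraph G" "pair_wf_digraph H"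
  shows "induced_free G H \<longleftrightarrow> \<not> (\<exists>f. inj_on f (pverts H) \<and> f ` pverts H \<subseteq> pverts G \<and>
    (\<forall>u\<in>pverts H. \<forall>v\<in>pverts H. (u, v) \<in> parcs H \<longleftrightarrow> (f u, f v) \<in> parcs G))"
    (is "_ \<longleftrightarrow> \<not> ?emb")
proof -
  interpret G: pair_wf_digraph G by fact
  interpret H: pair_wf_digraph H by fact
  have "?emb" if K: "induced_subgraph K (with_proj G)" "digraph_iso K (with_proj H)" for K
  proof -
    obtain h where h: "pre_digraph.digraph_isomorphism K h" "with_proj H = app_iso h K"
      using K(2) unfolding digraph_iso_def by blast
    have vK: "verts K \<subseteq> pverts G" and aK: "arcs K = {e \<in> parcs G. fst e \<in> verts K \<and> snd e \<in> verts K}"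
      and ends: "tail K = fst" "head K = snd"
      using K(1) by (auto simp: induced_subgraph_def subgraph_def compatible_def)
    have inj: "inj_on (iso_verts h) (verts K)"
      and arc: "\<And>a. a \<in> arcs K \<Longrightarrow> iso_verts h (fst a) = iso_tail h (iso_arcs h a)"
        "\<And>a. a \<in> arcs K \<Longrightarrow> iso_verts h (snd a) = iso_head h (iso_arcs h a)"
      using h(1) ends by (auto simp: pre_digraph.digraph_isomorphism_def)
    have H: "pverts H = iso_verts h ` verts K" "parcs H = iso_arcs h ` arcs K" "iso_tail h = fst"
      "iso_head h = snd"
      using arg_cong[OF h(2), of verts] arg_cong[OF h(2), of arcs] arg_cong[OF h(2), of tail]
        arg_cong[OF h(2), of head] by simp_all
    define f where "f = the_inv_into (verts K) (iso_verts h)"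
    have f: "f (iso_verts h x) = x" if "x \<in> verts K" for x
      unfolding f_def using inj that by (rule the_inv_into_f_f)
    have "(u, v) \<in> parcs H \<longleftrightarrow> (f u, f v) \<in> parcs G" if uv: "u \<in> pverts H" "v \<in> pverts H" for u v
    proof -
      obtain x y where xy: "x \<in> verts K" "y \<in> verts K" "u = iso_verts h x" "v = iso_verts h y"
        using uv H(1) by auto
      have iff: "iso_arcs h (a, b) = (iso_verts h a, iso_verts h b)" if "(a, b) \<in> arcs K" for a b
        using arc[OF that] H(3,4) by (simp add: prod_eq_iff)
      show ?thesis
      proof
        assume "(u, v) \<in> parcs H"
        then obtain a b where ab: "(a, b) \<in> arcs K" "(u, v) = iso_arcs h (a, b)"
          using H(2) by auto
        then have "a \<in> verts K" "b \<in> verts K" "iso_verts h a = u" "iso_verts h b = v"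
          using iff[OF ab(1)] aK by auto
        then have "a = x" "b = y"
          using xy inj by (auto dest: inj_onD)
        then show "(f u, f v) \<in> parcs G"
          using ab(1) aK f xy by auto
      next
        assume "(f u, f v) \<in> parcs G"
        then have "(x, y) \<in> arcs K"
          using aK f xy by auto
        then show "(u, v) \<in> parcs H"
          using iff[of x y] H(2) xy(3,4) by force
      qed
    qed
    moreover have "inj_on f (pverts H)" "f ` pverts H \<subseteq> pverts G"
      using H(1) f vK by (auto simp: inj_on_def)
    ultimately show ?thesis
      by blast
  qed
  moreover have "\<exists>K. induced_subgraph K (with_proj G) \<and> digraph_iso K (with_proj H)" if ?emb
  proof -
    obtain f where f: "inj_on f (pverts H)" "f ` pverts H \<subseteq> pverts G"
      "\<And>u v. u \<in> pverts H \<Longrightarrow> v \<in> pverts H \<Longrightarrow> (u, v) \<in> parcs H \<longleftrightarrow> (f u, f v) \<in> parcs G"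
      using \<open>?emb\<close> by blast
    define K where "K = \<lparr>verts = f ` pverts H, arcs = {(x, y) \<in> parcs G. x \<in> f ` pverts H \<and>
      y \<in> f ` pverts H},
      tail = fst, head = snd\<rparr>"
    have wf: "wf_digraph K"
      by unfold_locales (auto simp: K_def)
    have "wf_digraph (with_proj G)"
      by unfold_locales (auto simp: G.arc_fst_in_verts G.arc_snd_in_verts)
    then have induced: "induced_subgraph K (with_proj G)"
      using wf f(2) by (auto simp: induced_subgraph_def subgraph_def compatible_def K_def)
    define g where "g = the_inv_into (pverts H) f"
    define h where "h = \<lparr>iso_verts = g, iso_arcs = (\<lambda>(x, y). (g x, g y)), iso_head = snd, iso_tail = fst\<rparr>"
    have g: "g (f u) = u" if "u \<in> pverts H" for u
      unfolding g_def using f(1) that by (rule the_inv_into_f_f)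
    have "inj_on g (f ` pverts H)"
      using g by (auto simp: inj_on_def)
    moreover have "inj_on (\<lambda>(x, y). (g x, g y)) {(x, y) \<in> parcs G. x \<in> f ` pverts H \<and> y \<in> f ` pverts H}"
      using g by (auto simp: inj_on_def)
    ultimately have "pre_digraph.digraph_isomorphism K h"
      using wf by (auto simp: pre_digraph.digraph_isomorphism_def h_def K_def)
    moreover have "with_proj H = app_iso h K"
    proof -
      have "(\<lambda>(x, y). (g x, g y)) ` {(x, y) \<in> parcs G. x \<in> f ` pverts H \<and> y \<in> f ` pverts H} = parcs H"
      proof (intro equalityI subsetI)
        fix a assume "a \<in> (\<lambda>(x, y). (g x, g y)) ` {(x, y) \<in> parcs G. x \<in> f ` pverts H \<and> y \<in> f ` pverts H}"
        then show "a \<in> parcs H"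
          using f(3) g by auto
      next
        fix a assume a: "a \<in> parcs H"
        then have "fst a \<in> pverts H" "snd a \<in> pverts H" "a = (fst a, snd a)"
          using H.arc_fst_in_verts H.arc_snd_in_verts by auto
        then show "a \<in> (\<lambda>(x, y). (g x, g y)) ` {(x, y) \<in> parcs G. x \<in> f ` pverts H \<and> y \<in> f ` pverts H}"
          using f(3)[of "fst a" "snd a"] a g by (intro image_eqI[of _ _ "(f (fst a), f (snd a))"]) auto
      qed
      moreover have "g ` f ` pverts H = pverts H"
        using g by force
      ultimately show ?thesis
        by (simp add: app_iso_def h_def K_def with_proj_def)
    qed
    ultimately show ?thesis
      unfolding digraph_iso_def using induced by (intro exI[of _ K] conjI exI[of _ h])
  qed
  ultimately show ?thesis
    unfolding induced_free_def by blast
qed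

lemma lessThan_5: "{..<5::nat} = {0, 1, 2, 3, 4}"
  by auto

lemma lessThan_4: "{..<4::nat} = {0, 1, 2, 3}"
  by auto

lemma adj_graph_pair_graph: "pair_graph G \<Longrightarrow> adj_graph (\<lambda>u v. (u, v) \<in> parcs G)"
proof -
  assume "pair_graph G"
  then interpret pair_graph G .
  show ?thesis
    by unfold_locales (auto intro: arcs_symmetric dest: no_loops)
qed

lemma P5_gem_free_iff:
  assumes "pair_graph G"
  shows "P5_gem_free G \<longleftrightarrow> adj_graph.pg_free (\<lambda>u v. (u, v) \<in> parcs G) (pverts G)"
proof -
  interpret G: pair_graph G by fact
  interpret A: adj_graph "\<lambda>u v. (u, v) \<in> parcs G"
    using adj_graph_pair_graph[OF assms] .
  interpret P: pair_graph "path_graph 5"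
    by (rule pair_graph_path_graph)
  interpret Q: pair_graph gem
    by (rule pair_graph_gem)
  let ?E = "\<lambda>u v. (u, v) \<in> parcs G"
  have P5: "\<not> induced_free G (path_graph 5) \<longleftrightarrow>
    (\<exists>a b c d e. {a, b, c, d, e} \<subseteq> pverts G \<and> A.is_P5 a b c d e)"
  proof
    assume "\<not> induced_free G (path_graph 5)"
    then obtain f where f: "f ` pverts (path_graph 5) \<subseteq> pverts G"
      "\<And>u v. u \<in> pverts (path_graph 5) \<Longrightarrow> v \<in> pverts (path_graph 5) \<Longrightarrow>
        (u, v) \<in> parcs (path_graph 5) \<longleftrightarrow> (f u, f v) \<in> parcs G"
      using induced_free_iff[OF G.pair_wf_digraph P.pair_wf_digraph] by blast
    have "A.is_P5 (f 0) (f 1) (f 2) (f 3) (f 4)"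
      unfolding A.is_P5_def by (simp add: f(2)[symmetric] path_graph_def)
    moreover have "{f 0, f 1, f 2, f 3, f 4} \<subseteq> pverts G"
      using f(1) by (auto simp: path_graph_def)
    ultimately show "\<exists>a b c d e. {a, b, c, d, e} \<subseteq> pverts G \<and> A.is_P5 a b c d e"
      by blast
  next
    assume "\<exists>a b c d e. {a, b, c, d, e} \<subseteq> pverts G \<and> A.is_P5 a b c d e"
    then obtain a b c d e where V: "{a, b, c, d, e} \<subseteq> pverts G" and p: "A.is_P5 a b c d e"
      by blast
    let ?f = "(!) [a, b, c, d, e]"
    \<comment> \<open>Equal images would have the same neighbours, which the edges and non-edges in
      \<open>is_P5\<close> exclude.\<close>
    have "inj_on ?f (pverts (path_graph 5))"
      using p A.E_sym A.E_irrefl unfolding A.is_P5_def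
      by (auto simp: path_graph_def lessThan_5)
    moreover have "?f ` pverts (path_graph 5) \<subseteq> pverts G"
      using V by (auto simp: path_graph_def lessThan_5)
    moreover have "\<forall>u\<in>pverts (path_graph 5). \<forall>v\<in>pverts (path_graph 5).
        (u, v) \<in> parcs (path_graph 5) \<longleftrightarrow> (?f u, ?f v) \<in> parcs G"
      using p A.E_sym A.E_irrefl unfolding A.is_P5_def
      by (auto simp: path_graph_def lessThan_5)
    ultimately show "\<not> induced_free G (path_graph 5)"
      unfolding induced_free_iff[OF G.pair_wf_digraph P.pair_wf_digraph] by blast
  qed
  have gem: "\<not> induced_free G gem \<longleftrightarrow>
    (\<exists>a b c d e. {a, b, c, d, e} \<subseteq> pverts G \<and> A.is_gem a b c d e)"
  proof
    assume "\<not> induced_free G gem"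
    then obtain f where f: "f ` pverts gem \<subseteq> pverts G"
      "\<And>u v. u \<in> pverts gem \<Longrightarrow> v \<in> pverts gem \<Longrightarrow> (u, v) \<in> parcs gem \<longleftrightarrow> (f u, f v) \<in> parcs G"
      using induced_free_iff[OF G.pair_wf_digraph Q.pair_wf_digraph] by blast
    have "A.is_gem (f 0) (f 1) (f 2) (f 3) (f 4)"
      unfolding A.is_gem_def by (simp add: f(2)[symmetric] path_graph_def gem_def)
    moreover have "{f 0, f 1, f 2, f 3, f 4} \<subseteq> pverts G"
      using f(1) by (auto simp: path_graph_def gem_def)
    ultimately show "\<exists>a b c d e. {a, b, c, d, e} \<subseteq> pverts G \<and> A.is_gem a b c d e"
      by blast
  next
    assume "\<exists>a b c d e. {a, b, c, d, e} \<subseteq> pverts G \<and> A.is_gem a b c d e"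
    then obtain a b c d e where V: "{a, b, c, d, e} \<subseteq> pverts G" and p: "A.is_gem a b c d e"
      by blast
    let ?f = "(!) [a, b, c, d, e]"
    have "inj_on ?f (pverts gem)"
      using p A.E_sym A.E_irrefl unfolding A.is_gem_def
      by (auto simp: path_graph_def gem_def lessThan_4)
    moreover have "?f ` pverts gem \<subseteq> pverts G"
      using V by (auto simp: path_graph_def gem_def lessThan_4)
    moreover have "\<forall>u\<in>pverts gem. \<forall>v\<in>pverts gem. (u, v) \<in> parcs gem \<longleftrightarrow> (?f u, ?f v) \<in> parcs G"
      using p A.E_sym A.E_irrefl unfolding A.is_gem_def
      by (auto simp: path_graph_def gem_def lessThan_4)
    ultimately show "\<not> induced_free G gem"
      unfolding induced_free_iff[OF G.pair_wf_digraph Q.pair_wf_digraph] by blast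
  qed
  show ?thesis
    unfolding P5_gem_free_def A.pg_free_def using P5 gem by meson
qed

lemma upper_bound:
  assumes G: "pair_graph G" and free: "P5_gem_free G"
  shows "int (chromatic_number G) \<le> \<lceil>5 * real (clique_number G) / 4\<rceil>"
proof -
  interpret pair_graph G by fact
  interpret A: adj_graph "\<lambda>u v. (u, v) \<in> parcs G"
    using adj_graph_pair_graph[OF G] .
  have om: "clique_number G = A.om (pverts G)"
    unfolding clique_number_def A.om_def is_clique_def A.clique_def ..
  have "A.colourable (pverts G) (bd (clique_number G))"
    unfolding om using A.colourable_five_fourths[OF pair_finite_verts] P5_gem_free_iff[OF G] free by blast
  then obtain c :: "'a \<Rightarrow> nat" where c: "c ` pverts G \<subseteq> {..<bd (clique_number G)}" "A.proper (pverts G) c"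
    unfolding A.colourable_def by blast
  have "proper_colouring G (bd (clique_number G)) c"
    unfolding proper_colouring_def using c(1) A.properD[OF c(2) in_arcsD1 in_arcsD2] by blast
  then have "chromatic_number G \<le> bd (clique_number G)"
    unfolding chromatic_number_def by (intro Least_le) blast
  moreover have "int (bd (clique_number G)) \<le> \<lceil>5 * real (clique_number G) / 4\<rceil>"
  proof -
    have "4 * bd (clique_number G) \<le> 5 * clique_number G + 3"
      unfolding bd_def by simp
    then show ?thesis
      unfolding le_ceiling_iff by linarith
  qed
  ultimately show ?thesis
    by linarith
qed

text \<open>Adjacency in the five-cycle on the residues modulo 5, made reflexive because the
  vertices of one residue form a clique.\<close>

definition close :: "nat \<Rightarrow> nat \<Rightarrow> bool" where
  "close a b \<longleftrightarrow> a = b \<or> (a + 1) mod 5 = b \<or> (b + 1) mod 5 = a"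

definition C5_blow_up :: "nat \<Rightarrow> nat pair_pre_digraph" where
  "C5_blow_up q = \<lparr>pverts = {..<5 * q},
     parcs = {(u, v). u < 5 * q \<and> v < 5 * q \<and> u \<noteq> v \<and> close (u mod 5) (v mod 5)}\<rparr>"

text \<open>Distinct non-adjacent vertices have residues that are not close, so an induced P4 runs
  through four consecutive residues. A residue close to the last of them is close to one of the
  other three, and, for \<open>close_gem\<close>, none is close to all four.\<close>

lemma close_P5: "\<forall>a\<in>set [0..<5]. \<forall>b\<in>set [0..<5]. close a b \<longrightarrow>
    (\<forall>c\<in>set [0..<5]. close b c \<and> \<not> close a c \<longrightarrow>
    (\<forall>d\<in>set [0..<5]. close c d \<and> \<not> close a d \<and> \<not> close b d \<longrightarrow>
    (\<forall>e\<in>set [0..<5]. close d e \<longrightarrow> close a e \<or> close b e \<or> close c e)))"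
  by code_simp

lemma close_gem: "\<forall>a\<in>set [0..<5]. \<forall>b\<in>set [0..<5]. close a b \<longrightarrow>
    (\<forall>c\<in>set [0..<5]. close b c \<and> \<not> close a c \<longrightarrow>
    (\<forall>d\<in>set [0..<5]. close c d \<and> \<not> close a d \<and> \<not> close b d \<longrightarrow>
    (\<forall>e\<in>set [0..<5]. \<not> (close e a \<and> close e b \<and> close e c \<and> close e d))))"
  by code_simp

text \<open>The five-cycle has neither a stable set of size three nor a triangle. The first bounds
  the colour classes of the blow-up, the second the number of residues in a clique.\<close>

lemma close_triple: "\<forall>a\<in>set [0..<5]. \<forall>b\<in>set [0..<5]. \<forall>c\<in>set [0..<5]. a = b \<or> b = c \<or> a = c \<or>
    ((close a b \<or> close b c \<or> close a c) \<and> \<not> (close a b \<and> close b c \<and> close a c))"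
  by code_simp

lemma card_le_2:
  assumes "finite S" "\<And>x y z. x \<in> S \<Longrightarrow> y \<in> S \<Longrightarrow> z \<in> S \<Longrightarrow> x = y \<or> y = z \<or> x = z"
  shows "card S \<le> 2"
proof (rule ccontr)
  assume "\<not> ?thesis"
  then obtain T where T: "T \<subseteq> S" "card T = 3"
    using obtain_subset_with_card_n[of 3 S] by auto
  then obtain x y z where "T = {x, y, z}" "x \<noteq> y" "y \<noteq> z" "x \<noteq> z"
    by (auto simp: card_3_iff)
  then show False
    using assms(2)[of x y z] T(1) by auto
qed

lemma pair_graph_C5_blow_up: "pair_graph (C5_blow_up q)"
  by (rule pair_graphI) (auto simp: C5_blow_up_def sym_def irrefl_def close_def)

lemma mod5: "u mod 5 \<in> set [0..<5]" for u :: nat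
  by simp

lemma P5_gem_free_C5_blow_up: "P5_gem_free (C5_blow_up q)"
proof -
  let ?G = "C5_blow_up q"
  interpret A: adj_graph "\<lambda>u v. (u, v) \<in> parcs ?G"
    using adj_graph_pair_graph[OF pair_graph_C5_blow_up] .
  have E: "(u, v) \<in> parcs ?G \<longleftrightarrow> u \<noteq> v \<and> close (u mod 5) (v mod 5)" if "u < 5 * q" "v < 5 * q" for u v
    using that by (simp add: C5_blow_up_def)
  have V: "pverts ?G = {..<5 * q}"
    by (simp add: C5_blow_up_def)
  let ?close = "\<lambda>u v. close (u mod 5) (v mod 5)"
  have "\<not> A.is_P5 a b c d e" if abcde: "{a, b, c, d, e} \<subseteq> pverts ?G" for a b c d e
  proof
    assume p: "A.is_P5 a b c d e"
    have ne: "a \<noteq> c" "a \<noteq> d" "a \<noteq> e" "b \<noteq> d" "b \<noteq> e" "c \<noteq> e"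
      using p A.E_sym unfolding A.is_P5_def by blast+
    have "a < 5 * q" "b < 5 * q" "c < 5 * q" "d < 5 * q" "e < 5 * q"
      using abcde V by auto
    then have "?close a b" "?close b c \<and> \<not> ?close a c" "?close c d \<and> \<not> ?close a d \<and> \<not> ?close b d"
      "?close d e" "\<not> (?close a e \<or> ?close b e \<or> ?close c e)"
      using p ne unfolding A.is_P5_def by (simp_all add: E)
    then show False
      using close_P5[THEN bspec, OF mod5, THEN bspec, OF mod5, THEN mp, THEN bspec, OF _ mod5,
          THEN mp, THEN bspec, OF _ _ mod5, THEN mp, THEN bspec, OF _ _ _ mod5, THEN mp, of a b c d e]
      by fast
  qed
  moreover have "\<not> A.is_gem a b c d e" if abcde: "{a, b, c, d, e} \<subseteq> pverts ?G" for a b c d e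
  proof
    assume p: "A.is_gem a b c d e"
    have ne: "a \<noteq> c" "a \<noteq> d" "b \<noteq> d"
      using p A.E_sym unfolding A.is_gem_def by blast+
    have "a < 5 * q" "b < 5 * q" "c < 5 * q" "d < 5 * q" "e < 5 * q"
      using abcde V by auto
    then have "?close a b" "?close b c \<and> \<not> ?close a c" "?close c d \<and> \<not> ?close a d \<and> \<not> ?close b d"
      "?close e a \<and> ?close e b \<and> ?close e c \<and> ?close e d"
      using p ne A.E_sym unfolding A.is_gem_def by (simp_all add: E)
    then show False
      using close_gem[THEN bspec, OF mod5, THEN bspec, OF mod5, THEN mp, THEN bspec, OF _ mod5,
          THEN mp, THEN bspec, OF _ _ mod5, THEN mp, THEN bspec, OF _ _ _ mod5, of a b c d e]
      by fast
  qed
  ultimately show ?thesis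
    unfolding P5_gem_free_iff[OF pair_graph_C5_blow_up] A.pg_free_def by simp
qed

lemma card_residue_class:
  fixes q :: nat
  assumes "i < 5"
  shows "card {u. u < 5 * q \<and> u mod 5 = i} = q"
proof -
  have "bij_betw (\<lambda>k. 5 * k + i) {..<q} {u. u < 5 * q \<and> u mod 5 = i}"
    unfolding bij_betw_def
  proof
    show "(\<lambda>k. 5 * k + i) ` {..<q} = {u. u < 5 * q \<and> u mod 5 = i}"
    proof (intro equalityI subsetI)
      fix u assume "u \<in> {u. u < 5 * q \<and> u mod 5 = i}"
      then have "u = 5 * (u div 5) + i" "u div 5 < q"
        by auto
      then show "u \<in> (\<lambda>k. 5 * k + i) ` {..<q}"
        by blast
    qed (use assms in auto)
  qed (auto simp: inj_on_def)
  then show ?thesis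
    using bij_betw_same_card by fastforce
qed

lemma clique_number_C5_blow_up: "clique_number (C5_blow_up q) = 2 * q"
proof (rule antisym)
  let ?G = "C5_blow_up q"
  have C: "is_clique ?G {u. u < 5 * q \<and> (u mod 5 = 0 \<or> u mod 5 = 1)}"
    by (auto simp: is_clique_def C5_blow_up_def close_def)
  have "{u. u < 5 * q \<and> (u mod 5 = 0 \<or> u mod 5 = 1)} =
      {u. u < 5 * q \<and> u mod 5 = 0} \<union> {u. u < 5 * q \<and> u mod 5 = 1}"
    by auto
  moreover have "card \<dots> = q + q"
    by (subst card_Un_disjoint) (auto simp: card_residue_class)
  ultimately show "2 * q \<le> clique_number ?G"
    using clique_number_attained(2)[OF pair_graph_C5_blow_up C] by simp
  obtain K where K: "is_clique ?G K" "card K = clique_number ?G"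
    using clique_number_attained(1)[OF pair_graph_C5_blow_up] by blast
  have lt: "K \<subseteq> {..<5 * q}"
    using K(1) by (auto simp: is_clique_def C5_blow_up_def)
  have close: "close (u mod 5) (v mod 5)" if "u \<in> K" "v \<in> K" "u \<noteq> v" for u v
    using K(1) that by (auto simp: is_clique_def C5_blow_up_def)
  let ?S = "(\<lambda>u. u mod 5) ` K"
  have finK: "finite K"
    using lt finite_subset by blast
  have "card ?S \<le> 2"
  proof (rule card_le_2)
    fix x y z assume "x \<in> ?S" "y \<in> ?S" "z \<in> ?S"
    then obtain u v w where uvw: "u \<in> K" "v \<in> K" "w \<in> K" "x = u mod 5" "y = v mod 5" "z = w mod 5"
      by blast
    show "x = y \<or> y = z \<or> x = z"
      using close_triple[THEN bspec, OF mod5[of u], THEN bspec, OF mod5[of v], THEN bspec, OF mod5[of w]]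
        close[of u v] close[of v w] close[of u w] uvw by blast
  qed (use finK in simp)
  have "K \<subseteq> (\<Union>i\<in>?S. {u. u < 5 * q \<and> u mod 5 = i})"
    using lt by auto
  then have "card K \<le> card (\<Union>i\<in>?S. {u. u < 5 * q \<and> u mod 5 = i})"
    using finK by (intro card_mono) auto
  also have "\<dots> \<le> (\<Sum>i\<in>?S. card {u. u < 5 * q \<and> u mod 5 = i})"
    using finK by (intro card_UN_le) auto
  also have "\<dots> = (\<Sum>i\<in>?S. q)"
    by (intro sum.cong) (auto simp: card_residue_class)
  also have "\<dots> \<le> 2 * q"
    using \<open>card ?S \<le> 2\<close> by simp
  finally show "clique_number ?G \<le> 2 * q"
    using K(2) by simp
qed

lemma chromatic_number_C5_blow_up: "5 * q \<le> 2 * chromatic_number (C5_blow_up q)"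
proof -
  let ?G = "C5_blow_up q" and ?k = "chromatic_number (C5_blow_up q)"
  obtain c where c: "proper_colouring ?G ?k c"
    using chromatic_number_attained[OF pair_graph_C5_blow_up] by blast
  have far: "\<not> close (u mod 5) (v mod 5)" if "u < 5 * q" "v < 5 * q" "c u = c v" "u \<noteq> v" for u v
    using c that by (auto simp: proper_colouring_def C5_blow_up_def)
  have colour_class: "card {u. u < 5 * q \<and> c u = i} \<le> 2" for i
  proof (rule card_le_2)
    fix u v w assume uvw: "u \<in> {u. u < 5 * q \<and> c u = i}" "v \<in> {u. u < 5 * q \<and> c u = i}"
      "w \<in> {u. u < 5 * q \<and> c u = i}"
    have refl: "close x x" for x
      by (simp add: close_def)
    show "u = v \<or> v = w \<or> u = w"
      using close_triple[THEN bspec, OF mod5[of u], THEN bspec, OF mod5[of v], THEN bspec, OF mod5[of w]]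
        far[of u v] far[of v w] far[of u w] uvw refl by (metis (mono_tags, lifting) mem_Collect_eq)
  qed simp
  have "{..<5 * q} \<subseteq> (\<Union>i<?k. {u. u < 5 * q \<and> c u = i})"
    using c by (auto simp: proper_colouring_def C5_blow_up_def)
  then have "card {..<5 * q} \<le> card (\<Union>i<?k. {u. u < 5 * q \<and> c u = i})"
    by (intro card_mono) auto
  also have "\<dots> \<le> (\<Sum>i<?k. card {u. u < 5 * q \<and> c u = i})"
    by (intro card_UN_le) auto
  also have "\<dots> \<le> (\<Sum>i<?k. 2)"
    by (intro sum_mono colour_class)
  finally show ?thesis
    by simp
qed

theorem theorem1:
  shows "(\<forall>G :: 'a pair_pre_digraph. pair_graph G \<and> P5_gem_free G \<longrightarrow>
            int (chromatic_number G) \<le> \<lceil>5 * real (clique_number G) / 4\<rceil>) \<and>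
         (\<forall>q :: nat. q > 0 \<longrightarrow>
            (\<exists>G :: nat pair_pre_digraph. pair_graph G \<and> P5_gem_free G \<and>
               clique_number G = 2 * q \<and>
               int (chromatic_number G) = \<lceil>5 * real (clique_number G) / 4\<rceil>))"
proof (intro conjI allI impI)
  fix G :: "'a pair_pre_digraph"
  assume "pair_graph G \<and> P5_gem_free G"
  then show "int (chromatic_number G) \<le> \<lceil>5 * real (clique_number G) / 4\<rceil>"
    using upper_bound by blast
next
  fix q :: nat
  let ?G = "C5_blow_up q"
  have "\<lceil>5 * real (clique_number ?G) / 4\<rceil> \<le> int (chromatic_number ?G)"
    unfolding ceiling_le_iff clique_number_C5_blow_up using chromatic_number_C5_blow_up[of q] by linarith
  then have "int (chromatic_number ?G) = \<lceil>5 * real (clique_number ?G) / 4\<rceil>"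
    using upper_bound[OF pair_graph_C5_blow_up P5_gem_free_C5_blow_up, of q] by linarith
  then show "\<exists>G :: nat pair_pre_digraph. pair_graph G \<and> P5_gem_free G \<and>
      clique_number G = 2 * q \<and> int (chromatic_number G) = \<lceil>5 * real (clique_number G) / 4\<rceil>"
    using pair_graph_C5_blow_up P5_gem_free_C5_blow_up clique_number_C5_blow_up by blast
qed

end
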